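(* Let $d\ge 1$, $L>0$, $T>0$, and let $N\ge 2$ be an integer power of $2$. Let $(p_t)_{t\in[0,T]}$ be a family of probability density functions on $\mathbb{T}^d$ (so $p_t\ge 0$ and $\int_{\mathbb{T}^d}p_t(x)\,dx=1$) and $(V_t)_{t\in[0,T]}$ a family of real-valued functions on $\mathbb{T}^d$ such that $p_t$ satisfies the continuity equation $\frac{\partial}{\partial t}p_t(x)=-\nabla\cdot\big[p_t(x)\nabla V_t(x)\big]$ on $\mathbb{T}^d\times[0,T]$. Suppose that $\sqrt{p_t},\,V_t\in\mathsf{C}^{2(s+1)}$ for all $t\in[0,T]$, for some integer $s\ge (d+7)/4$, and that for every $x\in\mathbb{T}^d$ the functions $t\mapsto V_t(x)$, $t\mapsto \nabla^2\sqrt{p_t}(x)$ and $t\mapsto \nabla^2[V_t\sqrt{p_t}](x)$ are continuous on $[0,T]$. For $t\in[0,T]$ let $\ket{\psi_t}\in\mathbb{C}^{N^d}$ be the unit vector proportional to $\sum_{x\in\mathbb{X}_N^d}\sqrt{p_t(x)}\ket{x}$. Let $\ket{\phi_0}\in\mathbb{C}^{N^d}$ be a unit vector and let $\ket{\phi_t}$ be the solution of $i\frac{d}{dt}\ket{\phi_t}=H_t^c\ket{\phi_t}$ on $[0,T]$ with this initial condition, where $H_t^c=i[K,D_{V_t}]$. Define $$c_s=3\max_{t\in[0,T]}\Big[\big(\|V_t\|_{\mathsf{L}^\infty}+1\big)\big\|\nabla^{2(s+1)}\sqrt{p_t}\big\|_{\mathsf{L}^2}+\big\|\nabla^{2(s+1)}(V_t\sqrt{p_t})\big\|_{\mathsf{L}^2}\Big]+1$$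 and $$\delta=\big\|\ket{\psi_0}-\ket{\phi_0}\big\|+T\,c_s\Big(\frac{Ld}{N}\Big)^{2s},$$ where $\|\cdot\|$ is the Euclidean norm. If $\delta\le T$, then $\big\|\ket{\psi_T}-\ket{\phi_T}\big\|\le\delta$.
   Context: $\mathbb{T}^d$ denotes the cube $[0,L]^d$ with opposite faces identified. $\mathbb{X}_N=\frac{L}{N}\{0,1,\dots,N-1\}$ and $\mathbb{X}_N^d\subset\mathbb{T}^d$ is the uniform grid of $N^d$ points. For $x=(x_1,\dots,x_d)\in\mathbb{X}_N^d$, $\ket{x}=\ket{x_1N/L}\otimes\cdots\otimes\ket{x_dN/L}\in\mathbb{C}^{N^d}$, where $\ket{j}$, $j\in\{0,\dots,N-1\}$, is the standard basis of $\mathbb{C}^N$. Define $N\times N$ matrices $F=\frac{1}{\sqrt N}\sum_{j,\ell=0}^{N-1}e^{2\pi i j\ell/N}\ket{j}\!\bra{\ell}$, $S=\sum_{j=0}^{N-1}(-1)^j\ket{j}\!\bra{j}$, $D_K=(2\pi/L)^2\sum_{j=0}^{N-1}(j-N/2)^2\ket{j}\!\bra{j}$, and the $N^d\times N^d$ matrix $K=\frac12\big(SFD_KF^\dagger S^\dagger\big)^{\oplus d}$, where $M^{\oplus d}=\sum_{j=1}^d I^{\otimes(j-1)}\otimes M\otimes I^{\otimes(d-j)}$ is the $d$-fold Kronecker sum. For a function $V$ on $\mathbb{T}^d$, $D_V=\sum_{x\in\mathbb{X}_N^d}V(x)\ket{x}\!\bra{x}$. $\|f\|_{\mathsf{L}^2}=(\int_{\mathbb{T}^d}|f|^2dx)^{1/2}$,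 $\|f\|_{\mathsf{L}^\infty}=\max_{x\in\mathbb{T}^d}|f(x)|$; $\nabla^{2m}f$ denotes the Laplacian applied $m$ times to $f$. $\mathsf{C}^k$ is the space of functions $f:\mathbb{T}^d\to\mathbb{C}$ all of whose partial derivatives $\partial^{\kappa}f$ with $\|\kappa\|_1\le k$ are continuous on $\mathbb{T}^d$ (including across the periodic boundaries). $\sqrt{p_t}$ and $V_t\sqrt{p_t}$ denote pointwise operations. *)

theory Defs
  imports "HOL-Analysis.Analysis"
begin

text \<open>Functions on the torus T^d = [0,L]^d (opposite faces identified) are modelled as
  functions on real^'n (d = CARD('n)) that are L-periodic in every coordinate.\<close>

definition periodic_torus :: "real \<Rightarrow> (real^'n \<Rightarrow> 'a) \<Rightarrow> bool" where
  "periodic_torus L f \<longleftrightarrow> (\<forall>x i. f (x + L *\<^sub>R axis i 1) = f x)"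

definition partial_deriv :: "'n \<Rightarrow> (real^'n \<Rightarrow> 'a::real_normed_vector) \<Rightarrow> real^'n \<Rightarrow> 'a" where
  "partial_deriv i f x = vector_derivative (\<lambda>h::real. f (x + h *\<^sub>R axis i 1)) (at 0)"

text \<open>C^k: all iterated partial derivatives of order \<le> k exist and are continuous
  (everywhere on real^'n, i.e. on the torus including across the periodic boundaries).\<close>
fun Ck :: "nat \<Rightarrow> (real^'n \<Rightarrow> 'a::real_normed_vector) \<Rightarrow> bool" where
  "Ck 0 f = continuous_on UNIV f"
| "Ck (Suc k) f = (continuous_on UNIV f \<and>
      (\<forall>i x. (\<lambda>h::real. f (x + h *\<^sub>R axis i 1)) differentiable (at 0)) \<and>
      (\<forall>i. Ck k (partial_deriv i f)))"

definition laplacian :: "(real^'n \<Rightarrow> 'a::real_normed_vector) \<Rightarrow> real^'n \<Rightarrow> 'a" where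
  "laplacian f = (\<lambda>x. \<Sum>i\<in>UNIV. partial_deriv i (partial_deriv i f) x)"

definition torus_cube :: "real \<Rightarrow> (real^'n) set" where
  "torus_cube L = cbox 0 (\<chi> i. L)"

definition L2_norm_torus :: "real \<Rightarrow> (real^'n \<Rightarrow> 'a::real_normed_vector) \<Rightarrow> real" where
  "L2_norm_torus L f = sqrt (integral (torus_cube L) (\<lambda>x. (norm (f x))^2))"

definition Linf_norm_torus :: "real \<Rightarrow> (real^'n \<Rightarrow> 'a::real_normed_vector) \<Rightarrow> real" where
  "Linf_norm_torus L f = (SUP x\<in>torus_cube L. norm (f x))"

text \<open>Grid: multi-indices j with 0 \<le> j i < N, the grid point x_j = (L/N) j, and vectors in
  C^(N^d) represented as functions on multi-indices (only values on the grid matter).\<close>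
definition grid_idx :: "nat \<Rightarrow> ('n \<Rightarrow> nat) set" where
  "grid_idx N = {j. \<forall>i. j i < N}"

definition grid_pt :: "real \<Rightarrow> nat \<Rightarrow> ('n \<Rightarrow> nat) \<Rightarrow> real^'n" where
  "grid_pt L N j = (\<chi> i. L * real (j i) / real N)"

definition vnorm :: "nat \<Rightarrow> (('n \<Rightarrow> nat) \<Rightarrow> complex) \<Rightarrow> real" where
  "vnorm N v = sqrt (\<Sum>j\<in>grid_idx N. (cmod (v j))^2)"

definition Fmat :: "nat \<Rightarrow> nat \<Rightarrow> nat \<Rightarrow> complex" where
  "Fmat N j l = exp (2 * pi * \<i> * of_nat j * of_nat l / of_nat N) / of_real (sqrt (real N))"

definition Smat :: "nat \<Rightarrow> complex" where
  "Smat j = (-1) ^ j"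

definition DKdiag :: "real \<Rightarrow> nat \<Rightarrow> nat \<Rightarrow> complex" where
  "DKdiag L N j = of_real ((2 * pi / L)^2 * (real j - real N / 2)^2)"

definition M1 :: "real \<Rightarrow> nat \<Rightarrow> nat \<Rightarrow> nat \<Rightarrow> complex" where
  "M1 L N a b = (\<Sum>k<N. Smat a * Fmat N a k * DKdiag L N k * cnj (Fmat N b k) * cnj (Smat b))"

text \<open>K = 1/2 (S F D_K F^dagger S^dagger)^{Kronecker sum d}, acting on coordinate i.\<close>
definition Kop :: "real \<Rightarrow> nat \<Rightarrow> (('n \<Rightarrow> nat) \<Rightarrow> complex) \<Rightarrow> ('n \<Rightarrow> nat) \<Rightarrow> complex" where
  "Kop L N v = (\<lambda>j. (1/2) * (\<Sum>i\<in>UNIV. \<Sum>b<N. M1 L N (j i) b * v (j(i := b))))"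

definition DVop :: "real \<Rightarrow> nat \<Rightarrow> (real^'n \<Rightarrow> real) \<Rightarrow> (('n \<Rightarrow> nat) \<Rightarrow> complex) \<Rightarrow> ('n \<Rightarrow> nat) \<Rightarrow> complex" where
  "DVop L N V v = (\<lambda>j. of_real (V (grid_pt L N j)) * v j)"

definition Hc :: "real \<Rightarrow> nat \<Rightarrow> (real^'n \<Rightarrow> real) \<Rightarrow> (('n \<Rightarrow> nat) \<Rightarrow> complex) \<Rightarrow> ('n \<Rightarrow> nat) \<Rightarrow> complex" where
  "Hc L N V v = (\<lambda>j. \<i> * (Kop L N (DVop L N V v) j - DVop L N V (Kop L N v) j))"

end

theory Submission
  imports Defs
begin

text \<open>
  Writing \<open>u = sqrt p\<close>, the continuity equation becomes \<open>\<partial>u/\<partial>t = [-\<Delta>/2, V] u\<close>. This holds even where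
  \<open>u\<close> vanishes: as \<open>u \<ge> 0\<close>, its gradient vanishes there, hence so does the right-hand side.
  Sampling \<open>u\<close> on the grid gives \<open>U' = [K, V] U + e\<close> with \<open>e = V E(u) - E(V u)\<close>, where
  \<open>E(w)\<close> is the grid error of replacing \<open>-\<Delta>/2\<close> by \<open>K\<close>. In Fourier space \<open>K\<close> acts
  on a frequency through its representative modulo \<open>N\<close>, so only the unresolved frequencies contribute to \<open>E(w)\<close>;
  applying Cauchy--Schwarz within every residue class modulo \<open>N\<close> bounds the grid norm of \<open>E(w)\<close> by a quarter
  of \<open>(L d / N)\<^sup>2\<^sup>s\<close> times the \<open>L\<^sup>2\<close> norm of \<open>\<Delta>\<^sup>s\<^sup>+\<^sup>1 w\<close>. The hypothesis
  \<open>\<delta> \<le> T\<close> forces the same aliasing terms to be small for \<open>u\<close> itself, so the grid norm of \<open>U\<close>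
  stays above half of its continuum value. Since \<open>[K, V]\<close> is skew-Hermitian, the distance between the normalised
  \<open>U\<close> and \<open>\<phi>\<close> grows at most at the rate of the normalised residual.
\<close>

section \<open>Calculus of \<open>C\<^sup>k\<close> functions on the torus\<close>

text \<open>The scale \<open>sqrt ((real N / L) ^ CARD('n))\<close> is the grid norm of a resolved
  trigonometric polynomial of unit L2 norm. For general functions a lower bound on the grid norm is
  not automatic, since colliding frequencies may cancel on the grid. Write A for the L2 norm of
  \<open>(laplacian ^^ (s + 1)) u\<close> and e for \<open>(L * CARD('n) / N) ^ (2 * s)\<close>. The
  factor 3 in the constant c_s yields \<open>3 * A * e \<le> 1\<close>, and its summand 1 yields
  \<open>e \<le> 1\<close>. Under these two bounds the unresolved frequencies carry at most 1/9 of
  the mass and at most 1/6 of the scale on the grid, while the resolved ones contribute at least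
  2/3. The condition \<open>CARD('n) + 7 \<le> 4 * s\<close> acts twice: it makes the sum of
  \<open>1 / lap_symbol L k ^ (2 * s)\<close> over a residue class a convergent lattice sum, and it
  lets \<open>pi ^ (4 * s)\<close> absorb the constant of that sum. Square roots of quantities that
  may vanish are differentiated twice in the argument, once for the density and once for the
  distance of the two states; \<open>sqrt_growth\<close> handles both.\<close>

lemma Ck_continuous: "Ck k f \<Longrightarrow> continuous_on UNIV f"
  by (cases k) auto

lemma Ck_Suc_imp: "Ck (Suc k) f \<Longrightarrow> Ck k f"
proof (induction k arbitrary: f)
  case (Suc k)
  have "Ck k (partial_deriv i f)" for i
    by (rule Suc.IH) (use Suc.prems in simp)
  then show ?case using Suc.prems by simp
qed simp

lemma Ck_mono: "k \<le> l \<Longrightarrow> Ck l f \<Longrightarrow> Ck k f"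
  by (induction rule: inc_induct) (auto intro: Ck_Suc_imp)

lemma Ck_Suc_partial: "Ck (Suc k) f \<Longrightarrow> Ck k (partial_deriv i f)"
  by simp

lemma has_partial_deriv_0:
  assumes "Ck (Suc k) f"
  shows "((\<lambda>h. f (x + h *\<^sub>R axis i 1)) has_vector_derivative partial_deriv i f x) (at 0)"
  using assms vector_derivative_works unfolding partial_deriv_def Ck.simps by blast

text \<open>The definition speaks only about \<open>h = 0\<close>; recentring the line at
  \<open>x + t *\<^sub>R axis i 1\<close> transports it to every point of the line, as
  differentiation under the integral requires.\<close>

lemma has_partial_deriv:
  assumes "Ck (Suc k) f"
  shows "((\<lambda>h. f (x + h *\<^sub>R axis i 1)) has_vector_derivative
           partial_deriv i f (x + t *\<^sub>R axis i 1)) (at t)"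
proof -
  have "((\<lambda>h. f ((x + t *\<^sub>R axis i 1) + h *\<^sub>R axis i 1)) has_vector_derivative
           partial_deriv i f (x + t *\<^sub>R axis i 1)) (at ((\<lambda>h. h - t) t))"
    using has_partial_deriv_0[OF assms] by simp
  moreover have "((\<lambda>h. h - t) has_vector_derivative 1) (at t)"
    by (auto intro!: derivative_eq_intros)
  ultimately have "(((\<lambda>h. f ((x + t *\<^sub>R axis i 1) + h *\<^sub>R axis i 1)) \<circ> (\<lambda>h. h - t))
      has_vector_derivative 1 *\<^sub>R partial_deriv i f (x + t *\<^sub>R axis i 1)) (at t)"
    by (intro vector_diff_chain_at)
  moreover have "(x + t *\<^sub>R axis i 1) + (h - t) *\<^sub>R axis i 1 = x + h *\<^sub>R axis i 1" for h
    by (simp add: add.assoc flip: scaleR_add_left)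
  ultimately show ?thesis by (simp only: o_def scaleR_one)
qed

lemma partial_deriv_eqI:
  "((\<lambda>h. f (x + h *\<^sub>R axis i 1)) has_vector_derivative D) (at 0) \<Longrightarrow> partial_deriv i f x = D"
  unfolding partial_deriv_def by (rule vector_derivative_at)

lemma has_partial_deriv_mult:
  fixes f g :: "real^'n \<Rightarrow> real"
  assumes "Ck (Suc k) f" "Ck (Suc k) g"
  shows "((\<lambda>h. f (x + h *\<^sub>R axis i 1) * g (x + h *\<^sub>R axis i 1)) has_vector_derivative
      (partial_deriv i f x * g x + f x * partial_deriv i g x)) (at 0)"
  using has_vector_derivative_mult[OF has_partial_deriv_0[OF assms(1), of x i] has_partial_deriv_0[OF assms(2), of x i]]
  by (simp add: algebra_simps)

lemma partial_deriv_mult: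
  fixes f g :: "real^'n \<Rightarrow> real"
  assumes "Ck (Suc k) f" "Ck (Suc k) g"
  shows "partial_deriv i (\<lambda>y. f y * g y) = (\<lambda>x. partial_deriv i f x * g x + f x * partial_deriv i g x)"
  using partial_deriv_eqI[OF has_partial_deriv_mult[OF assms]] by blast

lemma has_partial_deriv_add:
  assumes "Ck (Suc k) f" "Ck (Suc k) g"
  shows "((\<lambda>h. f (x + h *\<^sub>R axis i 1) + g (x + h *\<^sub>R axis i 1)) has_vector_derivative
      (partial_deriv i f x + partial_deriv i g x)) (at 0)"
  by (intro has_vector_derivative_add has_partial_deriv_0[OF assms(1)] has_partial_deriv_0[OF assms(2)])

lemma partial_deriv_add:
  assumes "Ck (Suc k) f" "Ck (Suc k) g"
  shows "partial_deriv i (\<lambda>y. f y + g y) = (\<lambda>x. partial_deriv i f x + partial_deriv i g x)"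
  using partial_deriv_eqI[OF has_partial_deriv_add[OF assms]] by blast

lemma Ck_add: "Ck k f \<Longrightarrow> Ck k g \<Longrightarrow> Ck k (\<lambda>x. f x + g x)"
proof (induction k arbitrary: f g)
  case 0
  then show ?case by (auto intro: continuous_on_add)
next
  case (Suc k)
  have "Ck k (partial_deriv i (\<lambda>x. f x + g x))" for i
    unfolding partial_deriv_add[OF Suc.prems] using Suc by auto
  moreover have "(\<lambda>h. f (x + h *\<^sub>R axis i 1) + g (x + h *\<^sub>R axis i 1)) differentiable (at 0)" for x i
    using has_partial_deriv_add[OF Suc.prems] differentiableI_vector by blast
  ultimately show ?case using Suc.prems by (auto intro: continuous_on_add)
qed

lemma Ck_mult:
  fixes f g :: "real^'n \<Rightarrow> real"
  shows "Ck k f \<Longrightarrow> Ck k g \<Longrightarrow> Ck k (\<lambda>x. f x * g x)"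
proof (induction k arbitrary: f g)
  case 0
  then show ?case by (auto intro: continuous_on_mult)
next
  case (Suc k)
  have "Ck k f" "Ck k g" using Suc.prems Ck_Suc_imp by blast+
  then have "Ck k (partial_deriv i (\<lambda>x. f x * g x))" for i
    unfolding partial_deriv_mult[OF Suc.prems]
    using Suc.prems by (intro Ck_add Suc.IH) simp_all
  moreover have "(\<lambda>h. f (x + h *\<^sub>R axis i 1) * g (x + h *\<^sub>R axis i 1)) differentiable (at 0)" for x i
    using has_partial_deriv_mult[OF Suc.prems] differentiableI_vector by blast
  ultimately show ?case using Suc.prems by (auto intro: continuous_on_mult)
qed

lemma Ck_zero: "Ck k (\<lambda>_::real^'n. 0 :: 'a::real_normed_vector)"
proof (induction k)
  case (Suc k)
  have "partial_deriv i (\<lambda>_::real^'n. 0 :: 'a) = (\<lambda>_. 0)" for i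
    by (intro ext partial_deriv_eqI) auto
  then show ?case using Suc by auto
qed auto

lemma Ck_sum: "(\<And>a. a \<in> A \<Longrightarrow> Ck k (f a)) \<Longrightarrow> Ck k (\<lambda>x. \<Sum>a\<in>A. f a x)"
  by (induction A rule: infinite_finite_induct) (auto intro: Ck_add simp: Ck_zero)

lemma Ck_laplacian: "Ck (k + 2) f \<Longrightarrow> Ck k (laplacian f)"
  unfolding laplacian_def by (intro Ck_sum) auto

lemma Ck_laplacian_funpow: "Ck (k + 2 * n) f \<Longrightarrow> Ck k ((laplacian ^^ n) f)"
proof (induction n arbitrary: k)
  case (Suc n)
  have "Ck (k + 2) ((laplacian ^^ n) f)"
    by (rule Suc.IH) (use Suc.prems in \<open>simp only: add.assoc mult_Suc_right\<close>)
  then show ?case unfolding funpow.simps o_def by (rule Ck_laplacian)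
qed simp

lemma laplacian_mult:
  fixes f g :: "real^'n \<Rightarrow> real"
  assumes "Ck 2 f" "Ck 2 g"
  shows "laplacian (\<lambda>y. f y * g y) x =
    f x * laplacian g x + g x * laplacian f x + 2 * (\<Sum>i\<in>UNIV. partial_deriv i f x * partial_deriv i g x)"
proof -
  have 2: "Ck (Suc (Suc 0)) f" "Ck (Suc (Suc 0)) g" using assms by (simp_all add: numeral_2_eq_2)
  have 1: "Ck (Suc 0) f" "Ck (Suc 0) g" using 2 Ck_Suc_imp by blast+
  have d: "Ck (Suc 0) (partial_deriv i f)" "Ck (Suc 0) (partial_deriv i g)" for i
    using 2 Ck_Suc_partial by blast+
  have "partial_deriv i (partial_deriv i (\<lambda>y. f y * g y)) x =
     f x * partial_deriv i (partial_deriv i g) x + g x * partial_deriv i (partial_deriv i f) x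
     + 2 * (partial_deriv i f x * partial_deriv i g x)" for i
    unfolding partial_deriv_mult[OF 2]
    by (subst partial_deriv_add[OF Ck_mult[OF d(1) 1(2)] Ck_mult[OF 1(1) d(2)]],
        subst partial_deriv_mult[OF d(1) 1(2)], subst partial_deriv_mult[OF 1(1) d(2)]) simp
  then show ?thesis
    by (simp add: laplacian_def sum.distrib sum_distrib_left)
qed

lemma periodic_torus_partial_deriv:
  assumes "periodic_torus L f"
  shows "periodic_torus L (partial_deriv i f)"
  unfolding periodic_torus_def
proof (intro allI)
  fix x j
  have "f (x + L *\<^sub>R axis j 1 + h *\<^sub>R axis i 1) = f (x + h *\<^sub>R axis i 1)" for h :: real
    using assms[unfolded periodic_torus_def, rule_format, of "x + h *\<^sub>R axis i 1" j]
    by (simp add: ac_simps)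
  then show "partial_deriv i f (x + L *\<^sub>R axis j 1) = partial_deriv i f x"
    unfolding partial_deriv_def by simp
qed

lemma periodic_torus_laplacian: "periodic_torus L f \<Longrightarrow> periodic_torus L (laplacian f)"
  using periodic_torus_partial_deriv[OF periodic_torus_partial_deriv, of L f]
  unfolding laplacian_def periodic_torus_def by (simp cong: sum.cong)

lemma periodic_torus_laplacian_funpow: "periodic_torus L f \<Longrightarrow> periodic_torus L ((laplacian ^^ n) f)"
  by (induction n) (auto intro: periodic_torus_laplacian)

lemma periodic_torus_mult:
  "periodic_torus L f \<Longrightarrow> periodic_torus L g \<Longrightarrow> periodic_torus L (\<lambda>x. f x * g x)"
  by (auto simp: periodic_torus_def)

lemma periodic_torus_int_shift:
  fixes f :: "real^'n \<Rightarrow> 'a" and m :: "'n \<Rightarrow> int"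
  assumes "periodic_torus L f"
  shows "f (x + (\<chi> i. L * of_int (m i))) = f x"
proof -
  have nat: "f (x + (of_nat n * L) *\<^sub>R axis i 1) = f x" for n i x
  proof (induction n)
    case (Suc n)
    have "f (x + (of_nat n * L) *\<^sub>R axis i 1 + L *\<^sub>R axis i 1) = f x"
      using Suc assms by (simp add: periodic_torus_def)
    then show ?case by (simp add: algebra_simps)
  qed auto
  have one: "f (x + (of_int n * L) *\<^sub>R axis i 1) = f x" for n i x
  proof (cases "n \<ge> 0")
    case True
    then show ?thesis using nat[of x "nat n" i] by simp
  next
    case False
    then show ?thesis using nat[of "x + (of_int n * L) *\<^sub>R axis i 1" "nat (-n)" i]
      by (simp add: algebra_simps)
  qed
  have "f (x + (\<Sum>i\<in>A. (of_int (m i) * L) *\<^sub>R axis i 1)) = f x" if "finite A" for A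
    using that
  proof (induction A)
    case (insert a A)
    then show ?case
      using one[of "x + (\<Sum>i\<in>A. (of_int (m i) * L) *\<^sub>R axis i 1)" "m a" a]
      by (simp add: algebra_simps)
  qed auto
  moreover have "(\<Sum>i\<in>UNIV. (of_int (m i) * L) *\<^sub>R axis i 1) = (\<chi> i. L * of_int (m i))"
    by (simp add: vec_eq_iff axis_def if_distrib cong: if_cong)
  ultimately show ?thesis by (metis finite)
qed

section \<open>Fourier coefficients on the torus\<close>

lemma integrable_on_torus_cube:
  fixes f :: "real^'n \<Rightarrow> 'b::banach"
  shows "continuous_on UNIV f \<Longrightarrow> f integrable_on torus_cube L"
  unfolding torus_cube_def by (intro integrable_continuous) (rule continuous_on_subset, auto)

text \<open>The cube with its \<open>i\<close>-th side replaced by \<open>{a..b}\<close>. With the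
  other sides fixed, a translation along axis \<open>i\<close> only moves the interval, and
  integrals split like one-dimensional ones.\<close>

definition slab :: "real \<Rightarrow> 'n \<Rightarrow> real \<Rightarrow> real \<Rightarrow> (real^'n) set" where
  "slab L i a b = cbox (\<chi> j. if j = i then a else 0) (\<chi> j. if j = i then b else L)"

lemma mem_slab: "x \<in> slab L i a b \<longleftrightarrow>
    a \<le> x $ i \<and> x $ i \<le> b \<and> (\<forall>j. j \<noteq> i \<longrightarrow> 0 \<le> x $ j \<and> x $ j \<le> L)"
  by (force simp: slab_def mem_box_cart)

lemma slab_cube: "slab L i 0 L = torus_cube L"
  by (rule set_eqI) (force simp: mem_slab torus_cube_def mem_box_cart)

lemma integrable_on_slab:
  fixes f :: "real^'n \<Rightarrow> 'b::banach"
  shows "continuous_on UNIV f \<Longrightarrow> f integrable_on slab L i a b"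
  unfolding slab_def by (intro integrable_continuous) (rule continuous_on_subset, auto)

lemma integral_slab_split:
  fixes f :: "real^'n \<Rightarrow> 'b::banach"
  assumes "continuous_on UNIV f" "a \<le> c" "c \<le> b"
  shows "integral (slab L i a b) f = integral (slab L i a c) f + integral (slab L i c b) f"
proof -
  have "slab L i a c = slab L i a b \<inter> {x. x \<bullet> axis i 1 \<le> c}"
       "slab L i c b = slab L i a b \<inter> {x. x \<bullet> axis i 1 \<ge> c}"
    using assms(2,3) by (auto simp: mem_slab inner_axis)
  moreover have "integral (slab L i a b) f =
      integral (slab L i a b \<inter> {x. x \<bullet> axis i 1 \<le> c}) f +
      integral (slab L i a b \<inter> {x. x \<bullet> axis i 1 \<ge> c}) f"
    using integrable_on_slab[OF assms(1), of L i a b] unfolding slab_def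
    by (intro integral_split) (auto simp: axis_in_Basis_iff)
  ultimately show ?thesis by simp
qed

lemma integral_slab_shift:
  fixes f :: "real^'n \<Rightarrow> 'b::banach"
  shows "integral (slab L i a b) (\<lambda>x. f (x + h *\<^sub>R axis i 1)) = integral (slab L i (a + h) (b + h)) f"
proof -
  have "slab L i (a + h) (b + h) =
     cbox ((\<chi> j. if j = i then a else 0) + h *\<^sub>R axis i 1) ((\<chi> j. if j = i then b else L) + h *\<^sub>R axis i 1)"
    unfolding slab_def by (intro arg_cong2[where f = cbox]) (auto simp: vec_eq_iff axis_def)
  then show ?thesis
    using integral_shift_cbox_plus[of "\<chi> j. if j = i then a else 0" "\<chi> j. if j = i then b else L" f "h *\<^sub>R axis i 1"]
    by (simp add: slab_def o_def add.commute)
qed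

text \<open>Translation turns the cube into the slab over \<open>{h..L + h}\<close>. Its part over
  \<open>{L..L + h}\<close> is one period away from the missing part over
  \<open>{0..h}\<close>.\<close>

lemma integral_torus_shift:
  fixes f :: "real^'n \<Rightarrow> 'b::banach"
  assumes f: "continuous_on UNIV f" "periodic_torus L f" and h: "0 \<le> h" "h \<le> L"
  shows "integral (torus_cube L) (\<lambda>x. f (x + h *\<^sub>R axis i 1)) = integral (torus_cube L) f"
proof -
  have "integral (slab L i L (L + h)) f = integral (slab L i 0 h) (\<lambda>x. f (x + L *\<^sub>R axis i 1))"
    by (simp add: integral_slab_shift add.commute)
  also have "\<dots> = integral (slab L i 0 h) f"
    using f(2) by (simp add: periodic_torus_def)
  finally have "integral (slab L i h (L + h)) f = integral (slab L i 0 h) f + integral (slab L i h L) f"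
    using integral_slab_split[OF f(1), of h L "L + h" L i] h by simp
  also have "\<dots> = integral (slab L i 0 L) f"
    using integral_slab_split[OF f(1), of 0 h L L i] h by simp
  finally show ?thesis
    using integral_slab_shift[of L i 0 L f h] by (simp add: slab_cube add.commute)
qed

text \<open>Integration by parts without boundary terms: the integral of a translate of
  \<open>f\<close> does not depend on the translation \<open>h\<close>, and differentiating under
  the integral at \<open>h = 0\<close> produces the integral of \<open>f'\<close>.\<close>

lemma integral_torus_partial:
  fixes f f' :: "real^'n \<Rightarrow> complex"
  assumes L: "L > 0" and f: "continuous_on UNIV f" "periodic_torus L f" and f': "continuous_on UNIV f'"
    and deriv: "\<And>x t. ((\<lambda>h. f (x + h *\<^sub>R axis i 1)) has_vector_derivative f' (x + t *\<^sub>R axis i 1)) (at t)"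
  shows "integral (torus_cube L) f' = 0"
proof -
  have cont: "continuous_on UNIV (\<lambda>x. f (x + h *\<^sub>R axis i 1))" for h
    by (intro continuous_intros continuous_on_compose2[OF f(1)]) auto
  have "((\<lambda>h. integral (cbox 0 (\<chi> i. L)) (\<lambda>x. f (x + h *\<^sub>R axis i 1))) has_vector_derivative
     integral (cbox 0 (\<chi> i. L)) (\<lambda>x. f' (x + 0 *\<^sub>R axis i 1))) (at 0 within {0..L})"
  proof (rule leibniz_rule_vector_derivative)
    show "continuous_on ({0..L} \<times> cbox 0 (\<chi> i. L)) (\<lambda>(h, x). f' (x + h *\<^sub>R axis i 1))"
      unfolding case_prod_unfold by (intro continuous_intros continuous_on_compose2[OF f']) auto
  qed (use L integrable_on_torus_cube[OF cont] has_vector_derivative_at_within[OF deriv] in \<open>auto simp: torus_cube_def\<close>)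
  then have "((\<lambda>h. integral (torus_cube L) (\<lambda>x. f (x + h *\<^sub>R axis i 1))) has_vector_derivative
     integral (torus_cube L) f') (at 0 within {0..L})"
    by (simp add: torus_cube_def)
  \<comment> \<open>Shift invariance is available for \<open>0 \<le> h \<le> L\<close>, so the
    derivative at 0 is one-sided; on a nondegenerate interval it is still unique.\<close>
  then have "((\<lambda>h. integral (torus_cube L) f) has_vector_derivative integral (torus_cube L) f') (at 0 within {0..L})"
    by (rule has_vector_derivative_transform_within[where d = 1])
       (use L integral_torus_shift[OF f] in auto)
  moreover have "((\<lambda>h. integral (torus_cube L) f) has_vector_derivative 0) (at 0 within {0..L})"
    by simp
  ultimately show ?thesis
    using vector_derivative_unique_within_closed_interval[of 0 L 0] L by (metis atLeastAtMost_iff cbox_interval less_imp_le order_refl)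
qed

section \<open>Characters of the torus and Fourier coefficients\<close>

definition torus_char :: "real \<Rightarrow> ('n \<Rightarrow> int) \<Rightarrow> real^'n \<Rightarrow> complex" where
  "torus_char L k x = cis (2 * pi / L * (\<Sum>i\<in>UNIV. of_int (k i) * x $ i))"

text \<open>Normalised by the volume, so that characters have coefficient 1 at their own frequency;
  every L2 integral then carries a factor \<open>L ^ CARD('n)\<close>.\<close>

definition fourier_coeff :: "real \<Rightarrow> (real^'n \<Rightarrow> complex) \<Rightarrow> ('n \<Rightarrow> int) \<Rightarrow> complex" where
  "fourier_coeff L f k = integral (torus_cube L) (\<lambda>x. f x * cnj (torus_char L k x)) / of_real (L ^ CARD('n))"

text \<open>The eigenvalue of minus the Laplacian on \<open>torus_char L k\<close>.\<close>

definition lap_symbol :: "real \<Rightarrow> ('n::finite \<Rightarrow> int) \<Rightarrow> real" where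
  "lap_symbol L k = (2 * pi / L)\<^sup>2 * (\<Sum>i\<in>UNIV. (of_int (k i))\<^sup>2)"

lemma lap_symbol_nonneg: "0 \<le> lap_symbol L k"
  by (auto simp: lap_symbol_def intro!: sum_nonneg mult_nonneg_nonneg)

lemma continuous_on_torus_char [continuous_intros]: "continuous_on S (torus_char L k)"
  unfolding torus_char_def by (intro continuous_intros)

lemma norm_torus_char [simp]: "norm (torus_char L k x) = 1"
  by (simp add: torus_char_def)

lemma torus_char_0 [simp]: "torus_char L (\<lambda>_. 0) x = 1"
  by (simp add: torus_char_def)

lemma cnj_torus_char: "cnj (torus_char L k x) = torus_char L (\<lambda>i. - k i) x"
  by (simp add: torus_char_def cis_cnj sum_negf)

lemma torus_char_mult: "torus_char L k x * torus_char L l x = torus_char L (\<lambda>i. k i + l i) x"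
  by (simp add: torus_char_def cis_mult sum.distrib algebra_simps)

lemma torus_char_shift: "torus_char L k (x + h *\<^sub>R axis i 1) = torus_char L k x * cis (2 * pi / L * of_int (k i) * h)"
proof -
  have "(\<Sum>j\<in>UNIV. of_int (k j) * (x + h *\<^sub>R axis i 1) $ j) = (\<Sum>j\<in>UNIV. of_int (k j) * x $ j) + of_int (k i) * h"
  proof -
    have "of_int (k j) * (x + h *\<^sub>R axis i 1) $ j = of_int (k j) * x $ j + (if j = i then of_int (k i) * h else 0)" for j
      by (simp add: algebra_simps axis_def)
    then show ?thesis by (simp add: sum.distrib)
  qed
  then show ?thesis by (simp add: torus_char_def cis_mult algebra_simps)
qed

lemma periodic_torus_torus_char: "L \<noteq> 0 \<Longrightarrow> periodic_torus L (torus_char L k)"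
proof -
  assume "L \<noteq> 0"
  then have "2 * pi / L * of_int (k i) * L = of_int (k i) * (2 * pi)" for i by simp
  moreover have "cis (of_int m * (2 * pi)) = 1" for m :: int
    using cis_multiple_2pi[of "of_int m"] by (simp add: mult.commute)
  ultimately show ?thesis
    unfolding periodic_torus_def torus_char_shift by simp
qed

lemma has_vector_derivative_torus_char:
  "((\<lambda>h. torus_char L k (x + h *\<^sub>R axis i 1)) has_vector_derivative
     (2 * pi * \<i> * of_int (k i) / of_real L) * torus_char L k (x + t *\<^sub>R axis i 1)) (at t)"
proof -
  have "((\<lambda>h. cis (2 * pi / L * of_int (k i) * h)) has_vector_derivative
     (2 * pi / L * of_int (k i)) *\<^sub>R (\<i> * cis (2 * pi / L * of_int (k i) * t))) (at t)"
    unfolding has_vector_derivative_def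
    by (rule derivative_eq_intros refl)+ (auto simp: algebra_simps scaleR_conv_of_real)
  then have "((\<lambda>h. torus_char L k x * cis (2 * pi / L * of_int (k i) * h)) has_vector_derivative
     torus_char L k x * ((2 * pi / L * of_int (k i)) *\<^sub>R (\<i> * cis (2 * pi / L * of_int (k i) * t)))) (at t)"
    by (rule has_vector_derivative_mult_right)
  then show ?thesis
    unfolding torus_char_shift by (rule has_vector_derivative_eq_rhs) (simp add: scaleR_conv_of_real)
qed

text \<open>\<open>integral_torus_partial\<close> is applied to the product of \<open>f\<close> with
  the conjugate character, whose derivative consists of the two terms to be compared.\<close>

lemma fourier_coeff_partial_deriv:
  fixes f :: "real^'n \<Rightarrow> real"
  assumes L: "L > 0" and f: "Ck (Suc 0) f" "periodic_torus L f"
  shows "fourier_coeff L (\<lambda>x. of_real (partial_deriv i f x)) k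
       = (2 * pi * \<i> * of_int (k i) / of_real L) * fourier_coeff L (\<lambda>x. of_real (f x)) k"
proof -
  let ?c = "2 * pi * \<i> * of_int (k i) / of_real L :: complex"
  let ?e = "\<lambda>x. cnj (torus_char L k x)"
  have cf: "continuous_on UNIV f" "continuous_on UNIV (partial_deriv i f)"
    using f(1) by auto
  have c1: "continuous_on UNIV (\<lambda>x. complex_of_real (partial_deriv i f x) * ?e x)"
    and c2: "continuous_on UNIV (\<lambda>x. complex_of_real (f x) * ?e x)"
    by (intro continuous_intros cf)+
  have "integral (torus_cube L) (\<lambda>x. of_real (partial_deriv i f x) * ?e x - ?c * (of_real (f x) * ?e x)) = 0"
  proof (rule integral_torus_partial[OF L])
    show "periodic_torus L (\<lambda>x. of_real (f x) * ?e x)"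
      using f(2) periodic_torus_torus_char[of L k] L by (simp add: periodic_torus_def)
    show "((\<lambda>h. of_real (f (x + h *\<^sub>R axis i 1)) * ?e (x + h *\<^sub>R axis i 1)) has_vector_derivative
       of_real (partial_deriv i f (x + t *\<^sub>R axis i 1)) * ?e (x + t *\<^sub>R axis i 1)
        - ?c * (of_real (f (x + t *\<^sub>R axis i 1)) * ?e (x + t *\<^sub>R axis i 1))) (at t)" for x t
    proof -
      have 1: "((\<lambda>h. complex_of_real (f (x + h *\<^sub>R axis i 1))) has_vector_derivative
          of_real (partial_deriv i f (x + t *\<^sub>R axis i 1))) (at t)"
        by (intro has_vector_derivative_of_real)
           (simp add: has_partial_deriv[OF f(1)] has_real_derivative_iff_has_vector_derivative)
      have 2: "((\<lambda>h. ?e (x + h *\<^sub>R axis i 1)) has_vector_derivative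
          - ?c * ?e (x + t *\<^sub>R axis i 1)) (at t)"
        using has_vector_derivative_torus_char[of L "\<lambda>i. - k i" x i t] by (simp add: cnj_torus_char)
      show ?thesis
        by (rule has_vector_derivative_eq_rhs[OF has_vector_derivative_mult[OF 1 2]]) (simp add: algebra_simps)
    qed
  qed (intro continuous_intros c1 c2)+
  then have "integral (torus_cube L) (\<lambda>x. of_real (partial_deriv i f x) * ?e x)
     = ?c * integral (torus_cube L) (\<lambda>x. of_real (f x) * ?e x)"
    by (subst (asm) integral_diff)
       (simp_all only: integrable_on_torus_cube c1 integrable_on_torus_cube[OF continuous_on_mult_left[OF c2]]
          Henstock_Kurzweil_Integration.integral_mult_right right_minus_eq)
  then show ?thesis by (simp add: fourier_coeff_def)
qed

lemma fourier_coeff_sum: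
  assumes "\<And>a. a \<in> A \<Longrightarrow> continuous_on UNIV (f a)"
  shows "fourier_coeff L (\<lambda>x. \<Sum>a\<in>A. f a x) k = (\<Sum>a\<in>A. fourier_coeff L (f a) k)"
proof (cases "finite A")
  case True
  have "integral (torus_cube L) (\<lambda>x. \<Sum>a\<in>A. f a x * cnj (torus_char L k x))
      = (\<Sum>a\<in>A. integral (torus_cube L) (\<lambda>x. f a x * cnj (torus_char L k x)))"
    by (intro integral_sum True integrable_on_torus_cube continuous_intros assms)
  then show ?thesis by (simp add: fourier_coeff_def sum_distrib_right sum_divide_distrib)
qed (simp add: fourier_coeff_def)

lemma fourier_coeff_cmult: "fourier_coeff L (\<lambda>x. c * f x) k = c * fourier_coeff L f k"
  by (simp add: fourier_coeff_def mult.assoc)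

lemma fourier_coeff_laplacian:
  fixes f :: "real^'n \<Rightarrow> real"
  assumes L: "L > 0" and f: "Ck 2 f" "periodic_torus L f"
  shows "fourier_coeff L (\<lambda>x. of_real (laplacian f x)) k = - of_real (lap_symbol L k) * fourier_coeff L (\<lambda>x. of_real (f x)) k"
proof -
  have 2: "Ck (Suc (Suc 0)) f" using f by (simp add: numeral_2_eq_2)
  have "fourier_coeff L (\<lambda>x. of_real (partial_deriv i (partial_deriv i f) x)) k
      = (2 * pi * \<i> * of_int (k i) / of_real L)\<^sup>2 * fourier_coeff L (\<lambda>x. of_real (f x)) k" for i
  proof -
    have "fourier_coeff L (\<lambda>x. of_real (partial_deriv i (partial_deriv i f) x)) k
      = (2 * pi * \<i> * of_int (k i) / of_real L) * fourier_coeff L (\<lambda>x. of_real (partial_deriv i f x)) k"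
      by (rule fourier_coeff_partial_deriv[OF L Ck_Suc_partial[OF 2] periodic_torus_partial_deriv[OF f(2)]])
    also have "fourier_coeff L (\<lambda>x. of_real (partial_deriv i f x)) k
      = (2 * pi * \<i> * of_int (k i) / of_real L) * fourier_coeff L (\<lambda>x. of_real (f x)) k"
      by (rule fourier_coeff_partial_deriv[OF L Ck_Suc_imp[OF 2] f(2)])
    finally show ?thesis by (simp add: power2_eq_square)
  qed
  moreover have "continuous_on UNIV (partial_deriv i (partial_deriv i f))" for i
    using 2 by simp
  ultimately have "fourier_coeff L (\<lambda>x. of_real (laplacian f x)) k
      = (\<Sum>i\<in>UNIV. (2 * pi * \<i> * of_int (k i) / of_real L)\<^sup>2 * fourier_coeff L (\<lambda>x. of_real (f x)) k)"
    unfolding laplacian_def of_real_sum by (subst fourier_coeff_sum) (auto intro!: continuous_intros)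
  then show ?thesis
    by (simp add: lap_symbol_def power_mult_distrib power_divide sum_distrib_left sum_distrib_right sum_negf
        flip: sum_divide_distrib)
qed

lemma fourier_coeff_laplacian_funpow:
  fixes f :: "real^'n \<Rightarrow> real"
  assumes L: "L > 0" and f: "Ck (2 * n) f" "periodic_torus L f"
  shows "fourier_coeff L (\<lambda>x. of_real ((laplacian ^^ n) f x)) k
       = (- of_real (lap_symbol L k)) ^ n * fourier_coeff L (\<lambda>x. of_real (f x)) k"
  using f(1)
proof (induction n)
  case (Suc n)
  have 1: "Ck (2 * n) f" by (rule Ck_mono[OF _ Suc.prems]) simp
  have 2: "Ck 2 ((laplacian ^^ n) f)" 
    by (rule Ck_laplacian_funpow) (use Suc.prems in \<open>simp only: mult_Suc_right\<close>)
  show ?case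
    using fourier_coeff_laplacian[OF L 2 periodic_torus_laplacian_funpow[OF f(2)], of k] Suc.IH[OF 1]
    by (simp add: mult.assoc)
qed simp

lemma content_torus_cube: "L \<ge> 0 \<Longrightarrow> measure lborel (torus_cube L :: (real^'n) set) = L ^ CARD('n)"
proof -
  assume "L \<ge> 0"
  then have "cbox (0::real^'n) (\<chi> i. L) \<noteq> {}" by (auto simp: interval_ne_empty_cart)
  then show ?thesis unfolding torus_cube_def by (subst content_cbox_cart) auto
qed

text \<open>For nonzero \<open>k\<close> no integral is computed:
  \<open>fourier_coeff_partial_deriv\<close> for the constant 1 along an axis with
  \<open>k i \<noteq> 0\<close> says that a nonzero multiple of the coefficient is 0. Orthogonality
  of the characters follows by subtracting frequencies.\<close>

lemma fourier_coeff_1: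
  assumes L: "L > 0"
  shows "fourier_coeff L (\<lambda>_. 1) k = (if k = (\<lambda>_. 0) then 1 else 0)"
proof (cases "k = (\<lambda>_. 0)")
  case True
  then show ?thesis using L content_torus_cube[of L, where 'n = 'a]
    by (simp add: fourier_coeff_def torus_cube_def scaleR_conv_of_real)
next
  case False
  then obtain i where i: "k i \<noteq> 0" by auto
  have pd: "partial_deriv i (\<lambda>_::real^'a. 1::real) = (\<lambda>_. 0)" for i
    by (intro ext partial_deriv_eqI) auto
  have "Ck (Suc 0) (\<lambda>_::real^'a. 1::real)"
    by (simp add: pd)
  from fourier_coeff_partial_deriv[OF L this, of i k] show ?thesis
    using i L False by (simp add: periodic_torus_def pd) (simp add: fourier_coeff_def)
qed

lemma fourier_coeff_torus_char:
  assumes L: "L > 0"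
  shows "fourier_coeff L (torus_char L l) k = (if k = l then 1 else 0)"
proof -
  have "fourier_coeff L (torus_char L l) k = fourier_coeff L (\<lambda>_. 1) (\<lambda>i. k i - l i)"
    by (simp add: fourier_coeff_def cnj_torus_char torus_char_mult)
  then show ?thesis by (simp add: fourier_coeff_1[OF L] fun_eq_iff)
qed

section \<open>Completeness and Fourier inversion\<close>

lemma fourier_coeff_diff:
  assumes "continuous_on UNIV f" "continuous_on UNIV g"
  shows "fourier_coeff L (\<lambda>x. f x - g x) k = fourier_coeff L f k - fourier_coeff L g k"
proof -
  have "integral (torus_cube L) (\<lambda>x. f x * cnj (torus_char L k x) - g x * cnj (torus_char L k x))
      = integral (torus_cube L) (\<lambda>x. f x * cnj (torus_char L k x)) - integral (torus_cube L) (\<lambda>x. g x * cnj (torus_char L k x))"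
    by (intro integral_diff integrable_on_torus_cube continuous_intros assms)
  then show ?thesis by (simp add: fourier_coeff_def left_diff_distrib diff_divide_distrib)
qed

lemma fourier_coeff_add:
  assumes "continuous_on UNIV f" "continuous_on UNIV g"
  shows "fourier_coeff L (\<lambda>x. f x + g x) k = fourier_coeff L f k + fourier_coeff L g k"
proof -
  have "integral (torus_cube L) (\<lambda>x. f x * cnj (torus_char L k x) + g x * cnj (torus_char L k x))
      = integral (torus_cube L) (\<lambda>x. f x * cnj (torus_char L k x)) + integral (torus_cube L) (\<lambda>x. g x * cnj (torus_char L k x))"
    by (intro integral_add integrable_on_torus_cube continuous_intros assms)
  then show ?thesis by (simp add: fourier_coeff_def ring_distribs add_divide_distrib)
qed

lemma fourier_coeff_cnj:
  assumes "continuous_on UNIV f"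
  shows "fourier_coeff L (\<lambda>x. cnj (f x)) k = cnj (fourier_coeff L f (\<lambda>i. - k i))"
proof -
  have "integral (torus_cube L) (cnj \<circ> (\<lambda>x. f x * cnj (torus_char L (\<lambda>i. - k i) x)))
     = cnj (integral (torus_cube L) (\<lambda>x. f x * cnj (torus_char L (\<lambda>i. - k i) x)))"
    by (intro integral_linear integrable_on_torus_cube continuous_intros assms bounded_linear_cnj)
  then show ?thesis by (simp add: fourier_coeff_def o_def cnj_torus_char)
qed

lemma fourier_coeff_mult_cnj_torus_char: "fourier_coeff L (\<lambda>x. f x * cnj (torus_char L k x)) (\<lambda>_. 0) = fourier_coeff L f k"
  by (simp add: fourier_coeff_def)

lemma norm_fourier_coeff_le:
  assumes "L > 0" "continuous_on UNIV f" and B: "\<And>x. x \<in> torus_cube L \<Longrightarrow> norm (f x) \<le> B"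
  shows "norm (fourier_coeff L f k) \<le> B"
proof -
  have c: "continuous_on UNIV (\<lambda>x. f x * cnj (torus_char L k x))" by (intro continuous_intros assms)
  have "0 \<in> torus_cube L" using assms(1) by (simp add: torus_cube_def mem_box_cart)
  then have "B \<ge> 0" using B norm_ge_zero order_trans by blast
  then have "norm (integral (torus_cube L) (\<lambda>x. f x * cnj (torus_char L k x))) \<le> B * measure lborel (torus_cube L :: (real^'a) set)"
    using integrable_integral[OF integrable_on_torus_cube[OF c, of L]] B unfolding torus_cube_def
    by (intro has_integral_bound) (auto simp: norm_mult)
  then show ?thesis using assms(1)
    by (simp add: fourier_coeff_def norm_divide norm_power content_torus_cube divide_le_eq)
qed

section \<open>Orthogonal projection onto finitely many frequencies\<close>

lemma integral_norm_sq:
  fixes f :: "real^'n \<Rightarrow> complex"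
  assumes "L > 0" "continuous_on UNIV f"
  shows "integral (torus_cube L) (\<lambda>x. (norm (f x))\<^sup>2)
       = L ^ CARD('n) * Re (fourier_coeff L (\<lambda>x. f x * cnj (f x)) (\<lambda>_. 0))"
proof -
  have "integral (torus_cube L) (Re \<circ> (\<lambda>x. f x * cnj (f x))) = Re (integral (torus_cube L) (\<lambda>x. f x * cnj (f x)))"
    by (intro integral_linear integrable_on_torus_cube continuous_intros assms bounded_linear_Re)
  then show ?thesis using assms(1)
    by (simp only: o_def fourier_coeff_def cnj_torus_char) (simp add: cmod_power2 flip: power2_eq_square of_real_power)
qed

text \<open>Pythagoras: \<open>f\<close> is the partial sum \<open>g\<close> plus a remainder
  \<open>r\<close> whose coefficients on \<open>F\<close> vanish, so \<open>r\<close> is orthogonal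
  to \<open>g\<close>. Bessel's inequality and the lower half of Parseval's identity are both read
  off from here.\<close>

lemma fourier_projection:
  fixes f :: "real^'n \<Rightarrow> complex"
  assumes L: "L > 0" and f: "continuous_on UNIV f" and F: "finite F"
  shows "integral (torus_cube L) (\<lambda>x. (norm (f x - (\<Sum>k\<in>F. fourier_coeff L f k * torus_char L k x)))\<^sup>2)
      = integral (torus_cube L) (\<lambda>x. (norm (f x))\<^sup>2) - L ^ CARD('n) * (\<Sum>k\<in>F. (norm (fourier_coeff L f k))\<^sup>2)"
proof -
  define g where "g = (\<lambda>x. \<Sum>k\<in>F. fourier_coeff L f k * torus_char L k x)"
  define r where "r = (\<lambda>x. f x - g x)"
  have g: "continuous_on UNIV g" unfolding g_def by (intro continuous_intros)
  have r: "continuous_on UNIV r" unfolding r_def by (intro continuous_intros f g)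
  have fg: "fourier_coeff L g k = (if k \<in> F then fourier_coeff L f k else 0)" for k
    unfolding g_def using F
    by (subst fourier_coeff_sum) (auto intro!: continuous_intros simp: fourier_coeff_cmult fourier_coeff_torus_char[OF L] if_distrib cong: if_cong)
  \<comment> \<open>Pairing with \<open>g\<close> only evaluates coefficients on \<open>F\<close>;
    \<open>h = r\<close> gives orthogonality and \<open>h = g\<close> the squared norm of the
    partial sum.\<close>
  have inner: "fourier_coeff L (\<lambda>x. h x * cnj (g x)) (\<lambda>_. 0) = (\<Sum>k\<in>F. cnj (fourier_coeff L f k) * fourier_coeff L h k)"
    if h: "continuous_on UNIV h" for h
  proof -
    have "h x * cnj (g x) = (\<Sum>k\<in>F. cnj (fourier_coeff L f k) * (h x * cnj (torus_char L k x)))" for x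
      by (simp add: g_def sum_distrib_left algebra_simps)
    then have "fourier_coeff L (\<lambda>x. h x * cnj (g x)) (\<lambda>_. 0)
       = fourier_coeff L (\<lambda>x. \<Sum>k\<in>F. cnj (fourier_coeff L f k) * (h x * cnj (torus_char L k x))) (\<lambda>_. 0)"
      by presburger
    also have "\<dots> = (\<Sum>k\<in>F. cnj (fourier_coeff L f k) * fourier_coeff L h k)"
      by (subst fourier_coeff_sum) (auto intro!: continuous_intros h simp: fourier_coeff_cmult fourier_coeff_mult_cnj_torus_char)
    finally show ?thesis .
  qed
  have rk: "fourier_coeff L r k = 0" if "k \<in> F" for k
    using that unfolding r_def by (simp add: fourier_coeff_diff[OF f g] fg)
  then have rg: "fourier_coeff L (\<lambda>x. r x * cnj (g x)) (\<lambda>_. 0) = 0"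
    by (simp add: inner[OF r])
  have "fourier_coeff L (\<lambda>x. g x * cnj (r x)) (\<lambda>_. 0) = fourier_coeff L (\<lambda>x. cnj (r x * cnj (g x))) (\<lambda>_. 0)"
    by (simp add: mult.commute)
  also have "\<dots> = 0"
    using rg by (subst fourier_coeff_cnj) (auto intro!: continuous_intros r g)
  finally have gr: "fourier_coeff L (\<lambda>x. g x * cnj (r x)) (\<lambda>_. 0) = 0" .
  have gg: "fourier_coeff L (\<lambda>x. g x * cnj (g x)) (\<lambda>_. 0) = (\<Sum>k\<in>F. of_real ((norm (fourier_coeff L f k))\<^sup>2))"
    by (simp only: inner[OF g] fg complex_norm_square) (auto intro!: sum.cong)
  have "f x * cnj (f x) = (r x * cnj (r x) + r x * cnj (g x)) + (g x * cnj (r x) + g x * cnj (g x))" for x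
    by (simp add: r_def algebra_simps)
  then have "fourier_coeff L (\<lambda>x. f x * cnj (f x)) (\<lambda>_. 0)
      = fourier_coeff L (\<lambda>x. (r x * cnj (r x) + r x * cnj (g x)) + (g x * cnj (r x) + g x * cnj (g x))) (\<lambda>_. 0)"
    by presburger
  also have "\<dots> = fourier_coeff L (\<lambda>x. r x * cnj (r x)) (\<lambda>_. 0) + (\<Sum>k\<in>F. of_real ((norm (fourier_coeff L f k))\<^sup>2))"
    by (subst fourier_coeff_add, (intro continuous_intros r g)+)+ (simp add: rg gr gg)
  finally show ?thesis
    using integral_norm_sq[OF L f] integral_norm_sq[OF L r] 
    by (simp add: r_def g_def algebra_simps flip: of_real_sum)
qed

lemma bessel:
  fixes f :: "real^'n \<Rightarrow> complex"
  assumes L: "L > 0" and f: "continuous_on UNIV f" and F: "finite F"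
  shows "L ^ CARD('n) * (\<Sum>k\<in>F. (norm (fourier_coeff L f k))\<^sup>2) \<le> integral (torus_cube L) (\<lambda>x. (norm (f x))\<^sup>2)"
proof -
  have "0 \<le> integral (torus_cube L) (\<lambda>x. (norm (f x - (\<Sum>k\<in>F. fourier_coeff L f k * torus_char L k x)))\<^sup>2)"
    by (intro integral_nonneg integrable_on_torus_cube continuous_intros f) auto
  then show ?thesis by (simp add: fourier_projection[OF assms])
qed

section \<open>Density of trigonometric polynomials\<close>

inductive trig_poly :: "real \<Rightarrow> (real^'n \<Rightarrow> complex) \<Rightarrow> bool" for L where
  monom: "trig_poly L (\<lambda>x. c * torus_char L k x)"
| add: "trig_poly L f \<Longrightarrow> trig_poly L g \<Longrightarrow> trig_poly L (\<lambda>x. f x + g x)"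

lemma continuous_on_trig_poly: "trig_poly L f \<Longrightarrow> continuous_on UNIV f"
  by (induction rule: trig_poly.induct) (auto intro!: continuous_intros)

lemma trig_poly_const: "trig_poly L (\<lambda>x. c)"
  using trig_poly.monom[of L c "\<lambda>_. 0"] by simp

lemma trig_poly_mult_monom: "trig_poly L f \<Longrightarrow> trig_poly L (\<lambda>x. c * torus_char L k x * f x)"
proof (induction rule: trig_poly.induct)
  case (monom c' k')
  have "c * torus_char L k x * (c' * torus_char L k' x) = (c * c') * torus_char L (\<lambda>i. k i + k' i) x" for x
    by (simp flip: torus_char_mult)
  then show ?case by (simp only: trig_poly.monom)
next
  case (add f g)
  then show ?case by (simp only: distrib_left trig_poly.add)
qed

lemma trig_poly_mult: "trig_poly L f \<Longrightarrow> trig_poly L g \<Longrightarrow> trig_poly L (\<lambda>x. f x * g x)"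
proof (induction rule: trig_poly.induct)
  case (monom c' k')
  then show ?case by (rule trig_poly_mult_monom)
next
  case (add f f')
  then show ?case by (simp only: distrib_right trig_poly.add)
qed

lemma trig_poly_sum: "(\<And>a. a \<in> A \<Longrightarrow> trig_poly L (f a)) \<Longrightarrow> trig_poly L (\<lambda>x. \<Sum>a\<in>A. f a x)"
  by (induction A rule: infinite_finite_induct) (auto intro: trig_poly.add trig_poly_const)

definition torus_embed :: "real \<Rightarrow> real^'n \<Rightarrow> complex^'n" where
  "torus_embed L x = (\<chi> i. cis (2 * pi / L * x $ i))"

lemma continuous_on_torus_embed: "continuous_on S (torus_embed L)"
  unfolding torus_embed_def by (intro continuous_intros)

text \<open>The basis directions of \<open>complex^'n\<close> are real or imaginary parts of single
  coordinates. Along the embedding these are a cosine and a sine, hence combinations of the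
  characters of frequency \<open>k\<close> and its negative, with \<open>k\<close> a unit
  vector.\<close>

lemma trig_poly_coordinate:
  assumes "b \<in> Basis"
  shows "trig_poly L (\<lambda>x. of_real (torus_embed L x \<bullet> b))"
proof -
  obtain i u where b: "b = axis i u" "u \<in> Basis"
    using assms by (auto simp: Basis_vec_def)
  define k :: "'a \<Rightarrow> int" where "k = (\<lambda>j. if j = i then 1 else 0)"
  have s: "(\<Sum>j\<in>UNIV. of_int (k j) * x $ j) = x $ i" for x :: "real^'a"
  proof -
    have "(\<Sum>j\<in>UNIV. of_int (k j) * x $ j) = (\<Sum>j\<in>UNIV. if j = i then x $ j else 0)"
      by (intro sum.cong) (auto simp: k_def)
    then show ?thesis by simp
  qed
  have c: "cis (2 * pi / L * x $ i) = torus_char L k x" for x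
    by (simp add: torus_char_def s)
  have c': "cis (- (2 * pi / L * x $ i)) = torus_char L (\<lambda>j. - k j) x" for x
    unfolding cnj_torus_char[symmetric] c[symmetric] by (simp add: cis_cnj)
  consider "u = 1" | "u = \<i>" using b(2) by (auto simp: Basis_complex_def)
  then show ?thesis
  proof cases
    case 1
    have "of_real (torus_embed L x \<bullet> b) = 1/2 * torus_char L k x + 1/2 * torus_char L (\<lambda>j. - k j) x" for x
      unfolding c[symmetric] c'[symmetric] by (simp add: b inner_axis torus_embed_def 1 complex_eq_iff)
    then have "(\<lambda>x. of_real (torus_embed L x \<bullet> b)) = (\<lambda>x. 1/2 * torus_char L k x + 1/2 * torus_char L (\<lambda>j. - k j) x)"
      by (intro ext)
    then show ?thesis by (simp only:) (intro trig_poly.intros)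
  next
    case 2
    have "of_real (torus_embed L x \<bullet> b) = - \<i>/2 * torus_char L k x + \<i>/2 * torus_char L (\<lambda>j. - k j) x" for x
      unfolding c[symmetric] c'[symmetric] by (simp add: b inner_axis torus_embed_def 2 complex_eq_iff)
    then have "(\<lambda>x. of_real (torus_embed L x \<bullet> b)) = (\<lambda>x. - \<i>/2 * torus_char L k x + \<i>/2 * torus_char L (\<lambda>j. - k j) x)"
      by (intro ext)
    then show ?thesis by (simp only:) (intro trig_poly.intros)
  qed
qed

lemma trig_poly_torus_embed:
  assumes "real_polynomial_function p"
  shows "trig_poly L (\<lambda>x. of_real (p (torus_embed L x)))"
  using assms
proof (induction rule: real_polynomial_function.induct)
  case (linear f)
  have "f z = (\<Sum>b\<in>Basis. (z \<bullet> b) * f b)" for z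
  proof -
    have "f z = f (\<Sum>b\<in>Basis. (z \<bullet> b) *\<^sub>R b)" by (simp add: euclidean_representation)
    also have "\<dots> = (\<Sum>b\<in>Basis. (z \<bullet> b) * f b)"
      using linear by (simp add: linear_sum linear_simps bounded_linear.linear)
    finally show ?thesis .
  qed
  note expand = arg_cong[OF this, of complex_of_real, unfolded of_real_sum of_real_mult]
  have eq: "(\<lambda>x. complex_of_real (f (torus_embed L x)))
      = (\<lambda>x. \<Sum>b\<in>Basis. of_real (torus_embed L x \<bullet> b) * of_real (f b))"
    by (intro ext expand)
  show ?case
    by (subst eq, intro trig_poly_sum trig_poly_mult trig_poly_coordinate trig_poly_const)
next
  case (add f g)
  from trig_poly.add[OF add.IH] show ?case by simp
next
  case (mult f g)
  from trig_poly_mult[OF mult.IH] show ?case by simp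
qed (rule trig_poly_const)

text \<open>Equality on the circle fixes each coordinate up to an integer multiple of
  \<open>L\<close>, which a periodic function does not see. This makes the descended function well
  defined.\<close>

lemma periodic_torus_embed_eq:
  assumes L: "L > 0" and f: "periodic_torus L f" and eq: "torus_embed L x = torus_embed L y"
  shows "f x = f y"
proof -
  have "\<exists>m::int. x $ i = y $ i + L * of_int m" for i
  proof -
    have "cis (2 * pi / L * x $ i) = cis (2 * pi / L * y $ i)"
      using eq by (simp add: torus_embed_def vec_eq_iff)
    then have "cis (2 * pi / L * x $ i - 2 * pi / L * y $ i) = 1"
      by (simp flip: cis_divide)
    then have "cos (2 * pi / L * x $ i - 2 * pi / L * y $ i) = 1"
      by (simp add: complex_eq_iff)
    then obtain m :: int where "2 * pi / L * x $ i - 2 * pi / L * y $ i = of_int m * (2 * pi)"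
      unfolding cos_one_2pi_int by auto
    then have "(2 * pi / L) * (x $ i - y $ i - L * of_int m) = 0"
      using L by (simp add: field_simps)
    then have "x $ i = y $ i + L * of_int m" using L by simp
    then show ?thesis by blast
  qed
  then obtain m :: "'a \<Rightarrow> int" where "\<And>i. x $ i = y $ i + L * of_int (m i)" by metis
  then have "x = y + (\<chi> i. L * of_int (m i))" by (simp add: vec_eq_iff)
  then show ?thesis using periodic_torus_int_shift[OF f, of y m] by simp
qed

text \<open>A periodic function descends to the image of the cube in the product of circles, a compact subset of
  a Euclidean space on which Stone--Weierstrass applies; polynomials pull back to trigonometric ones.\<close>

lemma trig_poly_approx:
  fixes g :: "real^'n \<Rightarrow> real"
  assumes L: "L > 0" and g: "continuous_on UNIV g" "periodic_torus L g" and e: "e > 0"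
  obtains q where "trig_poly L q" "\<And>x. x \<in> torus_cube L \<Longrightarrow> norm (of_real (g x) - q x) < e"
proof -
  define S where "S = torus_embed L ` (torus_cube L :: (real^'n) set)"
  have cc: "compact (torus_cube L :: (real^'n) set)" by (simp add: torus_cube_def)
  define h where "h z = g (SOME x. x \<in> torus_cube L \<and> torus_embed L x = z)" for z
  have h: "h (torus_embed L x) = g x" if "x \<in> torus_cube L" for x
  proof -
    have "torus_embed L (SOME y. y \<in> torus_cube L \<and> torus_embed L y = torus_embed L x) = torus_embed L x"
      by (rule someI2[of _ x]) (use that in auto)
    then show ?thesis unfolding h_def by (rule periodic_torus_embed_eq[OF L g(2)])
  qed
  have "compact S" unfolding S_def by (intro compact_continuous_image continuous_on_torus_embed cc)
  \<comment> \<open>Preimages of closed sets are closed because they are images of compact ones: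
    \<open>torus_embed L\<close> maps the cube points with \<open>g\<close> in \<open>B\<close> onto
    the preimage of \<open>B\<close> under \<open>h\<close>.\<close>
  moreover have "continuous_on S h"
    unfolding continuous_on_closed_invariant
  proof (intro allI impI)
    fix B :: "real set" assume B: "closed B"
    have "closed (torus_cube L \<inter> g -` B)"
      using continuous_closed_vimage[of B g] B g(1)
      by (intro closed_Int closed_vimage) (auto simp: torus_cube_def)
    then have "compact (torus_cube L \<inter> g -` B)"
      using cc by (metis compact_Int_closed inf.right_idem inf_commute)
    then have "closed (torus_embed L ` (torus_cube L \<inter> g -` B))"
      by (intro compact_imp_closed compact_continuous_image continuous_on_torus_embed)
    moreover have "torus_embed L ` (torus_cube L \<inter> g -` B) \<inter> S = h -` B \<inter> S"
      using h by (auto simp: S_def)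
    ultimately show "\<exists>A. closed A \<and> A \<inter> S = h -` B \<inter> S" by blast
  qed
  ultimately obtain p where p: "real_polynomial_function p" "\<And>z. z \<in> S \<Longrightarrow> \<bar>h z - p z\<bar> < e"
    using Stone_Weierstrass_real_polynomial_function e by blast
  have "norm (complex_of_real (g x) - of_real (p (torus_embed L x))) < e" if "x \<in> torus_cube L" for x
    using p(2)[of "torus_embed L x"] that h[OF that]
    by (simp add: S_def flip: of_real_diff)
  then show ?thesis using that[OF trig_poly_torus_embed[OF p(1)]] by blast
qed

text \<open>Vanishing coefficients make \<open>g\<close> orthogonal to every trigonometric
  polynomial, so the integral of its square equals that of \<open>(g - q) * g\<close> for a
  \<open>q\<close> uniformly close to \<open>g\<close>. Real values are what
  \<open>trig_poly_approx\<close> can handle.\<close>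

lemma fourier_unique_real:
  fixes g :: "real^'n \<Rightarrow> real"
  assumes L: "L > 0" and g: "continuous_on UNIV g" "periodic_torus L g"
    and zero: "\<And>k. fourier_coeff L (\<lambda>x. of_real (g x)) k = 0" and x: "x \<in> torus_cube L"
  shows "g x = 0"
proof -
  let ?G = "\<lambda>x. complex_of_real (g x)"
  have G: "continuous_on UNIV ?G" by (intro continuous_intros g)
  have orth: "fourier_coeff L (\<lambda>x. q x * ?G x) (\<lambda>_. 0) = 0" if "trig_poly L q" for q
    using that
  proof (induction rule: trig_poly.induct)
    case (monom c k)
    have "(\<lambda>x. c * torus_char L k x * ?G x) = (\<lambda>x. c * (?G x * cnj (torus_char L (\<lambda>i. - k i) x)))"
      by (simp add: cnj_torus_char fun_eq_iff)
    then have "fourier_coeff L (\<lambda>x. c * torus_char L k x * ?G x) (\<lambda>_. 0)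
        = fourier_coeff L (\<lambda>x. c * (?G x * cnj (torus_char L (\<lambda>i. - k i) x))) (\<lambda>_. 0)" by (rule arg_cong)
    also have "\<dots> = c * fourier_coeff L ?G (\<lambda>i. - k i)"
      by (subst fourier_coeff_cmult, subst fourier_coeff_mult_cnj_torus_char) (rule refl)
    finally show ?case using zero by simp
  next
    case (add f h)
    then show ?case unfolding distrib_right
      using continuous_on_mult[OF continuous_on_trig_poly[OF add.hyps(1)] G]
        continuous_on_mult[OF continuous_on_trig_poly[OF add.hyps(2)] G]
      by (subst fourier_coeff_add) auto
  qed
  obtain B where B: "\<And>x. x \<in> torus_cube L \<Longrightarrow> norm (?G x) \<le> B" "B > 0"
  proof -
    have "compact (?G ` torus_cube L)"
      by (intro compact_continuous_image continuous_on_subset[OF G]) (auto simp: torus_cube_def)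
    then obtain B where "B > 0" "\<forall>z\<in>?G ` torus_cube L. norm z \<le> B"
      using compact_imp_bounded bounded_pos by metis
    then show ?thesis by (intro that[of B]) blast+
  qed
  have "norm (fourier_coeff L (\<lambda>x. ?G x * ?G x) (\<lambda>_. 0)) \<le> 0 + e" if e: "e > 0" for e
  proof -
    obtain q where q: "trig_poly L q" "\<And>x. x \<in> torus_cube L \<Longrightarrow> norm (?G x - q x) < e / B"
      using trig_poly_approx[OF L g, of "e / B"] e B(2) by auto
    note cq = continuous_on_trig_poly[OF q(1)]
    have "fourier_coeff L (\<lambda>x. ?G x * ?G x) (\<lambda>_. 0) = fourier_coeff L (\<lambda>x. ?G x * ?G x - q x * ?G x) (\<lambda>_. 0)"
      by (subst fourier_coeff_diff[OF continuous_on_mult[OF G G] continuous_on_mult[OF cq G]])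
         (simp only: orth[OF q(1)] diff_zero)
    moreover have "norm (fourier_coeff L (\<lambda>x. ?G x * ?G x - q x * ?G x) (\<lambda>_. 0)) \<le> e"
    proof (rule norm_fourier_coeff_le[OF L])
      fix x :: "real^'n" assume x: "x \<in> torus_cube L"
      have "norm (?G x * ?G x - q x * ?G x) = norm (?G x - q x) * norm (?G x)"
        by (simp only: norm_mult[symmetric] left_diff_distrib)
      also have "\<dots> \<le> e / B * B"
        using q(2)[OF x] B(1)[OF x] B(2) e by (intro mult_mono) auto
      finally show "norm (?G x * ?G x - q x * ?G x) \<le> e" using B by simp
    qed (intro continuous_intros cq G)
    ultimately show ?thesis by simp
  qed
  then have "norm (fourier_coeff L (\<lambda>x. ?G x * ?G x) (\<lambda>_. 0)) \<le> 0" by (rule field_le_epsilon)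
  then have "integral (torus_cube L) (\<lambda>x. (norm (?G x))\<^sup>2) = 0"
    using integral_norm_sq[OF L G] by simp
  moreover have "box (0::real^'n) (\<chi> i. L) \<noteq> {}" using L by (simp add: interval_ne_empty_cart)
  ultimately have "(norm (?G x))\<^sup>2 = 0"
    using x unfolding torus_cube_def
    by (subst (asm) integral_cbox_eq_0_iff) (auto intro!: continuous_intros continuous_on_subset[OF g(1)])
  then show ?thesis by simp
qed

text \<open>Conjugation reflects frequencies, so the conjugate of \<open>g\<close> has vanishing
  coefficients too, and the real case applies to real and imaginary part.\<close>

lemma fourier_unique:
  fixes g :: "real^'n \<Rightarrow> complex"
  assumes L: "L > 0" and g: "continuous_on UNIV g" "periodic_torus L g"
    and zero: "\<And>k. fourier_coeff L g k = 0" and x: "x \<in> torus_cube L"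
  shows "g x = 0"
proof -
  have cz: "fourier_coeff L (\<lambda>x. cnj (g x)) k = 0" for k
    by (subst fourier_coeff_cnj[OF g(1)]) (simp add: zero)
  have re: "complex_of_real (Re (g x)) = 1/2 * (g x + cnj (g x))"
   and im: "complex_of_real (Im (g x)) = - \<i>/2 * (g x - cnj (g x))" for x
    by (auto simp: complex_eq_iff)
  have cc: "continuous_on UNIV (\<lambda>x. cnj (g x))" by (intro continuous_intros g)
  have "Re (g x) = 0"
  proof (rule fourier_unique_real[OF L _ _ _ x])
    show "fourier_coeff L (\<lambda>x. of_real (Re (g x))) k = 0" for k
      unfolding re fourier_coeff_cmult using cz zero by (simp add: fourier_coeff_add[OF g(1) cc])
  qed (use g in \<open>auto simp: periodic_torus_def intro!: continuous_intros\<close>)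
  moreover have "Im (g x) = 0"
  proof (rule fourier_unique_real[OF L _ _ _ x])
    show "fourier_coeff L (\<lambda>x. of_real (Im (g x))) k = 0" for k
      unfolding im fourier_coeff_cmult using cz zero by (simp add: fourier_coeff_diff[OF g(1) cc])
  qed (use g in \<open>auto simp: periodic_torus_def intro!: continuous_intros\<close>)
  ultimately show ?thesis by (simp add: complex_eq_iff)
qed

text \<open>The sum \<open>S\<close> of the absolutely convergent series is continuous as a uniform
  limit and has the same coefficients as \<open>f\<close>, so uniqueness applies to
  \<open>f - S\<close>.\<close>

lemma fourier_inversion:
  fixes f :: "real^'n \<Rightarrow> complex"
  assumes L: "L > 0" and f: "continuous_on UNIV f" "periodic_torus L f"
    and summable: "(\<lambda>k. norm (fourier_coeff L f k)) summable_on UNIV" and x: "x \<in> torus_cube L"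
  shows "((\<lambda>k. fourier_coeff L f k * torus_char L k x) has_sum f x) UNIV"
proof -
  define S where "S x = (\<Sum>\<^sub>\<infinity>k. fourier_coeff L f k * torus_char L k x)" for x
  have abs: "(\<lambda>k. norm (fourier_coeff L f k * torus_char L k x)) summable_on UNIV" for x
    using summable by (simp add: norm_mult)
  have ul: "uniform_limit UNIV (\<lambda>F x. \<Sum>k\<in>F. fourier_coeff L f k * torus_char L k x) S (finite_subsets_at_top UNIV)"
    unfolding S_def by (rule Weierstrass_m_test_general[OF _ summable]) (simp add: norm_mult)
  have S: "continuous_on UNIV S"
    by (rule uniform_limit_theorem[OF _ ul]) (auto intro!: always_eventually continuous_intros)
  have Sper: "periodic_torus L S"
  proof -
    have "torus_char L k (x + L *\<^sub>R axis i 1) = torus_char L k x" for k and x :: "real^'n" and i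
      using periodic_torus_torus_char[of L k] L by (simp add: periodic_torus_def)
    then show ?thesis by (simp add: periodic_torus_def S_def)
  qed
  have coef: "fourier_coeff L S k = fourier_coeff L f k" for k
  proof -
    \<comment> \<open>A finite partial sum containing the frequency \<open>k\<close> already has the
      coefficient of \<open>f\<close> there, so the difference is a coefficient of the uniformly
      small remainder.\<close>
    have "norm (fourier_coeff L S k - fourier_coeff L f k) \<le> 0 + e" if e: "e > 0" for e
    proof -
      have "\<forall>\<^sub>F F in finite_subsets_at_top UNIV. \<forall>x\<in>UNIV. dist (\<Sum>k\<in>F. fourier_coeff L f k * torus_char L k x) (S x) < e"
        using ul e by (simp add: uniform_limit_iff)
      moreover have "\<forall>\<^sub>F F in finite_subsets_at_top UNIV. finite F \<and> k \<in> F"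
        unfolding eventually_finite_subsets_at_top by (rule exI[of _ "{k}"]) auto
      ultimately have "\<forall>\<^sub>F F in finite_subsets_at_top UNIV.
           (\<forall>x\<in>UNIV. dist (\<Sum>k\<in>F. fourier_coeff L f k * torus_char L k x) (S x) < e) \<and> finite F \<and> k \<in> F"
        by (rule eventually_conj)
      from eventually_happens'[OF finite_subsets_at_top_neq_bot this]
      obtain F where F: "finite F" "k \<in> F" "\<And>x. dist (\<Sum>k\<in>F. fourier_coeff L f k * torus_char L k x) (S x) < e"
        by auto
      let ?P = "\<lambda>x. \<Sum>k\<in>F. fourier_coeff L f k * torus_char L k x"
      have P: "continuous_on UNIV ?P" by (intro continuous_intros)
      have "fourier_coeff L ?P k = fourier_coeff L f k" using F(1,2)
        by (subst fourier_coeff_sum) (auto intro!: continuous_intros simp: fourier_coeff_cmult fourier_coeff_torus_char[OF L] if_distrib cong: if_cong)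
      then have "fourier_coeff L S k - fourier_coeff L f k = fourier_coeff L (\<lambda>x. S x - ?P x) k"
        by (simp add: fourier_coeff_diff[OF S P])
      also have "norm \<dots> \<le> e"
        using F(3) by (intro norm_fourier_coeff_le[OF L] continuous_intros S) (auto simp: dist_norm norm_minus_commute intro: less_imp_le)
      finally show ?thesis by simp
    qed
    then have "norm (fourier_coeff L S k - fourier_coeff L f k) \<le> 0" by (rule field_le_epsilon)
    then show ?thesis by simp
  qed
  have "f x - S x = 0"
  proof (rule fourier_unique[OF L _ _ _ x, of "\<lambda>x. f x - S x"])
    show "continuous_on UNIV (\<lambda>x. f x - S x)" by (intro continuous_on_diff f S)
    show "periodic_torus L (\<lambda>x. f x - S x)" using f(2) Sper by (simp add: periodic_torus_def)
    show "fourier_coeff L (\<lambda>x. f x - S x) k = 0" for k by (simp add: fourier_coeff_diff[OF f(1) S] coef)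
  qed
  moreover have "((\<lambda>k. fourier_coeff L f k * torus_char L k x) has_sum S x) UNIV"
    unfolding S_def using abs_summable_summable[OF abs] by (rule has_sum_infsum)
  ultimately show ?thesis by simp
qed

section \<open>Lattice sums and aliasing classes\<close>

definition supnorm :: "('n::finite \<Rightarrow> int) \<Rightarrow> nat" where
  "supnorm q = Max (range (\<lambda>i. nat \<bar>q i\<bar>))"

lemma supnorm_ge: "nat \<bar>q i\<bar> \<le> supnorm q"
  unfolding supnorm_def by (rule Max_ge) auto

lemma supnorm_attained: "\<exists>i. nat \<bar>q i\<bar> = supnorm q"
proof -
  have "supnorm q \<in> range (\<lambda>i. nat \<bar>q i\<bar>)" unfolding supnorm_def by (rule Max_in) auto
  then show ?thesis by auto
qed

lemma supnorm_pos: "q \<noteq> (\<lambda>_. 0) \<Longrightarrow> supnorm q \<ge> 1"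
proof -
  assume "q \<noteq> (\<lambda>_. 0)"
  then obtain i where "q i \<noteq> 0" by auto
  then have "1 \<le> nat \<bar>q i\<bar>" by auto
  also have "\<dots> \<le> supnorm q" by (rule supnorm_ge)
  finally show ?thesis .
qed

text \<open>The whole box of side \<open>2 * n + 1\<close> is counted rather than its surface;
  \<open>n \<ge> 1\<close> allows the homogeneous bound \<open>3 * n\<close>.\<close>

lemma card_supnorm_le:
  fixes Q :: "('n::finite \<Rightarrow> int) set"
  assumes "n \<ge> 1"
  shows "card {q \<in> Q. supnorm q = n} \<le> (3 * n) ^ CARD('n)"
proof -
  have "{q \<in> Q. supnorm q = n} \<subseteq> (PiE UNIV (\<lambda>_::'n. {- int n..int n}))"
  proof
    fix q assume "q \<in> {q \<in> Q. supnorm q = n}"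
    then have "nat \<bar>q i\<bar> \<le> n" for i using supnorm_ge[of q i] by simp
    then have "\<bar>q i\<bar> \<le> int n" for i by (metis nat_le_iff)
    then show "q \<in> PiE UNIV (\<lambda>_::'n. {- int n..int n})"
      by (simp add: PiE_iff) (metis abs_le_D1 abs_le_D2 minus_le_iff)
  qed
  then have "card {q \<in> Q. supnorm q = n} \<le> card (PiE UNIV (\<lambda>_::'n. {- int n..int n}))"
    by (intro card_mono finite_PiE) auto
  also have "\<dots> = (2 * n + 1) ^ CARD('n)"
    by (simp add: card_PiE nat_add_distrib nat_mult_distrib)
  also have "\<dots> \<le> (3 * n) ^ CARD('n)" using assms by (intro power_mono) auto
  finally show ?thesis .
qed

text \<open>Telescoping: for \<open>n \<ge> 2\<close> the term is at most
  \<open>1 / (n - 1) - 1 / n\<close>, so the sum up to \<open>M\<close> stays below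
  \<open>2 - 1 / M\<close>.\<close>

lemma sum_inverse_squares_le: "(\<Sum>n=1..M. 1 / (real n)\<^sup>2) \<le> 2"
proof (cases M)
  case (Suc m)
  have "(\<Sum>n=1..Suc m. 1 / (real n)\<^sup>2) \<le> 2 - 1 / real (Suc m)"
  proof (induction m)
    case (Suc m)
    have "1 / (real (Suc (Suc m)))\<^sup>2 \<le> 1 / real (Suc m) - 1 / real (Suc (Suc m))"
      by (simp add: divide_simps power2_eq_square)
    then show ?case using Suc by simp
  qed simp
  also have "\<dots> \<le> 2" by simp
  finally show ?thesis using Suc by simp
qed simp

text \<open>Summation over shells of equal \<open>supnorm\<close>: the exponent \<open>a\<close>
  beats the number of points in a shell by two powers, which leaves a sum of inverse
  squares.\<close>

lemma lattice_sum_le: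
  fixes Q :: "('n::finite \<Rightarrow> int) set"
  assumes Q: "finite Q" "(\<lambda>_. 0) \<notin> Q" and a: "CARD('n) + 2 \<le> a"
  shows "(\<Sum>q\<in>Q. 1 / real (supnorm q) ^ a) \<le> 2 * 3 ^ CARD('n)"
proof -
  define M where "M = Max (insert 0 (supnorm ` Q))"
  have sub: "supnorm ` Q \<subseteq> {1..M}"
  proof
    fix n assume n: "n \<in> supnorm ` Q"
    then obtain q where "q \<in> Q" "n = supnorm q" by auto
    moreover have "q \<noteq> (\<lambda>_. 0)" using \<open>q \<in> Q\<close> Q(2) by blast
    moreover have "n \<le> M" unfolding M_def using Q(1) n by (intro Max_ge) auto
    ultimately show "n \<in> {1..M}" using supnorm_pos[of q] by auto
  qed
  have "(\<Sum>q\<in>Q. 1 / real (supnorm q) ^ a) = (\<Sum>n=1..M. real (card {q \<in> Q. supnorm q = n}) * (1 / real n ^ a))"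
    by (rule sum_fun_comp[OF Q(1) _ sub]) simp
  also have "\<dots> \<le> (\<Sum>n=1..M. 3 ^ CARD('n) * (1 / (real n)\<^sup>2))"
  proof (rule sum_mono)
    fix n assume n: "n \<in> {1..M}"
    then have n1: "real n \<ge> 1" by auto
    have "real (card {q \<in> Q. supnorm q = n}) \<le> (3 * real n) ^ CARD('n)"
      using card_supnorm_le[of n Q] n by (metis atLeastAtMost_iff of_nat_le_iff of_nat_mult of_nat_numeral of_nat_power)
    moreover have "1 / real n ^ a \<le> 1 / real n ^ (CARD('n) + 2)"
      using n1 a by (intro divide_left_mono power_increasing) auto
    ultimately have "real (card {q \<in> Q. supnorm q = n}) * (1 / real n ^ a)
       \<le> (3 * real n) ^ CARD('n) * (1 / real n ^ (CARD('n) + 2))"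
      by (intro mult_mono) auto
    also have "\<dots> = 3 ^ CARD('n) * (1 / (real n)\<^sup>2)"
      using n1 by (simp add: power_add power_mult_distrib power2_eq_square)
    finally show "real (card {q \<in> Q. supnorm q = n}) * (1 / real n ^ a) \<le> 3 ^ CARD('n) * (1 / (real n)\<^sup>2)" .
  qed
  also have "\<dots> = 3 ^ CARD('n) * (\<Sum>n=1..M. 1 / (real n)\<^sup>2)" by (simp only: sum_distrib_left)
  also have "\<dots> \<le> 3 ^ CARD('n) * 2" by (intro mult_left_mono sum_inverse_squares_le) auto
  finally show ?thesis by simp
qed

lemma lap_symbol_ge_coordinate: "(2 * pi / L)\<^sup>2 * (of_int (k i))\<^sup>2 \<le> lap_symbol L k"
  unfolding lap_symbol_def by (intro mult_left_mono member_le_sum) auto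

lemma lap_symbol_ge_supnorm: "(2 * pi / L)\<^sup>2 * (real (supnorm k))\<^sup>2 \<le> lap_symbol L k"
proof -
  obtain i where i: "nat \<bar>k i\<bar> = supnorm k" using supnorm_attained by blast
  then have "real (supnorm k) = \<bar>of_int (k i)\<bar>" by (metis abs_ge_zero nat_0_le of_int_abs of_int_of_nat_eq)
  then show ?thesis using lap_symbol_ge_coordinate[of L k i] by simp
qed

lemma lap_symbol_pos: "L > 0 \<Longrightarrow> k \<noteq> (\<lambda>_. 0) \<Longrightarrow> lap_symbol L k > 0"
proof -
  assume "L > 0" "k \<noteq> (\<lambda>_. 0)"
  then have "0 < (2 * pi / L)\<^sup>2 * (real (supnorm k))\<^sup>2" using supnorm_pos[of k] by simp
  then show ?thesis using lap_symbol_ge_supnorm[of L k] by linarith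
qed

text \<open>On the grid the frequency \<open>k\<close> coincides with \<open>alias_rep N k\<close>, which for even \<open>N\<close> lies in the box
  \<open>{-N/2..<N/2}\<close> of frequencies resolved by the discrete operator.\<close>

definition alias_rep :: "nat \<Rightarrow> ('n \<Rightarrow> int) \<Rightarrow> 'n \<Rightarrow> int" where
  "alias_rep N k i = (k i + int (N div 2)) mod int N - int (N div 2)"

definition alias_quot :: "nat \<Rightarrow> ('n \<Rightarrow> int) \<Rightarrow> 'n \<Rightarrow> int" where
  "alias_quot N k i = (k i + int (N div 2)) div int N"

lemma alias_rep_alias_quot: "k i = alias_rep N k i + int N * alias_quot N k i"
proof -
  have "k i + int (N div 2) = (k i + int (N div 2)) mod int N + int N * ((k i + int (N div 2)) div int N)"
    by simp
  then show ?thesis unfolding alias_rep_def alias_quot_def by linarith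
qed

lemma alias_rep_le: "even N \<Longrightarrow> N > 0 \<Longrightarrow> 2 * \<bar>alias_rep N k i\<bar> \<le> int N"
proof -
  assume N: "even N" "N > 0"
  then obtain M where M: "N = 2 * M" by blast
  have "0 \<le> (k i + int (N div 2)) mod int N" "(k i + int (N div 2)) mod int N < int N" using N by auto
  then show ?thesis unfolding alias_rep_def M by simp
qed

lemma alias_rep_eq_iff: "N > 0 \<Longrightarrow> alias_rep N k = alias_rep N l \<longleftrightarrow> (\<forall>i. int N dvd k i - l i)"
  by (auto simp: alias_rep_def fun_eq_iff mod_eq_dvd_iff)

lemma alias_quot_eq_0: "alias_quot N k = (\<lambda>_. 0) \<Longrightarrow> alias_rep N k = k"
  using alias_rep_alias_quot[of k _ N] by (auto simp: fun_eq_iff)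

text \<open>A coordinate that is moved at all satisfies \<open>\<bar>alias_rep N k i\<bar> \<le> N /
  2 \<le> \<bar>k i\<bar>\<close>. Consequently the error in the symbol at \<open>k\<close> never
  exceeds \<open>lap_symbol L k\<close> itself.\<close>

lemma lap_symbol_alias_rep_le:
  assumes N: "even N" "N > 0"
  shows "lap_symbol L (alias_rep N k) \<le> lap_symbol L k"
  unfolding lap_symbol_def
proof (intro mult_left_mono sum_mono)
  fix i
  have "\<bar>alias_rep N k i\<bar> \<le> \<bar>k i\<bar>"
  proof (cases "alias_quot N k i = 0")
    case True
    then show ?thesis using alias_rep_alias_quot[of k i N] by simp
  next
    case False
    then have "int N * 1 \<le> int N * \<bar>alias_quot N k i\<bar>" by (intro mult_left_mono) auto
    then have "int N \<le> \<bar>int N * alias_quot N k i\<bar>" by (simp add: abs_mult)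
    then show ?thesis using alias_rep_alias_quot[of k i N] alias_rep_le[OF N, of k i] by linarith
  qed
  then show "(real_of_int (alias_rep N k i))\<^sup>2 \<le> (of_int (k i))\<^sup>2"
    by (metis abs_le_square_iff of_int_abs of_int_le_iff)
qed auto

text \<open>At a coordinate where the quotient \<open>q\<close> attains its \<open>supnorm\<close>,
  \<open>\<bar>k i\<bar> \<ge> N * \<bar>q\<bar> - N / 2 \<ge> N * \<bar>q\<bar> / 2\<close> if
  \<open>q\<close> is nonzero. This halving is why \<open>pi\<close> stands where the symbol has
  \<open>2 * pi\<close>.\<close>

lemma lap_symbol_ge_alias_quot:
  assumes N: "even N" "N > 0" and L: "L > 0"
  shows "(pi * real N / L * real (supnorm (alias_quot N k)))\<^sup>2 \<le> lap_symbol L k"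
proof -
  obtain i where i: "nat \<bar>alias_quot N k i\<bar> = supnorm (alias_quot N k)" using supnorm_attained by blast
  then have s: "int (supnorm (alias_quot N k)) = \<bar>alias_quot N k i\<bar>" by auto
  have "int N * int (supnorm (alias_quot N k)) \<le> 2 * \<bar>k i\<bar>"
  proof (cases "alias_quot N k i = 0")
    case False
    then have "int N * 1 \<le> int N * \<bar>alias_quot N k i\<bar>" by (intro mult_left_mono) auto
    moreover have "\<bar>int N * alias_quot N k i\<bar> = int N * \<bar>alias_quot N k i\<bar>" by (simp add: abs_mult)
    ultimately show ?thesis unfolding s using alias_rep_alias_quot[of k i N] alias_rep_le[OF N, of k i] by linarith
  qed (simp add: s)
  then have "real_of_int (int N * int (supnorm (alias_quot N k))) \<le> of_int (2 * \<bar>k i\<bar>)" by (simp only: of_int_le_iff)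
  then have le: "real N * real (supnorm (alias_quot N k)) \<le> 2 * \<bar>of_int (k i)\<bar>" by simp
  have "pi * real N / L * real (supnorm (alias_quot N k)) = (pi / L) * (real N * real (supnorm (alias_quot N k)))" by simp
  also have "\<dots> \<le> (pi / L) * (2 * \<bar>of_int (k i)\<bar>)" using le L by (intro mult_left_mono) auto
  finally have "(pi * real N / L * real (supnorm (alias_quot N k)))\<^sup>2 \<le> ((pi / L) * (2 * \<bar>of_int (k i)\<bar>))\<^sup>2"
    using L by (intro power_mono) auto
  also have "\<dots> = (2 * pi / L)\<^sup>2 * (of_int (k i))\<^sup>2" by (simp add: power_mult_distrib power_divide)
  also have "\<dots> \<le> lap_symbol L k" by (rule lap_symbol_ge_coordinate)
  finally show ?thesis .
qed

text \<open>Absorbs the constant of \<open>lattice_sum_le\<close>, using \<open>pi > 3\<close>. The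
  divisor 4 becomes the factor 1/2 in the amplitude once a square root is taken.\<close>

lemma pi_lattice_le:
  assumes s: "d + 7 \<le> 4 * s"
  shows "2 * 3 ^ d \<le> (pi ^ (4 * s) / 4 :: real)"
proof -
  have "8 * 3 ^ d \<le> (3 :: real) ^ (d + 7)" by (simp add: power_add)
  also have "\<dots> \<le> 3 ^ (4 * s)" using s by (intro power_increasing) auto
  also have "\<dots> \<le> pi ^ (4 * s)" using pi_gt3 by (intro power_mono) auto
  finally show ?thesis by simp
qed

text \<open>Inside one residue class a frequency is determined by \<open>alias_quot N k\<close>, and
  leaving out the representative \<open>m\<close> leaves out the quotient 0. The sum thus becomes a
  lattice sum over nonzero quotients.\<close>

lemma alias_sum_le:
  fixes F :: "('n::finite \<Rightarrow> int) set" and L :: real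
  assumes N: "even N" "N > 0" and L: "L > 0" and s: "CARD('n) + 7 \<le> 4 * s"
    and F: "finite F" "\<And>k. k \<in> F \<Longrightarrow> alias_rep N k = m" "m \<notin> F"
  shows "(\<Sum>k\<in>F. 1 / lap_symbol L k ^ (2 * s)) \<le> ((L * CARD('n) / N) ^ (2 * s) / 2)\<^sup>2"
proof -
  define P where "P = pi * real N / L"
  have P: "P > 0" using N L by (simp add: P_def)
  have inj: "inj_on (alias_quot N) F"
  proof (rule inj_onI)
    fix k l assume "k \<in> F" "l \<in> F" "alias_quot N k = alias_quot N l"
    then show "k = l" using F(2) alias_rep_alias_quot[of k _ N] alias_rep_alias_quot[of l _ N] by (auto simp: fun_eq_iff)
  qed
  have nz: "(\<lambda>_. 0) \<notin> alias_quot N ` F"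
    using F alias_quot_eq_0[of N] by (metis imageE)
  have "(\<Sum>k\<in>F. 1 / lap_symbol L k ^ (2 * s)) \<le> (\<Sum>k\<in>F. 1 / P ^ (4 * s) * (1 / real (supnorm (alias_quot N k)) ^ (4 * s)))"
  proof (rule sum_mono)
    fix k assume k: "k \<in> F"
    then have "alias_quot N k \<noteq> (\<lambda>_. 0)" using nz by (metis imageI)
    then have "supnorm (alias_quot N k) \<ge> 1" by (rule supnorm_pos)
    then have pos: "0 < P * real (supnorm (alias_quot N k))" using P by simp
    have "(P * real (supnorm (alias_quot N k))) ^ (4 * s) = ((P * real (supnorm (alias_quot N k)))\<^sup>2) ^ (2 * s)"
      by (simp flip: power_mult)
    also have "\<dots> \<le> lap_symbol L k ^ (2 * s)"
      using lap_symbol_ge_alias_quot[OF N L, of k] by (intro power_mono) (auto simp: P_def)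
    finally have "1 / lap_symbol L k ^ (2 * s) \<le> 1 / (P * real (supnorm (alias_quot N k))) ^ (4 * s)"
      by (intro frac_le zero_less_power pos) auto
    then show "1 / lap_symbol L k ^ (2 * s) \<le> 1 / P ^ (4 * s) * (1 / real (supnorm (alias_quot N k)) ^ (4 * s))"
      by (simp add: power_mult_distrib)
  qed
  also have "\<dots> = 1 / P ^ (4 * s) * (\<Sum>q\<in>alias_quot N ` F. 1 / real (supnorm q) ^ (4 * s))"
    by (simp add: sum.reindex[OF inj] o_def sum_distrib_left)
  also have "\<dots> \<le> 1 / P ^ (4 * s) * (2 * 3 ^ CARD('n))"
    using F(1) nz s P by (intro mult_left_mono lattice_sum_le) auto
  also have "\<dots> \<le> 1 / P ^ (4 * s) * (pi ^ (4 * s) / 4)"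
    using P by (intro mult_left_mono pi_lattice_le s) auto
  also have "\<dots> = (L / N) ^ (4 * s) / 4"
    by (simp add: P_def power_divide power_mult_distrib)
  also have "\<dots> \<le> (L * CARD('n) / N) ^ (4 * s) / 4"
  proof -
    have "L * 1 \<le> L * real CARD('n)" using L by (intro mult_left_mono) (auto simp: Suc_le_eq)
    then show ?thesis using L by (intro divide_right_mono power_mono) (auto intro: divide_right_mono)
  qed
  also have "\<dots> = ((L * CARD('n) / N) ^ (2 * s) / 2)\<^sup>2"
    by (simp add: power_divide flip: power_mult)
  finally show ?thesis .
qed

text \<open>Serves to establish convergence of Fourier series; what matters is that the constant is
  independent of \<open>F\<close>.\<close>

lemma lap_symbol_sum_bounded:
  fixes L :: real
  assumes L: "L > 0" and s: "CARD('n) + 2 \<le> 4 * s"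
  obtains C where "C \<ge> 0" "\<And>F :: ('n::finite \<Rightarrow> int) set. finite F \<Longrightarrow> (\<lambda>_. 0) \<notin> F \<Longrightarrow> (\<Sum>k\<in>F. 1 / lap_symbol L k ^ (2 * s)) \<le> C"
proof
  define P where "P = 2 * pi / L"
  have P: "P > 0" using L by (simp add: P_def)
  show "0 \<le> 1 / P ^ (4 * s) * (2 * 3 ^ CARD('n))" using P by simp
  fix F :: "('n \<Rightarrow> int) set" assume F: "finite F" "(\<lambda>_. 0) \<notin> F"
  have "(\<Sum>k\<in>F. 1 / lap_symbol L k ^ (2 * s)) \<le> (\<Sum>k\<in>F. 1 / P ^ (4 * s) * (1 / real (supnorm k) ^ (4 * s)))"
  proof (rule sum_mono)
    fix k assume k: "k \<in> F"
    then have "supnorm k \<ge> 1" using F by (intro supnorm_pos) auto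
    then have pos: "0 < P * real (supnorm k)" using P by simp
    have "(P * real (supnorm k)) ^ (4 * s) = ((P * real (supnorm k))\<^sup>2) ^ (2 * s)"
      by (simp flip: power_mult)
    also have "\<dots> \<le> lap_symbol L k ^ (2 * s)"
      using lap_symbol_ge_supnorm[of L k] by (intro power_mono) (auto simp: P_def power_mult_distrib power_divide)
    finally have "1 / lap_symbol L k ^ (2 * s) \<le> 1 / (P * real (supnorm k)) ^ (4 * s)"
      by (intro frac_le zero_less_power pos) auto
    then show "1 / lap_symbol L k ^ (2 * s) \<le> 1 / P ^ (4 * s) * (1 / real (supnorm k) ^ (4 * s))"
      by (simp add: power_mult_distrib)
  qed
  also have "\<dots> = 1 / P ^ (4 * s) * (\<Sum>k\<in>F. 1 / real (supnorm k) ^ (4 * s))"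
    by (simp add: sum_distrib_left)
  also have "\<dots> \<le> 1 / P ^ (4 * s) * (2 * 3 ^ CARD('n))"
    using F s P by (intro mult_left_mono lattice_sum_le) auto
  finally show "(\<Sum>k\<in>F. 1 / lap_symbol L k ^ (2 * s)) \<le> 1 / P ^ (4 * s) * (2 * 3 ^ CARD('n))" .
qed

section \<open>The discrete Laplacian in the grid characters\<close>

definition unit_root :: "nat \<Rightarrow> int \<Rightarrow> complex" where
  "unit_root N n = cis (2 * pi * of_int n / of_nat N)"

lemma unit_root_add: "unit_root N (m + n) = unit_root N m * unit_root N n"
  by (simp add: unit_root_def cis_mult distrib_left add_divide_distrib)

lemma cnj_unit_root: "cnj (unit_root N n) = unit_root N (- n)"
  by (simp add: unit_root_def cis_cnj)

lemma unit_root_0 [simp]: "unit_root N 0 = 1"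
  by (simp add: unit_root_def)

lemma unit_root_eq_1_iff:
  assumes "N > 0"
  shows "unit_root N n = 1 \<longleftrightarrow> int N dvd n"
proof
  assume "unit_root N n = 1"
  then have "cos (2 * pi * of_int n / of_nat N) = 1" by (simp add: unit_root_def complex_eq_iff)
  then obtain m :: int where m: "2 * pi * of_int n / of_nat N = of_int m * (2 * pi)"
    unfolding cos_one_2pi_int by auto
  then have "2 * pi * of_int n = 2 * pi * (of_int m * of_nat N)"
    using assms by (simp add: field_simps)
  then have "real_of_int n = of_int (m * int N)" by simp
  then have "n = m * int N" by (simp only: of_int_eq_iff)
  then show "int N dvd n" by simp
next
  assume "int N dvd n"
  then obtain m where "n = int N * m" ..
  then have eq: "2 * pi * of_int n / of_nat N = 2 * pi * of_int m" using assms by simp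
  show "unit_root N n = 1" unfolding unit_root_def eq by (rule cis_multiple_2pi) simp
qed

lemma unit_root_cong: "N > 0 \<Longrightarrow> int N dvd m - n \<Longrightarrow> unit_root N m = unit_root N n"
  using unit_root_add[of N "m - n" n] unit_root_eq_1_iff[of N "m - n"] by simp

lemma unit_root_power: "unit_root N n ^ b = unit_root N (n * int b)"
  unfolding unit_root_def Complex.DeMoivre by (rule arg_cong[where f = cis]) simp

lemma sum_unit_root:
  assumes N: "N > 0"
  shows "(\<Sum>b<N. unit_root N (n * int b)) = (if int N dvd n then of_nat N else 0)"
proof (cases "int N dvd n")
  case True
  then have "unit_root N (n * int b) = 1" for b using unit_root_eq_1_iff[OF N, of "n * int b"] by simp
  then show ?thesis using True by simp
next
  case False
  have "(\<Sum>b<N. unit_root N (n * int b)) = (\<Sum>b<N. unit_root N n ^ b)" by (simp add: unit_root_power)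
  also have "\<dots> = (unit_root N n ^ N - 1) / (unit_root N n - 1)"
    using False unit_root_eq_1_iff[OF N] by (intro geometric_sum) auto
  also have "unit_root N n ^ N = 1" using unit_root_eq_1_iff[OF N] by (simp add: unit_root_power)
  finally show ?thesis using False by simp
qed

lemma Fmat_unit_root: "Fmat N a l = unit_root N (int a * int l) / of_real (sqrt (real N))"
proof -
  have "exp (2 * pi * \<i> * of_nat a * of_nat l / of_nat N) = cis (2 * pi * of_int (int a * int l) / of_nat N)"
    unfolding cis_conv_exp by (simp add: mult_ac)
  then show ?thesis by (simp add: Fmat_def unit_root_def)
qed

lemma Smat_unit_root:
  assumes "N = 2 * h" "h > 0"
  shows "Smat a = unit_root N (int a * int h)"
proof -
  have "(-1 :: complex) ^ a = cis (pi * a)" by (simp add: Complex.DeMoivre mult.commute flip: cis_pi)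
  then show ?thesis using assms by (simp add: Smat_def unit_root_def)
qed

text \<open>With \<open>h = N / 2\<close>, the sign \<open>(-1) ^ a\<close> is the root of unity
  with exponent \<open>a * h\<close>. Conjugation by the sign matrix therefore moves column
  \<open>l\<close> of the Fourier matrix to the frequency \<open>l + h\<close>, which is
  \<open>l - N / 2\<close> modulo \<open>N\<close> and so fits the diagonal entry
  \<open>DKdiag L N l\<close>.\<close>

lemma M1_unit_root:
  assumes N: "N = 2 * h" "h > 0"
  shows "M1 L N a b = (\<Sum>l<N. DKdiag L N l * unit_root N ((int a - int b) * (int l + int h)) / of_nat N)"
  unfolding M1_def
proof (rule sum.cong)
  fix l
  have sq: "complex_of_real (sqrt (real N)) * of_real (sqrt (real N)) = of_nat N"
    by (simp flip: of_real_mult)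
  have "Smat a * Fmat N a l * DKdiag L N l * cnj (Fmat N b l) * cnj (Smat b)
     = DKdiag L N l * (unit_root N (int a * int h) * unit_root N (int a * int l) * unit_root N (- (int b * int l)) * unit_root N (- (int b * int h)))
       / (of_real (sqrt (real N)) * of_real (sqrt (real N)))"
    by (simp add: Fmat_unit_root Smat_unit_root[OF N] cnj_unit_root)
  also have "\<dots> = DKdiag L N l * unit_root N ((int a - int b) * (int l + int h)) / of_nat N"
    unfolding sq by (simp add: algebra_simps flip: unit_root_add)
  finally show "Smat a * Fmat N a l * DKdiag L N l * cnj (Fmat N b l) * cnj (Smat b)
     = DKdiag L N l * unit_root N ((int a - int b) * (int l + int h)) / of_nat N" .
qed simp

lemma cnj_M1: "cnj (M1 L N a b) = M1 L N b a"
  unfolding M1_def by (simp add: DKdiag_def mult_ac)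

text \<open>Summing over \<open>b\<close> is a geometric sum that annihilates every \<open>l\<close>
  except the one, \<open>l0\<close>, with \<open>l0 - N / 2\<close> congruent to \<open>k\<close>;
  that number is the representative of \<open>k\<close> in the resolved range.\<close>

lemma M1_eigen:
  assumes N: "even N" "N > 0"
  shows "(\<Sum>b<N. M1 L N a b * unit_root N (k * int b))
     = of_real ((2 * pi / L)\<^sup>2 * (of_int ((k + int (N div 2)) mod int N - int (N div 2)))\<^sup>2) * unit_root N (k * int a)"
proof -
  obtain h where h: "N = 2 * h" "h > 0" using N by auto
  define l0 where "l0 = nat ((k + int h) mod int N)"
  have l0: "l0 < N" "int l0 = (k + int h) mod int N" using N by (auto simp: l0_def nat_less_iff)
  have dv: "int N dvd k - int l - int h \<longleftrightarrow> l = l0" if "l < N" for l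
  proof -
    have "int N dvd k - int l - int h \<longleftrightarrow> int N dvd (k + int h) - int l"
    proof -
      \<comment> \<open>Since \<open>N = 2 * h\<close>, shifting by \<open>h\<close> and by
        \<open>- h\<close> is the same modulo \<open>N\<close>; the shift by \<open>h\<close> is the
        one in \<open>alias_rep\<close>.\<close>
      have eq: "k - int l - int h = (k + int h - int l) + (- 1) * int N" using h by simp
      show ?thesis unfolding eq by (rule dvd_add_times_triv_right_iff)
    qed
    also have "\<dots> \<longleftrightarrow> (k + int h) mod int N = int l mod int N" by (simp add: mod_eq_dvd_iff)
    also have "\<dots> \<longleftrightarrow> l = l0" using l0 that by auto
    finally show ?thesis .
  qed
  have "(\<Sum>b<N. M1 L N a b * unit_root N (k * int b))
      = (\<Sum>b<N. \<Sum>l<N. DKdiag L N l * unit_root N (int a * (int l + int h)) / of_nat N * unit_root N ((k - int l - int h) * int b))"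
  proof -
    have "unit_root N ((int a - int b) * (int l + int h)) * unit_root N (k * int b)
       = unit_root N (int a * (int l + int h)) * unit_root N ((k - int l - int h) * int b)" for b l
      unfolding unit_root_add[symmetric] by (rule arg_cong[where f = "unit_root N"]) (simp add: algebra_simps)
    then show ?thesis
      unfolding M1_unit_root[OF h] sum_distrib_right by (intro sum.cong refl) simp
  qed
  also have "\<dots> = (\<Sum>l<N. DKdiag L N l * unit_root N (int a * (int l + int h)) / of_nat N * (\<Sum>b<N. unit_root N ((k - int l - int h) * int b)))"
    by (subst sum.swap) (simp only: sum_distrib_left)
  also have "\<dots> = (\<Sum>l<N. if l = l0 then DKdiag L N l * unit_root N (int a * (int l + int h)) else 0)"
    using N(2) by (intro sum.cong refl) (auto simp: sum_unit_root dv)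
  also have "\<dots> = DKdiag L N l0 * unit_root N (int a * (int l0 + int h))" using l0(1) by simp
  also have "unit_root N (int a * (int l0 + int h)) = unit_root N (k * int a)"
  proof (rule unit_root_cong[OF N(2)])
    have "int N dvd k - int l0 - int h" using dv[OF l0(1)] by simp
    moreover have "int a * (int l0 + int h) - k * int a = - int a * (k - int l0 - int h)"
      by (simp add: algebra_simps)
    ultimately show "int N dvd int a * (int l0 + int h) - k * int a" by simp
  qed
  also have "DKdiag L N l0 = of_real ((2 * pi / L)\<^sup>2 * (of_int ((k + int (N div 2)) mod int N - int (N div 2)))\<^sup>2)"
  proof -
    have "real l0 - real N / 2 = of_int ((k + int (N div 2)) mod int N - int (N div 2))"
    proof -
      have "real l0 = of_int ((k + int h) mod int N)" by (metis l0(2) of_int_of_nat_eq)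
      moreover have "N div 2 = h" "real N / 2 = real h" using h by auto
      ultimately show ?thesis by simp
    qed
    then show ?thesis by (simp add: DKdiag_def)
  qed
  finally show ?thesis .
qed

section \<open>Characters of the grid and the operators in several dimensions\<close>

definition grid_char :: "nat \<Rightarrow> ('n::finite \<Rightarrow> int) \<Rightarrow> ('n \<Rightarrow> nat) \<Rightarrow> complex" where
  "grid_char N k j = unit_root N (\<Sum>i\<in>UNIV. k i * int (j i))"

lemma torus_char_grid_pt: "L \<noteq> 0 \<Longrightarrow> torus_char L k (grid_pt L N j) = grid_char N k j"
proof -
  assume L: "L \<noteq> 0"
  have "2 * pi / L * (\<Sum>i\<in>UNIV. of_int (k i) * (L * real (j i) / real N))
     = 2 * pi * (\<Sum>i\<in>UNIV. of_int (k i) * real (j i)) / real N"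
    using L by (simp add: sum_distrib_left sum_divide_distrib mult.assoc)
  then show ?thesis by (simp add: torus_char_def grid_char_def unit_root_def grid_pt_def)
qed

lemma grid_pt_in_cube: "L \<ge> 0 \<Longrightarrow> j \<in> grid_idx N \<Longrightarrow> grid_pt L N j \<in> torus_cube L"
proof -
  assume L: "L \<ge> 0" and j: "j \<in> grid_idx N"
  have "L * real (j i) / real N \<le> L" for i
  proof -
    have "j i < N" using j by (simp add: grid_idx_def)
    then have "real (j i) / real N \<le> 1" by simp
    then have "L * (real (j i) / real N) \<le> L * 1" using L by (intro mult_left_mono)
    then show ?thesis by simp
  qed
  then show ?thesis using L by (simp add: torus_cube_def grid_pt_def mem_box_cart)
qed

lemma finite_grid_idx [simp]: "finite (grid_idx N :: ('n::finite \<Rightarrow> nat) set)"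
proof -
  have "grid_idx N = PiE UNIV (\<lambda>_::'n. {..<N})" by (auto simp: grid_idx_def PiE_iff)
  then show ?thesis by (simp add: finite_PiE)
qed

lemma grid_idx_fun_upd: "j \<in> grid_idx N \<Longrightarrow> b < N \<Longrightarrow> j(i := b) \<in> grid_idx N"
  by (simp add: grid_idx_def)

text \<open>Changing the \<open>i\<close>-th grid coordinate affects one factor of the character, so
  each axis contributes its one-dimensional eigenvalue and these add up to the symbol of the
  representative.\<close>

lemma Kop_grid_char:
  assumes N: "even N" "N > 0"
  shows "Kop L N (grid_char N k) j = of_real (lap_symbol L (alias_rep N k) / 2) * grid_char N k j"
proof -
  have "(\<Sum>b<N. M1 L N (j i) b * grid_char N k (j(i := b)))
      = of_real ((2 * pi / L)\<^sup>2 * (of_int (alias_rep N k i))\<^sup>2) * grid_char N k j" for i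
  proof -
    define r where "r = (\<Sum>i'\<in>UNIV - {i}. k i' * int (j i'))"
    have d: "grid_char N k (j(i := b)) = unit_root N r * unit_root N (k i * int b)" for b
    proof -
      have "(\<Sum>i'\<in>UNIV. k i' * int ((j(i := b)) i')) = r + k i * int b"
        by (simp add: r_def sum.remove[of UNIV i])
      then show ?thesis by (simp add: grid_char_def unit_root_add)
    qed
    have "grid_char N k j = unit_root N r * unit_root N (k i * int (j i))" using d[of "j i"] by simp
    moreover have "(\<Sum>b<N. M1 L N (j i) b * grid_char N k (j(i := b))) = unit_root N r * (\<Sum>b<N. M1 L N (j i) b * unit_root N (k i * int b))"
      by (simp add: d sum_distrib_left mult_ac)
    ultimately show ?thesis unfolding M1_eigen[OF N] alias_rep_def by (simp only: mult_ac)
  qed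
  then show ?thesis
    by (simp add: Kop_def lap_symbol_def sum_distrib_left sum_distrib_right)
qed

lemma Kop_sum: "Kop L N (\<lambda>j. \<Sum>a\<in>A. f a j) j = (\<Sum>a\<in>A. Kop L N (f a) j)"
proof -
  have "(\<Sum>i\<in>UNIV. \<Sum>b<N. M1 L N (j i) b * (\<Sum>a\<in>A. f a (j(i := b))))
     = (\<Sum>i\<in>UNIV. \<Sum>a\<in>A. \<Sum>b<N. M1 L N (j i) b * f a (j(i := b)))"
    unfolding sum_distrib_left by (intro sum.cong refl sum.swap)
  also have "\<dots> = (\<Sum>a\<in>A. \<Sum>i\<in>UNIV. \<Sum>b<N. M1 L N (j i) b * f a (j(i := b)))"
    by (rule sum.swap)
  finally show ?thesis
    unfolding Kop_def by (simp only: sum_distrib_left[of "1/2::complex" _ A, symmetric])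
qed

lemma Kop_cmult: "Kop L N (\<lambda>j. c * f j) j = c * Kop L N f j"
  by (simp add: Kop_def sum_distrib_left mult_ac)

lemma Kop_diff: "Kop L N (\<lambda>j. f j - g j) j = Kop L N f j - Kop L N g j"
  by (simp add: Kop_def right_diff_distrib sum_subtractf)

lemma inner_mult_cnj: "(c * z) \<bullet> w = z \<bullet> (cnj c * w)" for c z w :: complex
  by (simp add: inner_complex_def algebra_simps)

text \<open>The product is the real inner product on complex numbers, the real part of the Hermitian
  one. Exchanging the coordinate \<open>j i\<close> with the summation index \<open>b\<close> is an
  involution that transposes the entry of \<open>M1\<close>, which is a Hermitian matrix.\<close>

lemma Kop_symmetric:
  "(\<Sum>j\<in>grid_idx N. v j \<bullet> Kop L N w j) = (\<Sum>j\<in>grid_idx N. Kop L N v j \<bullet> w j)"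
proof -
  have swap: "(\<Sum>j\<in>grid_idx N. \<Sum>b<N. v j \<bullet> (M1 L N (j i) b * w (j(i := b))))
      = (\<Sum>j\<in>grid_idx N. \<Sum>b<N. (M1 L N (j i) b * v (j(i := b))) \<bullet> w j)" for i
    unfolding sum.cartesian_product
    by (rule sum.reindex_bij_witness[where i = "\<lambda>(j, b). (j(i := b), j i)" and j = "\<lambda>(j, b). (j(i := b), j i)"])
       (auto simp: grid_idx_def inner_mult_cnj cnj_M1)
  have l: "(\<Sum>j\<in>grid_idx N. v j \<bullet> Kop L N w j)
      = (1/2) * (\<Sum>i\<in>UNIV. \<Sum>j\<in>grid_idx N. \<Sum>b<N. v j \<bullet> (M1 L N (j i) b * w (j(i := b))))"
  proof -
    have "v j \<bullet> Kop L N w j = (1/2) * (\<Sum>i\<in>UNIV. \<Sum>b<N. v j \<bullet> (M1 L N (j i) b * w (j(i := b))))" for j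
    proof -
      have "Kop L N w j = (1/2) *\<^sub>R (\<Sum>i\<in>UNIV. \<Sum>b<N. M1 L N (j i) b * w (j(i := b)))"
        by (simp add: Kop_def scaleR_conv_of_real)
      then show ?thesis by (simp add: inner_sum_right)
    qed
    then show ?thesis
      by (simp only: sum_distrib_left[symmetric]) (subst sum.swap, rule refl)
  qed
  have r: "(\<Sum>j\<in>grid_idx N. Kop L N v j \<bullet> w j)
      = (1/2) * (\<Sum>i\<in>UNIV. \<Sum>j\<in>grid_idx N. \<Sum>b<N. (M1 L N (j i) b * v (j(i := b))) \<bullet> w j)"
  proof -
    have "Kop L N v j \<bullet> w j = (1/2) * (\<Sum>i\<in>UNIV. \<Sum>b<N. (M1 L N (j i) b * v (j(i := b))) \<bullet> w j)" for j
    proof -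
      have "Kop L N v j = (1/2) *\<^sub>R (\<Sum>i\<in>UNIV. \<Sum>b<N. M1 L N (j i) b * v (j(i := b)))"
        by (simp add: Kop_def scaleR_conv_of_real)
      then show ?thesis by (simp add: inner_sum_left)
    qed
    then show ?thesis
      by (simp only: sum_distrib_left[symmetric]) (subst sum.swap, rule refl)
  qed
  show ?thesis unfolding l r swap ..
qed

lemma DVop_symmetric: "v j \<bullet> DVop L N V w j = DVop L N V v j \<bullet> w j"
  by (simp add: DVop_def inner_mult_cnj)

lemma Hc_eq: "- \<i> * Hc L N V v j = Kop L N (DVop L N V v) j - DVop L N V (Kop L N v) j"
  by (simp add: Hc_def)

text \<open>Both halves of the commutator equal the pairing of \<open>Kop L N v\<close> with
  \<open>DVop L N V v\<close>. This infinitesimal conservation of the norm removes the commutator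
  from every derivative of a squared norm below.\<close>

lemma commutator_skew:
  "(\<Sum>j\<in>grid_idx N. v j \<bullet> (Kop L N (DVop L N V v) j - DVop L N V (Kop L N v) j)) = 0"
proof -
  have "v j \<bullet> DVop L N V (Kop L N v) j = Kop L N v j \<bullet> DVop L N V v j" for j
    by (subst DVop_symmetric) (rule inner_commute)
  then show ?thesis
    unfolding inner_diff_right sum_subtractf Kop_symmetric by simp
qed

lemma sum_grid_char:
  fixes k :: "'n::finite \<Rightarrow> int"
  assumes N: "N > 0"
  shows "(\<Sum>j\<in>grid_idx N. grid_char N k j) = (if \<forall>i. int N dvd k i then of_nat (N ^ CARD('n)) else 0)"
  proof -
  have g: "grid_idx N = PiE UNIV (\<lambda>_::'n. {..<N})" by (auto simp: grid_idx_def PiE_iff)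
  have z: "unit_root N (\<Sum>i\<in>A. f i) = (\<Prod>i\<in>A. unit_root N (f i))" if "finite A" for A and f :: "'n \<Rightarrow> int"
    using that by (induction A) (auto simp: unit_root_add)
  have "(\<Sum>j\<in>grid_idx N. grid_char N k j) = (\<Prod>i\<in>UNIV. \<Sum>b<N. unit_root N (k i * int b))"
    unfolding g grid_char_def by (subst prod_sum_PiE) (auto simp: z)
  then show ?thesis using N by (auto simp: sum_unit_root)
qed

lemma grid_char_mult_cnj: "grid_char N k j * cnj (grid_char N l j) = grid_char N (\<lambda>i. k i - l i) j"
  by (simp add: grid_char_def cnj_unit_root left_diff_distrib sum_subtractf flip: unit_root_add)

text \<open>Frequencies in one residue class coincide on the grid, so their coefficients add before
  the square is taken; different classes are orthogonal there.\<close>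

lemma discrete_parseval:
  fixes c :: "('n::finite \<Rightarrow> int) \<Rightarrow> complex"
  assumes N: "N > 0" and F: "finite F"
  shows "(\<Sum>j\<in>grid_idx N. (norm (\<Sum>k\<in>F. c k * grid_char N k j))\<^sup>2)
     = N ^ CARD('n) * (\<Sum>m\<in>alias_rep N ` F. (norm (\<Sum>k\<in>{k\<in>F. alias_rep N k = m}. c k))\<^sup>2)"
proof -
  have "complex_of_real (\<Sum>j\<in>grid_idx N. (norm (\<Sum>k\<in>F. c k * grid_char N k j))\<^sup>2)
     = (\<Sum>j\<in>grid_idx N. \<Sum>k\<in>F. \<Sum>l\<in>F. c k * cnj (c l) * grid_char N (\<lambda>i. k i - l i) j)"
    unfolding of_real_sum complex_norm_square cnj_sum sum_product complex_cnj_mult grid_char_mult_cnj[symmetric]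
    by (simp only: mult_ac)
  also have "\<dots> = (\<Sum>k\<in>F. \<Sum>l\<in>F. c k * cnj (c l) * (\<Sum>j\<in>grid_idx N. grid_char N (\<lambda>i. k i - l i) j))"
    unfolding sum_distrib_left
    by (subst sum.swap, rule sum.cong[OF refl], subst sum.swap, rule refl)
  also have "\<dots> = (\<Sum>k\<in>F. \<Sum>l\<in>F. of_nat (N ^ CARD('n)) * (if alias_rep N l = alias_rep N k then c k * cnj (c l) else 0))"
    by (intro sum.cong refl) (auto simp: sum_grid_char[OF N] alias_rep_eq_iff[OF N] dvd_diff_commute)
  also have "\<dots> = of_nat (N ^ CARD('n)) * (\<Sum>k\<in>F. \<Sum>l\<in>{l\<in>F. alias_rep N l = alias_rep N k}. c k * cnj (c l))"
    by (simp only: sum.inter_filter[OF F] sum_distrib_left)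
  also have "(\<Sum>k\<in>F. \<Sum>l\<in>{l\<in>F. alias_rep N l = alias_rep N k}. c k * cnj (c l))
     = (\<Sum>m\<in>alias_rep N ` F. \<Sum>k\<in>{k\<in>F. alias_rep N k = m}. \<Sum>l\<in>{l\<in>F. alias_rep N l = alias_rep N k}. c k * cnj (c l))"
    by (rule sum.image_gen[OF F])
  also have "\<dots> = (\<Sum>m\<in>alias_rep N ` F. \<Sum>k\<in>{k\<in>F. alias_rep N k = m}. \<Sum>l\<in>{l\<in>F. alias_rep N l = m}. c k * cnj (c l))"
    by (intro sum.cong refl) auto
  also have "\<dots> = (\<Sum>m\<in>alias_rep N ` F. of_real ((norm (\<Sum>k\<in>{k\<in>F. alias_rep N k = m}. c k))\<^sup>2))"
    by (simp only: complex_norm_square cnj_sum sum_product)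
  finally have "complex_of_real (\<Sum>j\<in>grid_idx N. (norm (\<Sum>k\<in>F. c k * grid_char N k j))\<^sup>2)
     = of_real (N ^ CARD('n) * (\<Sum>m\<in>alias_rep N ` F. (norm (\<Sum>k\<in>{k\<in>F. alias_rep N k = m}. c k))\<^sup>2))"
    by simp
  then show ?thesis by (simp only: of_real_eq_iff of_nat_power)
qed

section \<open>Aliasing errors on the grid\<close>

lemma vnorm_L2_set: "vnorm N v = L2_set (\<lambda>j. cmod (v j)) (grid_idx N)"
  by (simp add: vnorm_def L2_set_def)

lemma vnorm_nonneg [simp]: "0 \<le> vnorm N v"
  by (simp add: vnorm_L2_set)

lemma vnorm_sq: "(vnorm N v)\<^sup>2 = (\<Sum>j\<in>grid_idx N. (cmod (v j))\<^sup>2)"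
  by (simp add: vnorm_def sum_nonneg)

lemma vnorm_triangle: "vnorm N (\<lambda>j. v j + w j) \<le> vnorm N v + vnorm N w"
proof -
  have "vnorm N (\<lambda>j. v j + w j) \<le> L2_set (\<lambda>j. cmod (v j) + cmod (w j)) (grid_idx N)"
    unfolding vnorm_L2_set by (intro L2_set_mono norm_triangle_ineq) auto
  also have "\<dots> \<le> vnorm N v + vnorm N w"
    unfolding vnorm_L2_set by (rule L2_set_triangle_ineq)
  finally show ?thesis .
qed

lemma vnorm_cmult: "vnorm N (\<lambda>j. c * v j) = cmod c * vnorm N v"
  by (simp add: vnorm_L2_set norm_mult L2_set_right_distrib)

lemma vnorm_diff_ge: "vnorm N v - vnorm N w \<le> vnorm N (\<lambda>j. v j + w j)"
  using vnorm_triangle[of N "\<lambda>j. v j + w j" "\<lambda>j. (- 1) * w j"] vnorm_cmult[of N "-1" w] by simp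

lemma vnorm_inner_le: "\<bar>\<Sum>j\<in>grid_idx N. v j \<bullet> w j\<bar> \<le> vnorm N v * vnorm N w"
proof -
  have "\<bar>\<Sum>j\<in>grid_idx N. v j \<bullet> w j\<bar> \<le> (\<Sum>j\<in>grid_idx N. \<bar>cmod (v j)\<bar> * \<bar>cmod (w j)\<bar>)"
    by (intro order_trans[OF sum_abs] sum_mono) (simp add: Cauchy_Schwarz_ineq2)
  also have "\<dots> \<le> vnorm N v * vnorm N w"
    unfolding vnorm_L2_set by (rule L2_set_mult_ineq)
  finally show ?thesis .
qed

lemma vnorm_tendsto:
  assumes "\<And>j. j \<in> grid_idx N \<Longrightarrow> ((\<lambda>F. v F j) \<longlongrightarrow> w j) net"
  shows "((\<lambda>F. vnorm N (v F)) \<longlongrightarrow> vnorm N w) net"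
  unfolding vnorm_def by (intro tendsto_intros assms)

lemma alias_rep_zero: "even N \<Longrightarrow> N > 0 \<Longrightarrow> alias_rep N (\<lambda>_. 0) = (\<lambda>_. 0)"
  by (auto simp: alias_rep_def fun_eq_iff)

text \<open>No member of \<open>F\<close> represents its class, so \<open>alias_sum_le\<close>
  applies to each class. Cauchy--Schwarz with the weights \<open>1 / lap_symbol L k ^ s\<close> then
  turns the colliding coefficients of a class into a weighted sum of squares, and the classes add up
  to the hypothesis on \<open>B\<close>.\<close>

lemma alias_bound:
  fixes c :: "('n::finite \<Rightarrow> int) \<Rightarrow> complex" and L :: real
  assumes N: "even N" "N > 0" and L: "L > 0" and s: "CARD('n) + 7 \<le> 4 * s"
    and F: "finite F" "\<And>k. k \<in> F \<Longrightarrow> alias_rep N k \<noteq> k"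
    and B: "B \<ge> 0" "L ^ CARD('n) * (\<Sum>k\<in>F. lap_symbol L k ^ (2 * s) * (norm (c k))\<^sup>2) \<le> B\<^sup>2"
  shows "vnorm N (\<lambda>j. \<Sum>k\<in>F. c k * grid_char N k j)
    \<le> sqrt ((real N / L) ^ CARD('n)) * ((L * CARD('n) / N) ^ (2 * s) * B / 2)"
proof -
  define e where "e = (L * CARD('n) / N) ^ (2 * s)"
  have e: "e \<ge> 0" using L by (simp add: e_def)
  \<comment> \<open>The zero frequency represents itself and is therefore not in
    \<open>F\<close>.\<close>
  have pos: "lap_symbol L k > 0" if "k \<in> F" for k
    using F(2)[OF that] alias_rep_zero[OF N, where 'a = 'n] by (intro lap_symbol_pos[OF L]) auto
  have cls: "(norm (\<Sum>k\<in>{k\<in>F. alias_rep N k = m}. c k))\<^sup>2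
      \<le> (e / 2)\<^sup>2 * (\<Sum>k\<in>{k\<in>F. alias_rep N k = m}. lap_symbol L k ^ (2 * s) * (norm (c k))\<^sup>2)" for m
  proof -
    let ?G = "{k\<in>F. alias_rep N k = m}"
    have "norm (\<Sum>k\<in>?G. c k) \<le> (\<Sum>k\<in>?G. (1 / lap_symbol L k ^ s) * (lap_symbol L k ^ s * norm (c k)))"
      by (rule order_trans[OF norm_sum], rule sum_mono) (use pos in fastforce)
    then have "(norm (\<Sum>k\<in>?G. c k))\<^sup>2 \<le> (\<Sum>k\<in>?G. (1 / lap_symbol L k ^ s) * (lap_symbol L k ^ s * norm (c k)))\<^sup>2"
      by (intro power_mono) auto
    also have "\<dots> \<le> (\<Sum>k\<in>?G. (1 / lap_symbol L k ^ s)\<^sup>2) * (\<Sum>k\<in>?G. (lap_symbol L k ^ s * norm (c k))\<^sup>2)"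
      by (rule Cauchy_Schwarz_ineq_sum)
    also have "\<dots> = (\<Sum>k\<in>?G. 1 / lap_symbol L k ^ (2 * s)) * (\<Sum>k\<in>?G. lap_symbol L k ^ (2 * s) * (norm (c k))\<^sup>2)"
      by (simp only: power_divide power_one power_mult_distrib power_mult[symmetric] mult.commute[of _ "2::nat"])
    also have "\<dots> \<le> (e / 2)\<^sup>2 * (\<Sum>k\<in>?G. lap_symbol L k ^ (2 * s) * (norm (c k))\<^sup>2)"
    proof (rule mult_right_mono)
      show "(\<Sum>k\<in>?G. 1 / lap_symbol L k ^ (2 * s)) \<le> (e / 2)\<^sup>2"
        unfolding e_def using F by (intro alias_sum_le[OF N L s, where m = m]) auto
    qed (auto intro!: sum_nonneg mult_nonneg_nonneg lap_symbol_nonneg)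
    finally show ?thesis .
  qed
  have "(vnorm N (\<lambda>j. \<Sum>k\<in>F. c k * grid_char N k j))\<^sup>2
      \<le> real N ^ CARD('n) * (\<Sum>m\<in>alias_rep N ` F. (e / 2)\<^sup>2 * (\<Sum>k\<in>{k\<in>F. alias_rep N k = m}. lap_symbol L k ^ (2 * s) * (norm (c k))\<^sup>2))"
    unfolding vnorm_sq discrete_parseval[OF N(2) F(1)] of_nat_power by (intro mult_left_mono sum_mono cls) auto
  also have "\<dots> = real N ^ CARD('n) * ((e / 2)\<^sup>2 * (\<Sum>k\<in>F. lap_symbol L k ^ (2 * s) * (norm (c k))\<^sup>2))"
    by (simp only: sum_distrib_left[symmetric] sum.image_gen[OF F(1), of "\<lambda>k. lap_symbol L k ^ (2 * s) * (norm (c k))\<^sup>2" "alias_rep N"])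
  also have "\<dots> = (real N / L) ^ CARD('n) * (e / 2)\<^sup>2 * (L ^ CARD('n) * (\<Sum>k\<in>F. lap_symbol L k ^ (2 * s) * (norm (c k))\<^sup>2))"
    using L by (simp add: power_divide)
  also have "\<dots> \<le> (real N / L) ^ CARD('n) * (e / 2)\<^sup>2 * B\<^sup>2"
    using B L by (intro mult_left_mono) auto
  also have "\<dots> = (sqrt ((real N / L) ^ CARD('n)) * (e * B / 2))\<^sup>2"
    using L by (simp add: power_mult_distrib power_divide)
  finally show ?thesis
    using e B L by (auto intro: power2_le_imp_le simp: e_def)
qed

section \<open>Smoothness, decay of coefficients and grid values\<close>

lemma L2_norm_torus_sq:
  fixes f :: "real^'n \<Rightarrow> real"
  assumes "continuous_on UNIV f"
  shows "(L2_norm_torus L f)\<^sup>2 = integral (torus_cube L) (\<lambda>x. (norm (complex_of_real (f x)))\<^sup>2)"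
proof -
  have "0 \<le> integral (torus_cube L) (\<lambda>x. (norm (f x))\<^sup>2)"
    by (intro integral_nonneg integrable_on_torus_cube continuous_intros assms) auto
  then show ?thesis by (simp add: L2_norm_torus_def)
qed

lemma L2_norm_torus_nonneg:
  fixes f :: "real^'n \<Rightarrow> real"
  assumes "continuous_on UNIV f"
  shows "0 \<le> L2_norm_torus L f"
proof -
  have "0 \<le> integral (torus_cube L) (\<lambda>x. (norm (f x))\<^sup>2)"
    by (intro integral_nonneg integrable_on_torus_cube continuous_intros assms) auto
  then show ?thesis by (simp add: L2_norm_torus_def)
qed

text \<open>Bessel's inequality for \<open>(laplacian ^^ n) w\<close>, whose coefficients are those
  of \<open>w\<close> times the \<open>n\<close>-th power of minus the symbol.\<close>

lemma fourier_coef_decay: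
  fixes w :: "real^'n \<Rightarrow> real" and L :: real
  assumes L: "L > 0" and w: "Ck (2 * n) w" "periodic_torus L w" and F: "finite F"
  shows "L ^ CARD('n) * (\<Sum>k\<in>F. lap_symbol L k ^ (2 * n) * (norm (fourier_coeff L (\<lambda>x. of_real (w x)) k))\<^sup>2)
       \<le> (L2_norm_torus L ((laplacian ^^ n) w))\<^sup>2"
proof -
  have "Ck 0 ((laplacian ^^ n) w)" by (rule Ck_laplacian_funpow) (simp add: w)
  then have c: "continuous_on UNIV ((laplacian ^^ n) w)" by simp
  have "(norm (fourier_coeff L (\<lambda>x. of_real ((laplacian ^^ n) w x)) k))\<^sup>2
      = lap_symbol L k ^ (2 * n) * (norm (fourier_coeff L (\<lambda>x. of_real (w x)) k))\<^sup>2" for k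
    by (simp only: fourier_coeff_laplacian_funpow[OF L w] norm_mult norm_power norm_minus_cancel norm_of_real
        abs_of_nonneg[OF lap_symbol_nonneg] power_mult_distrib power_mult[symmetric] mult.commute[of _ "2::nat"])
  then show ?thesis
    using bessel[OF L continuous_on_of_real[OF c] F] by (simp add: L2_norm_torus_sq[OF c])
qed

text \<open>The term is split into \<open>1 / lap_symbol L k ^ s\<close> and
  \<open>lap_symbol L k ^ (s + 1) * norm (f k)\<close>. By Cauchy--Schwarz a convergent lattice sum
  and the decay of the coefficients bound all finite sums. The second claim follows because the
  symbol is at least \<open>(2 * pi / L)\<^sup>2\<close> at nonzero frequencies.\<close>

lemma lap_symbol_fourier_coeff_summable:
  fixes w :: "real^'n \<Rightarrow> real" and L :: real
  assumes L: "L > 0" and s: "CARD('n) + 2 \<le> 4 * s"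
    and w: "Ck (2 * (s + 1)) w" "periodic_torus L w"
  shows "(\<lambda>k. lap_symbol L k * norm (fourier_coeff L (\<lambda>x. of_real (w x)) k)) summable_on UNIV"
    and "(\<lambda>k. norm (fourier_coeff L (\<lambda>x. of_real (w x)) k)) summable_on UNIV"
proof -
  define f where "f = fourier_coeff L (\<lambda>x. of_real (w x))"
  obtain C where C: "C \<ge> 0" "\<And>F :: ('n \<Rightarrow> int) set. finite F \<Longrightarrow> (\<lambda>_. 0) \<notin> F \<Longrightarrow> (\<Sum>k\<in>F. 1 / lap_symbol L k ^ (2 * s)) \<le> C"
    using lap_symbol_sum_bounded[OF L s] by blast
  define A where "A = (L2_norm_torus L ((laplacian ^^ (s + 1)) w))\<^sup>2 / L ^ CARD('n)"
  define D where "D = sqrt (C * A)"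
  have bound: "(\<Sum>k\<in>F. lap_symbol L k * norm (f k)) \<le> D" if F: "finite F" "(\<lambda>_. 0) \<notin> F" for F
  proof -
    have pos: "lap_symbol L k > 0" if "k \<in> F" for k using F(2) that by (intro lap_symbol_pos[OF L]) auto
    have "(\<Sum>k\<in>F. lap_symbol L k * norm (f k)) = (\<Sum>k\<in>F. (1 / lap_symbol L k ^ s) * (lap_symbol L k ^ (s + 1) * norm (f k)))"
      by (intro sum.cong refl) (use pos in fastforce)
    then have "(\<Sum>k\<in>F. lap_symbol L k * norm (f k))\<^sup>2 \<le> (\<Sum>k\<in>F. (1 / lap_symbol L k ^ s)\<^sup>2) * (\<Sum>k\<in>F. (lap_symbol L k ^ (s + 1) * norm (f k))\<^sup>2)"
      by (simp only: Cauchy_Schwarz_ineq_sum)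
    also have "\<dots> = (\<Sum>k\<in>F. 1 / lap_symbol L k ^ (2 * s)) * (\<Sum>k\<in>F. lap_symbol L k ^ (2 * (s + 1)) * (norm (f k))\<^sup>2)"
      by (simp only: power_divide power_one power_mult_distrib power_mult[symmetric] mult.commute[of _ "2::nat"])
    also have "\<dots> \<le> C * A"
    proof (rule mult_mono)
      show "(\<Sum>k\<in>F. lap_symbol L k ^ (2 * (s + 1)) * (norm (f k))\<^sup>2) \<le> A"
        using fourier_coef_decay[OF L w F(1)] L by (simp add: A_def f_def field_simps)
    qed (auto intro!: C F sum_nonneg mult_nonneg_nonneg lap_symbol_nonneg simp del: mult_Suc_right)
    finally show ?thesis unfolding D_def by (rule real_le_rsqrt)
  qed
  have D0: "D \<ge> 0" using bound[of "{}"] by simp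
  show "(\<lambda>k. lap_symbol L k * norm (fourier_coeff L (\<lambda>x. of_real (w x)) k)) summable_on UNIV"
  proof (rule nonneg_bdd_above_summable_on, rule mult_nonneg_nonneg[OF lap_symbol_nonneg norm_ge_zero],
         rule bdd_aboveI2)
    fix F :: "('n \<Rightarrow> int) set" assume "F \<in> {F. F \<subseteq> UNIV \<and> finite F}"
    then have F: "finite F" by simp
    have "(\<Sum>k\<in>F. lap_symbol L k * norm (f k)) = (\<Sum>k\<in>F - {\<lambda>_. 0}. lap_symbol L k * norm (f k))"
      by (rule sum.mono_neutral_right[OF F]) (auto simp: lap_symbol_def)
    also have "\<dots> \<le> D" using F by (intro bound) auto
    finally show "(\<Sum>k\<in>F. lap_symbol L k * norm (fourier_coeff L (\<lambda>x. of_real (w x)) k)) \<le> D" by (simp add: f_def)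
  qed
  show "(\<lambda>k. norm (fourier_coeff L (\<lambda>x. of_real (w x)) k)) summable_on UNIV"
  proof (rule nonneg_bdd_above_summable_on, rule norm_ge_zero, rule bdd_aboveI2)
    fix F :: "('n \<Rightarrow> int) set" assume "F \<in> {F. F \<subseteq> UNIV \<and> finite F}"
    then have F: "finite F" by simp
    have "(\<Sum>k\<in>F. norm (f k)) \<le> (\<Sum>k\<in>insert (\<lambda>_. 0) (F - {\<lambda>_. 0}). norm (f k))"
      using F by (intro sum_mono2) auto
    also have "\<dots> = norm (f (\<lambda>_. 0)) + (\<Sum>k\<in>F - {\<lambda>_. 0}. norm (f k))"
      by (subst sum.insert) (use F in auto)
    also have "(\<Sum>k\<in>F - {\<lambda>_. 0}. norm (f k)) \<le> (\<Sum>k\<in>F - {\<lambda>_. 0}. (L / (2 * pi))\<^sup>2 * (lap_symbol L k * norm (f k)))"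
    proof (rule sum_mono)
      fix k assume k: "k \<in> F - {\<lambda>_. 0}"
      then have "1 \<le> real (supnorm k)" using supnorm_pos[of k] by auto
      then have "(2 * pi / L)\<^sup>2 * 1\<^sup>2 \<le> (2 * pi / L)\<^sup>2 * (real (supnorm k))\<^sup>2"
        by (intro mult_left_mono power_mono) auto
      then have "(2 * pi / L)\<^sup>2 \<le> lap_symbol L k" using lap_symbol_ge_supnorm[of L k] by simp
      then have "(L / (2 * pi))\<^sup>2 * (2 * pi / L)\<^sup>2 \<le> (L / (2 * pi))\<^sup>2 * lap_symbol L k" by (intro mult_left_mono) auto
      then have "1 \<le> (L / (2 * pi))\<^sup>2 * lap_symbol L k" using L by (simp flip: power_mult_distrib)
      then have "1 * norm (f k) \<le> ((L / (2 * pi))\<^sup>2 * lap_symbol L k) * norm (f k)" by (intro mult_right_mono) auto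
      then show "norm (f k) \<le> (L / (2 * pi))\<^sup>2 * (lap_symbol L k * norm (f k))" by (simp only: mult_1 mult.assoc)
    qed
    also have "\<dots> \<le> (L / (2 * pi))\<^sup>2 * D"
      unfolding sum_distrib_left[symmetric] using F by (intro mult_left_mono bound) auto
    finally show "(\<Sum>k\<in>F. norm (fourier_coeff L (\<lambda>x. of_real (w x)) k)) \<le> norm (f (\<lambda>_. 0)) + (L / (2 * pi))\<^sup>2 * D"
      by (simp add: f_def)
  qed
qed

text \<open>The expansions are stated as limits over finite frequency sets, because grid operators
  and grid norms are evaluated on finite sums and carried to the limit afterwards.\<close>

lemma grid_fourier:
  fixes w :: "real^'n \<Rightarrow> real" and L :: real
  assumes L: "L > 0" and s: "CARD('n) + 2 \<le> 4 * s"
    and w: "Ck (2 * (s + 1)) w" "periodic_torus L w" and j: "j \<in> grid_idx N"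
  shows "((\<lambda>F. \<Sum>k\<in>F. fourier_coeff L (\<lambda>x. of_real (w x)) k * grid_char N k j) \<longlongrightarrow> of_real (w (grid_pt L N j)))
           (finite_subsets_at_top UNIV)"
    and "((\<lambda>F. \<Sum>k\<in>F. of_real (- lap_symbol L k) * fourier_coeff L (\<lambda>x. of_real (w x)) k * grid_char N k j)
           \<longlongrightarrow> of_real (laplacian w (grid_pt L N j))) (finite_subsets_at_top UNIV)"
proof -
  have w2: "Ck 2 w" by (rule Ck_mono[OF _ w(1)]) simp
  have "Ck 0 (laplacian w)" by (rule Ck_laplacian) (use w2 in \<open>simp only: add_0\<close>)
  then have c: "continuous_on UNIV w" "continuous_on UNIV (laplacian w)"
    using Ck_continuous[OF w(1)] by auto
  have e: "torus_char L k (grid_pt L N j) = grid_char N k j" for k using L by (simp add: torus_char_grid_pt)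
  have g: "grid_pt L N j \<in> torus_cube L" using L j by (intro grid_pt_in_cube) auto
  have "((\<lambda>k. fourier_coeff L (\<lambda>x. of_real (w x)) k * torus_char L k (grid_pt L N j)) has_sum of_real (w (grid_pt L N j))) UNIV"
    using w(2) by (intro fourier_inversion[OF L _ _ lap_symbol_fourier_coeff_summable(2)[OF L s w] g] continuous_intros c)
       (simp add: periodic_torus_def)
  then show "((\<lambda>F. \<Sum>k\<in>F. fourier_coeff L (\<lambda>x. of_real (w x)) k * grid_char N k j) \<longlongrightarrow> of_real (w (grid_pt L N j)))
           (finite_subsets_at_top UNIV)" by (simp only: has_sum_def e)
  have "((\<lambda>k. fourier_coeff L (\<lambda>x. of_real (laplacian w x)) k * torus_char L k (grid_pt L N j))
        has_sum of_real (laplacian w (grid_pt L N j))) UNIV"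
  proof (intro fourier_inversion[OF L _ _ _ g] continuous_intros c)
    show "periodic_torus L (\<lambda>x. complex_of_real (laplacian w x))"
      using periodic_torus_laplacian[OF w(2)] by (simp add: periodic_torus_def)
    show "(\<lambda>k. norm (fourier_coeff L (\<lambda>x. of_real (laplacian w x)) k)) summable_on UNIV"
      using lap_symbol_fourier_coeff_summable(1)[OF L s w]
      by (simp add: fourier_coeff_laplacian[OF L w2 w(2)] norm_mult lap_symbol_nonneg)
  qed
  then show "((\<lambda>F. \<Sum>k\<in>F. of_real (- lap_symbol L k) * fourier_coeff L (\<lambda>x. of_real (w x)) k * grid_char N k j)
           \<longlongrightarrow> of_real (laplacian w (grid_pt L N j))) (finite_subsets_at_top UNIV)"
    by (simp add: has_sum_def e fourier_coeff_laplacian[OF L w2 w(2)])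
qed

text \<open>Characters diagonalise both operators, so the error has an expansion with coefficients
  \<open>c k\<close>. These vanish at resolved frequencies and are at most
  \<open>lap_symbol L k * norm (f k) / 2\<close> elsewhere; this half and the half in
  \<open>alias_bound\<close> make up the quarter.\<close>

lemma laplacian_grid_error:
  fixes w :: "real^'n \<Rightarrow> real" and L :: real
  assumes N: "even N" "N > 0" and L: "L > 0" and s: "CARD('n) + 7 \<le> 4 * s"
    and w: "Ck (2 * (s + 1)) w" "periodic_torus L w"
  shows "vnorm N (\<lambda>j. Kop L N (\<lambda>j. of_real (w (grid_pt L N j))) j + of_real (laplacian w (grid_pt L N j)) / 2)
     \<le> sqrt ((real N / L) ^ CARD('n)) * ((L * CARD('n) / N) ^ (2 * s) * L2_norm_torus L ((laplacian ^^ (s + 1)) w) / 4)"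
proof -
  define f where "f = fourier_coeff L (\<lambda>x. of_real (w x))"
  define A where "A = L2_norm_torus L ((laplacian ^^ (s + 1)) w)"
  define c where "c k = of_real ((lap_symbol L (alias_rep N k) - lap_symbol L k) / 2) * f k" for k
  have s2: "CARD('n) + 2 \<le> 4 * s" using s by simp
  have "Ck 0 ((laplacian ^^ (s + 1)) w)" by (rule Ck_laplacian_funpow) (use w in simp)
  then have A0: "A \<ge> 0" unfolding A_def by (intro L2_norm_torus_nonneg) simp
  note g = grid_fourier[OF L s2 w, folded f_def, of _ N]
  have lim: "((\<lambda>F. \<Sum>k\<in>F. c k * grid_char N k j) \<longlongrightarrow>
      Kop L N (\<lambda>j. of_real (w (grid_pt L N j))) j + of_real (laplacian w (grid_pt L N j)) / 2)
      (finite_subsets_at_top UNIV)" if j: "j \<in> grid_idx N" for j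
  proof -
    have "((\<lambda>F. Kop L N (\<lambda>j. \<Sum>k\<in>F. f k * grid_char N k j) j
         + (\<Sum>k\<in>F. of_real (- lap_symbol L k) * f k * grid_char N k j) / 2)
      \<longlongrightarrow> Kop L N (\<lambda>j. of_real (w (grid_pt L N j))) j + of_real (laplacian w (grid_pt L N j)) / 2)
      (finite_subsets_at_top UNIV)"
      unfolding Kop_def
    proof (rule tendsto_add)
      show "((\<lambda>F. 1 / 2 * (\<Sum>i\<in>UNIV. \<Sum>b<N. M1 L N (j i) b * (\<Sum>k\<in>F. f k * grid_char N k (j(i := b)))))
        \<longlongrightarrow> 1 / 2 * (\<Sum>i\<in>UNIV. \<Sum>b<N. M1 L N (j i) b * of_real (w (grid_pt L N (j(i := b))))))
        (finite_subsets_at_top UNIV)"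
        by (intro tendsto_mult_left tendsto_sum g(1) grid_idx_fun_upd j) simp
      show "((\<lambda>F. (\<Sum>k\<in>F. of_real (- lap_symbol L k) * f k * grid_char N k j) / 2)
        \<longlongrightarrow> of_real (laplacian w (grid_pt L N j)) / 2) (finite_subsets_at_top UNIV)"
        by (intro tendsto_divide g(2) j tendsto_const) simp
    qed
    moreover have eq: "Kop L N (\<lambda>j. \<Sum>k\<in>F. f k * grid_char N k j) j
         + (\<Sum>k\<in>F. of_real (- lap_symbol L k) * f k * grid_char N k j) / 2 = (\<Sum>k\<in>F. c k * grid_char N k j)" for F
      unfolding Kop_sum Kop_cmult Kop_grid_char[OF N] sum_divide_distrib sum.distrib[symmetric]
      by (intro sum.cong refl) (simp add: c_def field_simps)
    ultimately show ?thesis by (simp only: eq)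
  qed
  show ?thesis
  proof (rule tendsto_upperbound[OF vnorm_tendsto[OF lim]])
    have "vnorm N (\<lambda>j. \<Sum>k\<in>F. c k * grid_char N k j)
       \<le> sqrt ((real N / L) ^ CARD('n)) * ((L * CARD('n) / N) ^ (2 * s) * A / 4)" if F: "finite F" for F
    proof -
      let ?G = "{k \<in> F. alias_rep N k \<noteq> k}"
      have "(\<lambda>j. \<Sum>k\<in>F. c k * grid_char N k j) = (\<lambda>j. \<Sum>k\<in>?G. c k * grid_char N k j)"
        by (rule ext, rule sum.mono_neutral_right[OF F]) (auto simp: c_def)
      then have "vnorm N (\<lambda>j. \<Sum>k\<in>F. c k * grid_char N k j) = vnorm N (\<lambda>j. \<Sum>k\<in>?G. c k * grid_char N k j)"
        by (rule arg_cong)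
      also have "\<dots> \<le> sqrt ((real N / L) ^ CARD('n)) * ((L * CARD('n) / N) ^ (2 * s) * (A / 2) / 2)"
      proof (rule alias_bound[OF N L s])
        have "(\<Sum>k\<in>?G. lap_symbol L k ^ (2 * s) * (norm (c k))\<^sup>2)
            \<le> (\<Sum>k\<in>?G. lap_symbol L k ^ (2 * (s + 1)) * (norm (f k))\<^sup>2 / 4)"
        proof (rule sum_mono)
          fix k :: "'n \<Rightarrow> int"
          have "\<bar>lap_symbol L (alias_rep N k) - lap_symbol L k\<bar> \<le> lap_symbol L k"
            using lap_symbol_alias_rep_le[OF N, of L k] lap_symbol_nonneg[of L "alias_rep N k"] by auto
          then have "norm (c k) \<le> lap_symbol L k * norm (f k) / 2"
            unfolding c_def norm_mult norm_of_real by (simp add: abs_divide mult_right_mono)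
          then have "(norm (c k))\<^sup>2 \<le> (lap_symbol L k * norm (f k) / 2)\<^sup>2" by (intro power_mono) auto
          then have "lap_symbol L k ^ (2 * s) * (norm (c k))\<^sup>2 \<le> lap_symbol L k ^ (2 * s) * (lap_symbol L k * norm (f k) / 2)\<^sup>2"
            by (intro mult_left_mono) (auto simp: lap_symbol_nonneg)
          also have "\<dots> = lap_symbol L k ^ (2 * (s + 1)) * (norm (f k))\<^sup>2 / 4"
            by (simp add: power_divide power_mult_distrib power2_eq_square)
          finally show "lap_symbol L k ^ (2 * s) * (norm (c k))\<^sup>2 \<le> lap_symbol L k ^ (2 * (s + 1)) * (norm (f k))\<^sup>2 / 4" .
        qed
        then have "L ^ CARD('n) * (\<Sum>k\<in>?G. lap_symbol L k ^ (2 * s) * (norm (c k))\<^sup>2)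
           \<le> L ^ CARD('n) * (\<Sum>k\<in>?G. lap_symbol L k ^ (2 * (s + 1)) * (norm (f k))\<^sup>2 / 4)"
          using L by (intro mult_left_mono) auto
        also have "\<dots> = L ^ CARD('n) * (\<Sum>k\<in>?G. lap_symbol L k ^ (2 * (s + 1)) * (norm (f k))\<^sup>2) / 4"
          by (simp only: sum_divide_distrib[symmetric] times_divide_eq_right)
        also have "\<dots> \<le> A\<^sup>2 / 4"
          unfolding A_def f_def by (intro divide_right_mono fourier_coef_decay L w) (use F in auto)
        finally show "L ^ CARD('n) * (\<Sum>k\<in>?G. lap_symbol L k ^ (2 * s) * (norm (c k))\<^sup>2) \<le> (A / 2)\<^sup>2"
          by (simp add: power_divide)
      qed (use F A0 in auto)
      finally show ?thesis by simp
    qed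
    then show "\<forall>\<^sub>F F in finite_subsets_at_top UNIV. vnorm N (\<lambda>j. \<Sum>k\<in>F. c k * grid_char N k j)
      \<le> sqrt ((real N / L) ^ CARD('n)) * ((L * CARD('n) / N) ^ (2 * s) * L2_norm_torus L ((laplacian ^^ (s + 1)) w) / 4)"
      unfolding A_def by (intro eventually_finite_subsets_at_top_weakI) auto
  qed (assumption, rule finite_subsets_at_top_neq_bot)
qed

text \<open>The partial sums converge uniformly on the cube, so the remainder in
  \<open>fourier_projection\<close> eventually drops to at most \<open>e\<close>.\<close>

lemma fourier_parseval_lower:
  fixes w :: "real^'n \<Rightarrow> real" and L :: real
  assumes L: "L > 0" and s: "CARD('n) + 2 \<le> 4 * s"
    and w: "Ck (2 * (s + 1)) w" "periodic_torus L w" and e: "e > 0"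
  shows "\<forall>\<^sub>F F in finite_subsets_at_top UNIV.
     integral (torus_cube L) (\<lambda>x. (w x)\<^sup>2) - e
       \<le> L ^ CARD('n) * (\<Sum>k\<in>F. (norm (fourier_coeff L (\<lambda>x. of_real (w x)) k))\<^sup>2)"
proof -
  let ?f = "\<lambda>x. complex_of_real (w x)"
  \<comment> \<open>Chosen so that a uniform error \<open>r\<close> costs at most \<open>e\<close>
    in the integral over a cube of volume \<open>L ^ CARD('n)\<close>.\<close>
  define r where "r = sqrt (e / L ^ CARD('n))"
  have r: "r > 0" "L ^ CARD('n) * r\<^sup>2 = e" using e L by (auto simp: r_def)
  have f: "continuous_on UNIV ?f" by (intro continuous_intros Ck_continuous[OF w(1)])
  have "uniform_limit (torus_cube L) (\<lambda>F x. \<Sum>k\<in>F. fourier_coeff L ?f k * torus_char L k x) ?f (finite_subsets_at_top UNIV)"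
  proof (rule Weierstrass_m_test_general'[where M = "\<lambda>k. norm (fourier_coeff L ?f k)"])
    show "((\<lambda>k. fourier_coeff L ?f k * torus_char L k x) has_sum ?f x) UNIV" if "x \<in> torus_cube L" for x
      using w(2) by (intro fourier_inversion[OF L f _ lap_symbol_fourier_coeff_summable(2)[OF L s w] that])
        (simp add: periodic_torus_def)
  qed (use lap_symbol_fourier_coeff_summable(2)[OF L s w] in \<open>auto simp: norm_mult\<close>)
  then have ev: "\<forall>\<^sub>F F in finite_subsets_at_top UNIV. \<forall>x\<in>torus_cube L. dist (\<Sum>k\<in>F. fourier_coeff L ?f k * torus_char L k x) (?f x) < r"
    using r(1) by (simp add: uniform_limit_iff)
  have fin: "\<forall>\<^sub>F F in finite_subsets_at_top (UNIV :: ('n \<Rightarrow> int) set). finite F"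
    by (rule eventually_finite_subsets_at_top_weakI) auto
  show ?thesis
    using ev fin
  proof eventually_elim
    case (elim F)
    define h where "h x = ?f x - (\<Sum>k\<in>F. fourier_coeff L ?f k * torus_char L k x)" for x
    have h: "continuous_on UNIV h" unfolding h_def by (intro continuous_intros f)
    have "integral (torus_cube L) (\<lambda>x. (norm (h x))\<^sup>2) \<le> L ^ CARD('n) * r\<^sup>2"
    proof -
      have "Re (fourier_coeff L (\<lambda>x. h x * cnj (h x)) (\<lambda>_. 0)) \<le> norm (fourier_coeff L (\<lambda>x. h x * cnj (h x)) (\<lambda>_. 0))"
        by (rule complex_Re_le_cmod)
      also have "\<dots> \<le> r\<^sup>2"
      proof (rule norm_fourier_coeff_le[OF L])
        fix x :: "real^'n" assume "x \<in> torus_cube L"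
        then have "norm (h x) \<le> r" using elim(1) by (simp add: h_def dist_norm norm_minus_commute less_imp_le)
        then show "norm (h x * cnj (h x)) \<le> r\<^sup>2" by (auto simp: norm_mult power2_eq_square intro!: mult_mono less_imp_le[OF r(1)])
      qed (intro continuous_intros h)
      finally show ?thesis unfolding integral_norm_sq[OF L h] using L by (intro mult_left_mono) auto
    qed
    then show ?case
      using fourier_projection[OF L f elim(2)] r(2) by (simp add: h_def)
  qed
qed

text \<open>A partial sum is split into resolved frequencies \<open>?P\<close> and unresolved ones
  \<open>?R\<close>. The former have grid norm at least 2/3 of the scale \<open>K\<close>, the
  latter at most \<open>K * (e * A / 2)\<close>, which is at most \<open>K / 6\<close>, and 2/3 -
  1/6 = 1/2.\<close>

lemma grid_norm_lower:
  fixes w :: "real^'n \<Rightarrow> real" and L :: real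
  assumes N: "even N" "N > 0" and L: "L > 0" and s: "CARD('n) + 7 \<le> 4 * s"
    and w: "Ck (2 * (s + 1)) w" "periodic_torus L w"
    and unit: "integral (torus_cube L) (\<lambda>x. (w x)\<^sup>2) = 1"
    and small: "3 * L2_norm_torus L ((laplacian ^^ (s + 1)) w) * (L * CARD('n) / N) ^ (2 * s) \<le> 1"
    and fine: "L * CARD('n) / N \<le> 1"
  shows "sqrt ((real N / L) ^ CARD('n)) / 2 \<le> vnorm N (\<lambda>j. of_real (w (grid_pt L N j)))"
proof -
  define f where "f = fourier_coeff L (\<lambda>x. of_real (w x))"
  define A where "A = L2_norm_torus L ((laplacian ^^ (s + 1)) w)"
  define e where "e = (L * CARD('n) / N) ^ (2 * s)"
  define K where "K = sqrt ((real N / L) ^ CARD('n))"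
  have K: "K \<ge> 0" "K\<^sup>2 = (real N / L) ^ CARD('n)" using L by (auto simp: K_def)
  have e: "e > 0" using L N by (simp add: e_def)
  have s2: "CARD('n) + 2 \<le> 4 * s" using s by simp
  have "Ck 0 ((laplacian ^^ (s + 1)) w)" by (rule Ck_laplacian_funpow) (use w in simp)
  then have A0: "A \<ge> 0" unfolding A_def by (intro L2_norm_torus_nonneg) simp
  have Ae: "A * e \<le> 1 / 3" using small by (simp add: A_def e_def)
  have d1: "1 \<le> real CARD('n)" by (simp add: Suc_le_eq)
  \<comment> \<open>A nonzero quotient makes the symbol at least \<open>b\<^sup>2\<close>, and
    \<open>e\<close> is \<open>1 / b ^ (2 * s)\<close>; \<open>fine\<close> says
    \<open>b \<ge> 1\<close>, which permits raising the exponent from \<open>2 * s\<close> to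
    \<open>2 * (s + 1)\<close>.\<close>
  have hi: "1 \<le> lap_symbol L k" "1 / e\<^sup>2 \<le> lap_symbol L k ^ (2 * (s + 1))" if k: "alias_rep N k \<noteq> k" for k :: "'n \<Rightarrow> int"
  proof -
    define b where "b = real N / (L * CARD('n))"
    have b: "b \<ge> 1" using fine L N by (simp add: b_def field_simps)
    have "alias_quot N k \<noteq> (\<lambda>_. 0)" using k alias_quot_eq_0 by blast
    then have q: "1 \<le> real (supnorm (alias_quot N k))" using supnorm_pos by auto
    have "b \<le> pi * real N / L"
    proof -
      have "1 / real CARD('n) \<le> 1" using d1 by (simp add: divide_le_eq)
      then have "1 / real CARD('n) \<le> pi" using pi_gt3 by linarith
      then have "1 / real CARD('n) * (real N / L) \<le> pi * (real N / L)" using L by (intro mult_right_mono) auto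
      then show ?thesis by (simp add: b_def mult.commute)
    qed
    also have "\<dots> = pi * real N / L * 1" by simp
    also have "\<dots> \<le> pi * real N / L * real (supnorm (alias_quot N k))" using q L by (intro mult_left_mono) auto
    finally have "b\<^sup>2 \<le> (pi * real N / L * real (supnorm (alias_quot N k)))\<^sup>2" using b by (intro power_mono) auto
    also have "\<dots> \<le> lap_symbol L k" by (rule lap_symbol_ge_alias_quot[OF N L])
    finally have bl: "b\<^sup>2 \<le> lap_symbol L k" .
    have "1 \<le> b\<^sup>2" using b by simp
    then show l1: "1 \<le> lap_symbol L k" using bl by simp
    have "1 / e\<^sup>2 = (b\<^sup>2) ^ (2 * s)"
      using L by (simp add: e_def b_def power_divide flip: power_mult)
    also have "\<dots> \<le> lap_symbol L k ^ (2 * s)" using bl by (intro power_mono) auto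
    also have "\<dots> \<le> lap_symbol L k ^ (2 * (s + 1))" using l1 by (intro power_increasing) auto
    finally show "1 / e\<^sup>2 \<le> lap_symbol L k ^ (2 * (s + 1))" .
  qed
  note g = grid_fourier(1)[OF L s2 w, folded f_def, of _ N]
  have "K / 2 \<le> vnorm N (\<lambda>j. of_real (w (grid_pt L N j)))"
  proof (rule tendsto_lowerbound[OF vnorm_tendsto[OF g]])
    have fin: "\<forall>\<^sub>F F in finite_subsets_at_top (UNIV :: ('n \<Rightarrow> int) set). finite F"
      by (rule eventually_finite_subsets_at_top_weakI) auto
    \<comment> \<open>The loss of 1/9 here and the tail of 1/9 below leave 7/9 of the mass on the
      resolved frequencies, above the required 4/9, the square of 2/3.\<close>
    have ev: "\<forall>\<^sub>F F in finite_subsets_at_top UNIV. 1 - 1 / 9 \<le> L ^ CARD('n) * (\<Sum>k\<in>F. (norm (f k))\<^sup>2)"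
      using fourier_parseval_lower[OF L s2 w, of "1 / 9"] unfolding unit f_def by simp
    show "\<forall>\<^sub>F F in finite_subsets_at_top UNIV. K / 2 \<le> vnorm N (\<lambda>j. \<Sum>k\<in>F. f k * grid_char N k j)"
      using ev fin
    proof eventually_elim
      case (elim F)
      let ?P = "{k \<in> F. alias_rep N k = k}" and ?R = "{k \<in> F. alias_rep N k \<noteq> k}"
      have split: "(\<Sum>k\<in>F. h k) = (\<Sum>k\<in>?P. h k) + (\<Sum>k\<in>?R. h k)" for h :: "_ \<Rightarrow> 'b::comm_monoid_add"
        by (subst sum.union_disjoint[symmetric]) (use elim(2) in \<open>auto intro!: sum.cong\<close>)
      have decay: "L ^ CARD('n) * (\<Sum>k\<in>?R. lap_symbol L k ^ (2 * (s + 1)) * (norm (f k))\<^sup>2) \<le> A\<^sup>2"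
        unfolding A_def f_def by (intro fourier_coef_decay L w) (use elim(2) in auto)
      have R: "vnorm N (\<lambda>j. \<Sum>k\<in>?R. f k * grid_char N k j) \<le> K * (e * A / 2)"
        unfolding K_def e_def
      proof (rule alias_bound[OF N L s])
        have "L ^ CARD('n) * (\<Sum>k\<in>?R. lap_symbol L k ^ (2 * s) * (norm (f k))\<^sup>2)
           \<le> L ^ CARD('n) * (\<Sum>k\<in>?R. lap_symbol L k ^ (2 * (s + 1)) * (norm (f k))\<^sup>2)"
          using L by (intro mult_left_mono sum_mono mult_right_mono power_increasing) (auto simp: hi(1))
        then show "L ^ CARD('n) * (\<Sum>k\<in>?R. lap_symbol L k ^ (2 * s) * (norm (f k))\<^sup>2) \<le> A\<^sup>2"
          using decay by linarith
      qed (use elim(2) A0 in auto)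
      have tail: "L ^ CARD('n) * (\<Sum>k\<in>?R. (norm (f k))\<^sup>2) \<le> 1 / 9"
      proof -
        have "(\<Sum>k\<in>?R. (norm (f k))\<^sup>2) \<le> (\<Sum>k\<in>?R. e\<^sup>2 * (lap_symbol L k ^ (2 * (s + 1)) * (norm (f k))\<^sup>2))"
        proof (rule sum_mono)
          fix k assume "k \<in> ?R"
          then have "1 / e\<^sup>2 \<le> lap_symbol L k ^ (2 * (s + 1))" using hi(2) by blast
          then have "1 \<le> e\<^sup>2 * lap_symbol L k ^ (2 * (s + 1))" using e by (simp add: divide_le_eq mult.commute)
          then have "1 * (norm (f k))\<^sup>2 \<le> e\<^sup>2 * lap_symbol L k ^ (2 * (s + 1)) * (norm (f k))\<^sup>2"
            by (intro mult_right_mono) auto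
          then show "(norm (f k))\<^sup>2 \<le> e\<^sup>2 * (lap_symbol L k ^ (2 * (s + 1)) * (norm (f k))\<^sup>2)" by (simp only: mult_1 mult.assoc)
        qed
        then have "L ^ CARD('n) * (\<Sum>k\<in>?R. (norm (f k))\<^sup>2)
           \<le> L ^ CARD('n) * (e\<^sup>2 * (\<Sum>k\<in>?R. lap_symbol L k ^ (2 * (s + 1)) * (norm (f k))\<^sup>2))"
          unfolding sum_distrib_left[symmetric] using L by (intro mult_left_mono) auto
        also have "\<dots> = e\<^sup>2 * (L ^ CARD('n) * (\<Sum>k\<in>?R. lap_symbol L k ^ (2 * (s + 1)) * (norm (f k))\<^sup>2))" by simp
        also have "\<dots> \<le> e\<^sup>2 * A\<^sup>2" using decay by (intro mult_left_mono) auto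
        also have "\<dots> = (A * e)\<^sup>2" by (simp add: power_mult_distrib)
        also have "\<dots> \<le> (1 / 3)\<^sup>2" using Ae A0 e by (intro power_mono) auto
        finally show ?thesis by (simp add: power_divide)
      qed
      have "(vnorm N (\<lambda>j. \<Sum>k\<in>?P. f k * grid_char N k j))\<^sup>2 = real N ^ CARD('n) * (\<Sum>k\<in>?P. (norm (f k))\<^sup>2)"
      proof -
        \<comment> \<open>On resolved frequencies each residue class is a singleton, so nothing can
          cancel and the grid norm is exact.\<close>
        have "alias_rep N ` ?P = ?P" by force
        moreover have "{k \<in> ?P. alias_rep N k = m} = {m}" if "m \<in> ?P" for m using that by auto
        ultimately show ?thesis
          unfolding vnorm_sq using elim(2) by (subst discrete_parseval[OF N(2)]) auto
      qed
      also have "\<dots> = K\<^sup>2 * (L ^ CARD('n) * (\<Sum>k\<in>?P. (norm (f k))\<^sup>2))"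
        using L by (simp add: K power_divide)
      also have "\<dots> \<ge> K\<^sup>2 * (2 / 3)\<^sup>2"
      proof (rule mult_left_mono)
        have "L ^ CARD('n) * (\<Sum>k\<in>F. (norm (f k))\<^sup>2)
           = L ^ CARD('n) * (\<Sum>k\<in>?P. (norm (f k))\<^sup>2) + L ^ CARD('n) * (\<Sum>k\<in>?R. (norm (f k))\<^sup>2)"
          by (simp only: split distrib_left)
        then show "(2 / 3)\<^sup>2 \<le> L ^ CARD('n) * (\<Sum>k\<in>?P. (norm (f k))\<^sup>2)"
          using elim(1) tail by (simp add: power_divide)
      qed simp
      finally have "(K * (2 / 3))\<^sup>2 \<le> (vnorm N (\<lambda>j. \<Sum>k\<in>?P. f k * grid_char N k j))\<^sup>2"
        by (simp only: power_mult_distrib)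
      then have P: "K * (2 / 3) \<le> vnorm N (\<lambda>j. \<Sum>k\<in>?P. f k * grid_char N k j)"
        by (rule power2_le_imp_le) simp
      have "K * (e * A / 2) \<le> K * (1 / 6)" using Ae K(1) by (intro mult_left_mono) (auto simp: mult.commute)
      then have "K / 2 \<le> vnorm N (\<lambda>j. \<Sum>k\<in>?P. f k * grid_char N k j) - vnorm N (\<lambda>j. \<Sum>k\<in>?R. f k * grid_char N k j)"
        using P R by linarith
      also have "\<dots> \<le> vnorm N (\<lambda>j. \<Sum>k\<in>F. f k * grid_char N k j)"
        unfolding split by (rule vnorm_diff_ge)
      finally show ?case .
    qed
  qed (assumption, rule finite_subsets_at_top_neq_bot)
  then show ?thesis by (simp add: K_def)
qed

section \<open>Time evolution\<close>

text \<open>Where \<open>h\<close> vanishes, \<open>sqrt h\<close> need not be differentiable, so the bound is proved for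
  \<open>sqrt (h + e\<^sup>2)\<close> and \<open>e\<close> is sent to 0.\<close>

lemma sqrt_growth:
  fixes h h' :: "real \<Rightarrow> real"
  assumes S: "convex S" "x \<in> S" "y \<in> S"
    and h: "\<And>z. z \<in> S \<Longrightarrow> (h has_real_derivative h' z) (at z within S)"
    and h0: "\<And>z. z \<in> S \<Longrightarrow> 0 \<le> h z"
    and B: "\<And>z. z \<in> S \<Longrightarrow> \<bar>h' z\<bar> \<le> 2 * B * sqrt (h z)" and B0: "B \<ge> 0"
  shows "sqrt (h y) \<le> sqrt (h x) + B * \<bar>y - x\<bar>"
proof (rule field_le_epsilon)
  fix e :: real assume e: "e > 0"
  define m where "m z = sqrt (h z + e\<^sup>2)" for z
  have pos: "h z + e\<^sup>2 > 0" if "z \<in> S" for z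
    using h0[OF that] e by (simp add: add_nonneg_pos)
  have d: "(m has_real_derivative inverse (sqrt (h z + e\<^sup>2)) / 2 * h' z) (at z within S)" if z: "z \<in> S" for z
    unfolding m_def
  proof (rule DERIV_chain'[where f = "\<lambda>z. h z + e\<^sup>2" and g = sqrt])
    show "((\<lambda>z. h z + e\<^sup>2) has_real_derivative h' z) (at z within S)"
      using DERIV_add[OF h[OF z] DERIV_const[of "e\<^sup>2"]] by simp
  qed (rule DERIV_real_sqrt[OF pos[OF z]])
  have b: "norm (inverse (sqrt (h z + e\<^sup>2)) / 2 * h' z) \<le> B" if z: "z \<in> S" for z
  proof -
    have "\<bar>h' z\<bar> \<le> 2 * B * sqrt (h z + e\<^sup>2)"
      by (rule order_trans[OF B[OF z]]) (use B0 in \<open>intro mult_left_mono real_sqrt_le_mono, auto\<close>)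
    then show ?thesis using pos[OF z] by (simp add: abs_mult field_simps)
  qed
  have "norm (m y - m x) \<le> B * norm (y - x)"
    by (rule field_differentiable_bound[OF S(1) d b]) (use S in auto)
  then have "m y \<le> m x + B * \<bar>y - x\<bar>" by simp
  moreover have "sqrt (h y) \<le> m y" unfolding m_def by simp
  moreover have "m x \<le> sqrt (h x) + e"
    using sqrt_add_le_add_sqrt[of "h x" "e\<^sup>2"] h0[OF S(2)] e by (simp add: m_def)
  ultimately show "sqrt (h y) \<le> sqrt (h x) + B * \<bar>y - x\<bar> + e" by linarith
qed

text \<open>The continuity equation only controls the square \<open>p\<close> of \<open>sqrt p\<close>. At a zero of \<open>sqrt p\<close> the
  velocity \<open>g\<close> vanishes as well, which makes the square root differentiable there.\<close>

lemma has_real_derivative_of_square: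
  fixes f g :: "real \<Rightarrow> real"
  assumes f0: "\<And>t. t \<in> {a..b} \<Longrightarrow> 0 \<le> f t"
    and sq: "\<And>t. t \<in> {a..b} \<Longrightarrow> ((\<lambda>\<tau>. (f \<tau>)\<^sup>2) has_real_derivative 2 * f t * g t) (at t within {a..b})"
    and g: "continuous_on {a..b} g" and zero: "\<And>t. t \<in> {a..b} \<Longrightarrow> f t = 0 \<Longrightarrow> g t = 0"
    and t: "t \<in> {a..b}"
  shows "(f has_real_derivative g t) (at t within {a..b})"
proof (cases "f t = 0")
  case False
  then have pos: "f t > 0" using f0[OF t] by simp
  have "((\<lambda>\<tau>. sqrt ((f \<tau>)\<^sup>2)) has_real_derivative inverse (sqrt ((f t)\<^sup>2)) / 2 * (2 * f t * g t)) (at t within {a..b})"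
    by (rule DERIV_chain'[OF sq[OF t]]) (use pos in \<open>intro DERIV_real_sqrt, simp\<close>)
  moreover have eq: "inverse (sqrt ((f t)\<^sup>2)) / 2 * (2 * f t * g t) = g t" using pos by simp
  ultimately have "((\<lambda>\<tau>. sqrt ((f \<tau>)\<^sup>2)) has_real_derivative g t) (at t within {a..b})" by (simp only: eq)
  then show ?thesis
    by (rule has_field_derivative_transform_within[where d = 1]) (use t f0 in auto)
next
  case True
  have "(f has_derivative (\<lambda>h. 0)) (at t within {a..b})"
    unfolding has_derivative_within_alt
  proof (intro conjI allI impI)
    fix e :: real assume e: "e > 0"
    obtain d where d: "d > 0" "\<And>y. y \<in> {a..b} \<Longrightarrow> dist y t < d \<Longrightarrow> dist (g y) (g t) < e"
      using g t e unfolding continuous_on_iff by blast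
    have "norm (f y - f t - 0) \<le> e * norm (y - t)" if y: "y \<in> {a..b}" "norm (y - t) < d" for y
    proof -
      \<comment> \<open>Near \<open>t\<close> the velocity is at most \<open>e\<close> in modulus,
        so \<open>sqrt_growth\<close> bounds \<open>f y\<close> by
        \<open>e * \<bar>y - t\<bar>\<close>; with \<open>f\<close> nonnegative this says that the
        derivative at \<open>t\<close> is 0.\<close>
      let ?S = "{a..b} \<inter> ball t d"
      have "sqrt ((f y)\<^sup>2) \<le> sqrt ((f t)\<^sup>2) + e * \<bar>y - t\<bar>"
      proof (rule sqrt_growth[where S = ?S and h = "\<lambda>z. (f z)\<^sup>2"])
        show "convex ?S" by (intro convex_Int) auto
        show "t \<in> ?S" "y \<in> ?S" using t y d by (auto simp: dist_norm norm_minus_commute)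
        fix z assume z: "z \<in> ?S"
        then show "((\<lambda>z. (f z)\<^sup>2) has_real_derivative 2 * f z * g z) (at z within ?S)"
          using has_field_derivative_subset[OF sq] by (metis IntD1 Int_lower1)
        have "\<bar>g z\<bar> \<le> e" using d(2)[of z] z zero[OF t True] by (auto simp: dist_commute)
        then have "f z * \<bar>g z\<bar> \<le> f z * e" using f0[of z] z by (intro mult_left_mono) auto
        then show "\<bar>2 * f z * g z\<bar> \<le> 2 * e * sqrt ((f z)\<^sup>2)"
          using f0[of z] z by (simp add: abs_mult mult.commute)
      qed (use e in auto)
      then show ?thesis using True f0[OF y(1)] by simp
    qed
    then show "\<exists>d>0. \<forall>y\<in>{a..b}. norm (y - t) < d \<longrightarrow> norm (f y - f t - 0) \<le> e * norm (y - t)"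
      using d(1) by blast
  qed simp
  moreover have "(\<lambda>h::real. 0) = (*) (g t)" using zero[OF t True] by auto
  ultimately show ?thesis unfolding has_field_derivative_def by simp
qed

section \<open>The commutator form of transport and its residual on the grid\<close>

lemma partial_deriv_at_zero:
  fixes u :: "real^'n \<Rightarrow> real"
  assumes u: "Ck (Suc 0) u" "\<And>y. 0 \<le> u y" and x: "u x = 0"
  shows "partial_deriv i u x = 0"
proof -
  have "((\<lambda>h. u (x + h *\<^sub>R axis i 1)) has_real_derivative partial_deriv i u x) (at 0)"
    using has_partial_deriv_0[OF u(1)] by (simp add: has_real_derivative_iff_has_vector_derivative)
  then show ?thesis
    by (rule DERIV_local_min[where d = 1]) (use u(2) x in auto)
qed

text \<open>By the product rule \<open>V * laplacian u\<close> cancels against a term of the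
  Laplacian of the product, and both sides consist of the same multiples of the mixed gradient term
  and of \<open>laplacian V\<close>. The factor \<open>2 * u x\<close> stays in front because the
  derivative of a square has this form.\<close>

lemma transport_eq_commutator:
  fixes u V :: "real^'n \<Rightarrow> real"
  assumes u: "Ck 2 u" and V: "Ck 2 V"
  shows "- (\<Sum>i\<in>UNIV. partial_deriv i (\<lambda>y. (u y)\<^sup>2 * partial_deriv i V y) x)
     = 2 * u x * ((V x * laplacian u x - laplacian (\<lambda>y. V y * u y) x) / 2)"
proof -
  have u2: "Ck (Suc (Suc 0)) u" and V2: "Ck (Suc (Suc 0)) V" using u V by (simp_all only: numeral_2_eq_2)
  have u1: "Ck (Suc 0) u" by (rule Ck_Suc_imp[OF u2])
  have "partial_deriv i (\<lambda>y. (u y)\<^sup>2 * partial_deriv i V y) x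
     = 2 * u x * partial_deriv i u x * partial_deriv i V x + u x * u x * partial_deriv i (partial_deriv i V) x" for i
    unfolding power2_eq_square
    by (subst partial_deriv_mult[OF Ck_mult[OF u1 u1] Ck_Suc_partial[OF V2]], subst partial_deriv_mult[OF u1 u1])
       (simp add: algebra_simps)
  then have "(\<Sum>i\<in>UNIV. partial_deriv i (\<lambda>y. (u y)\<^sup>2 * partial_deriv i V y) x)
     = u x * (2 * (\<Sum>i\<in>UNIV. partial_deriv i V x * partial_deriv i u x) + u x * laplacian V x)"
    by (simp add: laplacian_def sum.distrib sum_distrib_left algebra_simps)
  then show ?thesis unfolding laplacian_mult[OF V u] by (simp add: algebra_simps)
qed

lemma Linf_norm_torus_ge:
  fixes V :: "real^'n \<Rightarrow> real"
  assumes "continuous_on UNIV V" "x \<in> torus_cube L"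
  shows "\<bar>V x\<bar> \<le> Linf_norm_torus L V"
proof -
  have "compact ((\<lambda>x. norm (V x)) ` torus_cube L)"
    by (intro compact_continuous_image continuous_intros continuous_on_subset[OF assms(1)])
       (auto simp: torus_cube_def)
  then have "bdd_above ((\<lambda>x. norm (V x)) ` torus_cube L)"
    by (intro bounded_imp_bdd_above compact_imp_bounded)
  from cSUP_upper[OF assms(2) this] show ?thesis by (simp add: Linf_norm_torus_def)
qed

text \<open>Sampling commutes with multiplication by \<open>V\<close>, so the continuous and the
  discrete commutator can be compared term by term. Grid points lie in the cube, where
  \<open>Linf_norm_torus L V\<close> bounds the values of \<open>V\<close>.\<close>

lemma grid_residual_bound:
  fixes u V :: "real^'n \<Rightarrow> real" and L :: real
  assumes N: "even N" "N > 0" and L: "L > 0" and s: "CARD('n) + 7 \<le> 4 * s"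
    and u: "Ck (2 * (s + 1)) u" "periodic_torus L u" and V: "Ck (2 * (s + 1)) V" "periodic_torus L V"
  shows "vnorm N (\<lambda>j. of_real ((V (grid_pt L N j) * laplacian u (grid_pt L N j)
             - laplacian (\<lambda>y. V y * u y) (grid_pt L N j)) / 2)
           - (Kop L N (DVop L N V (\<lambda>j. of_real (u (grid_pt L N j)))) j
              - DVop L N V (Kop L N (\<lambda>j. of_real (u (grid_pt L N j)))) j))
     \<le> sqrt ((real N / L) ^ CARD('n)) * ((L * CARD('n) / N) ^ (2 * s)
         * (Linf_norm_torus L V * L2_norm_torus L ((laplacian ^^ (s + 1)) u)
            + L2_norm_torus L ((laplacian ^^ (s + 1)) (\<lambda>y. V y * u y))) / 4)"
proof -
  define E where "E w j = Kop L N (\<lambda>j. of_real (w (grid_pt L N j))) j + of_real (laplacian w (grid_pt L N j)) / 2"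
    for w :: "real^'n \<Rightarrow> real" and j
  let ?K = "sqrt ((real N / L) ^ CARD('n))" and ?e = "(L * CARD('n) / N) ^ (2 * s)"
  let ?A = "L2_norm_torus L ((laplacian ^^ (s + 1)) u)"
  let ?B = "L2_norm_torus L ((laplacian ^^ (s + 1)) (\<lambda>y. V y * u y))"
  have split: "(\<lambda>j. of_real ((V (grid_pt L N j) * laplacian u (grid_pt L N j)
             - laplacian (\<lambda>y. V y * u y) (grid_pt L N j)) / 2)
           - (Kop L N (DVop L N V (\<lambda>j. of_real (u (grid_pt L N j)))) j
              - DVop L N V (Kop L N (\<lambda>j. of_real (u (grid_pt L N j)))) j))
     = (\<lambda>j. of_real (V (grid_pt L N j)) * E u j + (- 1) * E (\<lambda>y. V y * u y) j)"
    by (rule ext) (simp add: E_def DVop_def field_simps)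
  have tri: "vnorm N (\<lambda>j. of_real (V (grid_pt L N j)) * E u j + (- 1) * E (\<lambda>y. V y * u y) j)
     \<le> vnorm N (\<lambda>j. of_real (V (grid_pt L N j)) * E u j) + vnorm N (\<lambda>j. (- 1) * E (\<lambda>y. V y * u y) j)"
    by (rule vnorm_triangle)
  have b1: "vnorm N (\<lambda>j. of_real (V (grid_pt L N j)) * E u j) \<le> Linf_norm_torus L V * (?K * (?e * ?A / 4))"
  proof -
    have "vnorm N (\<lambda>j. of_real (V (grid_pt L N j)) * E u j) \<le> L2_set (\<lambda>j. Linf_norm_torus L V * cmod (E u j)) (grid_idx N)"
      unfolding vnorm_L2_set using L
      by (intro L2_set_mono) (auto simp: norm_mult intro!: mult_right_mono Linf_norm_torus_ge Ck_continuous[OF V(1)] grid_pt_in_cube)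
    also have "\<dots> = Linf_norm_torus L V * vnorm N (E u)"
      unfolding vnorm_L2_set
    proof (rule L2_set_right_distrib[symmetric])
      have "0 \<in> torus_cube L" using L by (simp add: torus_cube_def mem_box_cart)
      then have "\<bar>V 0\<bar> \<le> Linf_norm_torus L V" by (rule Linf_norm_torus_ge[OF Ck_continuous[OF V(1)]])
      then show "0 \<le> Linf_norm_torus L V" by linarith
    qed
    also have "\<dots> \<le> Linf_norm_torus L V * (?K * (?e * ?A / 4))"
    proof (rule mult_left_mono)
      show "vnorm N (E u) \<le> ?K * (?e * ?A / 4)"
        using laplacian_grid_error[OF N L s u] by (simp only: E_def[abs_def])
      have "0 \<in> torus_cube L" using L by (simp add: torus_cube_def mem_box_cart)
      then have "\<bar>V 0\<bar> \<le> Linf_norm_torus L V" by (rule Linf_norm_torus_ge[OF Ck_continuous[OF V(1)]])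
      then show "0 \<le> Linf_norm_torus L V" by linarith
    qed
    finally show ?thesis .
  qed
  have b2: "vnorm N (\<lambda>j. (- 1) * E (\<lambda>y. V y * u y) j) \<le> ?K * (?e * ?B / 4)"
    unfolding vnorm_cmult
    using laplacian_grid_error[OF N L s Ck_mult[OF V(1) u(1)] periodic_torus_mult[OF V(2) u(2)]]
    by (simp only: E_def[abs_def] norm_minus_cancel norm_one mult_1)
  have alg: "Linf_norm_torus L V * (?K * (?e * ?A / 4)) + ?K * (?e * ?B / 4)
      = ?K * (?e * (Linf_norm_torus L V * ?A + ?B) / 4)"
  proof -
    have "x * (k * (c * a / 4)) + k * (c * b / 4) = k * (c * (x * a + b) / 4)" for x k c a b :: real
      by (simp add: field_simps)
    then show ?thesis .
  qed
  show ?thesis unfolding split by (rule order_trans[OF tri add_mono[OF b1 b2], unfolded alg])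
qed

text \<open>Normalisation replaces the residual \<open>e\<close> by \<open>r\<close>, which also
  contains the derivative of the norm; this costs the factor 2. The commutator is linear and skew,
  so only \<open>r\<close> drives the squared distance, and \<open>sqrt_growth\<close> takes the
  root even at times where the distance is 0.\<close>

lemma normalized_flow_bound:
  fixes U phi e :: "real \<Rightarrow> ('n::finite \<Rightarrow> nat) \<Rightarrow> complex" and T L :: real
  assumes T: "T > 0"
    and A: "\<And>t v j. A t v j = Kop L N (DVop L N (V t) v) j - DVop L N (V t) (Kop L N v) j"
    and U: "\<And>t j. t \<in> {0..T} \<Longrightarrow> j \<in> grid_idx N \<Longrightarrow>
          ((\<lambda>\<tau>. U \<tau> j) has_vector_derivative A t (U t) j + e t j) (at t within {0..T})"
    and phi: "\<And>t j. t \<in> {0..T} \<Longrightarrow> j \<in> grid_idx N \<Longrightarrow>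
          ((\<lambda>\<tau>. phi \<tau> j) has_vector_derivative A t (phi t) j) (at t within {0..T})"
    and pos: "\<And>t. t \<in> {0..T} \<Longrightarrow> vnorm N (U t) > 0"
    and e: "\<And>t. t \<in> {0..T} \<Longrightarrow> 2 * vnorm N (e t) \<le> R * vnorm N (U t)"
  shows "vnorm N (\<lambda>j. U T j /\<^sub>R vnorm N (U T) - phi T j)
     \<le> vnorm N (\<lambda>j. U 0 j /\<^sub>R vnorm N (U 0) - phi 0 j) + R * T"
proof -
  define n where "n t = vnorm N (U t)" for t
  define W where "W t j = U t j /\<^sub>R n t" for t j
  define D where "D t j = W t j - phi t j" for t j
  \<comment> \<open>The derivative of the norm \<open>n\<close>: the commutator part of the
    derivative of \<open>U\<close> drops out by skewness.\<close>
  define n' where "n' t = (\<Sum>j\<in>grid_idx N. W t j \<bullet> e t j)" for t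
  define r where "r t j = (e t j - n' t *\<^sub>R W t j) /\<^sub>R n t" for t j
  have n0: "n t > 0" if "t \<in> {0..T}" for t using pos[OF that] by (simp add: n_def)
  have sq: "(vnorm N v)\<^sup>2 = (\<Sum>j\<in>grid_idx N. v j \<bullet> v j)" for v :: "('n \<Rightarrow> nat) \<Rightarrow> complex"
    by (simp add: vnorm_sq power2_norm_eq_inner)
  have skew: "(\<Sum>j\<in>grid_idx N. v j \<bullet> A t v j) = 0" for t v
    unfolding A by (rule commutator_skew)
  have A_scale: "A t (\<lambda>j. v j /\<^sub>R c) j = A t v j /\<^sub>R c" for t v c j
  proof -
    have "(\<lambda>j. v j /\<^sub>R c) = (\<lambda>j. of_real (1 / c) * v j)"
      by (simp add: fun_eq_iff scaleR_conv_of_real divide_inverse)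
    moreover have "DVop L N (V t) (\<lambda>j. of_real (1 / c) * v j) = (\<lambda>j. of_real (1 / c) * DVop L N (V t) v j)"
      by (simp add: fun_eq_iff DVop_def)
    ultimately show ?thesis
      unfolding A by (simp add: Kop_cmult DVop_def scaleR_conv_of_real divide_inverse right_diff_distrib)
  qed
  have A_diff: "A t (\<lambda>j. v j - w j) j = A t v j - A t w j" for t v w j
  proof -
    have "DVop L N (V t) (\<lambda>j. v j - w j) = (\<lambda>j. DVop L N (V t) v j - DVop L N (V t) w j)"
      by (simp add: fun_eq_iff DVop_def right_diff_distrib)
    then show ?thesis unfolding A by (simp add: Kop_diff DVop_def algebra_simps)
  qed
  have sq_deriv: "((\<lambda>\<tau>. \<Sum>j\<in>grid_idx N. X \<tau> j \<bullet> X \<tau> j) has_real_derivative 2 * (\<Sum>j\<in>grid_idx N. X t j \<bullet> y j)) (at t within {0..T})"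
    if X: "\<And>j. j \<in> grid_idx N \<Longrightarrow> ((\<lambda>\<tau>. X \<tau> j) has_vector_derivative A t (X t) j + y j) (at t within {0..T})"
    for X :: "real \<Rightarrow> ('n \<Rightarrow> nat) \<Rightarrow> complex" and y t
  proof -
    have "((\<lambda>\<tau>. X \<tau> j \<bullet> X \<tau> j) has_real_derivative 2 * (X t j \<bullet> (A t (X t) j + y j))) (at t within {0..T})"
      if j: "j \<in> grid_idx N" for j
    proof -
      note dX = X[OF j, unfolded has_vector_derivative_def]
      show ?thesis unfolding has_field_derivative_def
        by (rule has_derivative_eq_rhs[OF has_derivative_inner[OF dX dX]])
           (auto simp: fun_eq_iff inner_commute algebra_simps)
    qed
    then have "((\<lambda>\<tau>. \<Sum>j\<in>grid_idx N. X \<tau> j \<bullet> X \<tau> j) has_real_derivative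
        (\<Sum>j\<in>grid_idx N. 2 * (X t j \<bullet> (A t (X t) j + y j)))) (at t within {0..T})"
      by (rule DERIV_sum)
    moreover have "(\<Sum>j\<in>grid_idx N. 2 * (X t j \<bullet> (A t (X t) j + y j))) = 2 * (\<Sum>j\<in>grid_idx N. X t j \<bullet> y j)"
      by (simp add: inner_add_right sum.distrib skew flip: sum_distrib_left)
    ultimately show ?thesis by simp
  qed
  have n_deriv: "(n has_real_derivative n' t) (at t within {0..T})" if t: "t \<in> {0..T}" for t
  proof -
    have ns: "n \<tau> = sqrt (\<Sum>j\<in>grid_idx N. U \<tau> j \<bullet> U \<tau> j)" for \<tau>
      unfolding sq[symmetric] n_def by simp
    have "0 < (\<Sum>j\<in>grid_idx N. U t j \<bullet> U t j)" using n0[OF t] unfolding ns by simp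
    then have "((\<lambda>\<tau>. sqrt (\<Sum>j\<in>grid_idx N. U \<tau> j \<bullet> U \<tau> j)) has_real_derivative
        inverse (sqrt (\<Sum>j\<in>grid_idx N. U t j \<bullet> U t j)) / 2 * (2 * (\<Sum>j\<in>grid_idx N. U t j \<bullet> e t j))) (at t within {0..T})"
      by (intro DERIV_chain'[OF sq_deriv[OF U[OF t]]] DERIV_real_sqrt)
    then show ?thesis
      unfolding ns[symmetric] by (simp add: n'_def W_def sum_distrib_left)
  qed
  have W_deriv: "((\<lambda>\<tau>. W \<tau> j) has_vector_derivative A t (W t) j + r t j) (at t within {0..T})"
    if t: "t \<in> {0..T}" and j: "j \<in> grid_idx N" for t j
  proof -
    have inv: "((\<lambda>\<tau>. inverse (n \<tau>)) has_real_derivative - (inverse (n t) * n' t * inverse (n t))) (at t within {0..T})"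
      using n0[OF t] by (intro DERIV_inverse' n_deriv[OF t]) auto
    have "((\<lambda>\<tau>. inverse (n \<tau>) *\<^sub>R U \<tau> j) has_vector_derivative
        (inverse (n t) *\<^sub>R (A t (U t) j + e t j) + (- (inverse (n t) * n' t * inverse (n t))) *\<^sub>R U t j)) (at t within {0..T})"
      by (rule has_vector_derivative_scaleR[OF inv U[OF t j]])
    moreover have "A t (W t) j = A t (U t) j /\<^sub>R n t"
      unfolding W_def by (rule A_scale)
    ultimately show ?thesis
      by (simp add: W_def r_def scaleR_diff_right scaleR_add_right mult_ac add_diff_eq)
  qed
  have D_deriv: "((\<lambda>\<tau>. D \<tau> j) has_vector_derivative A t (D t) j + r t j) (at t within {0..T})"
    if t: "t \<in> {0..T}" and j: "j \<in> grid_idx N" for t j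
  proof -
    have "A t (D t) j = A t (W t) j - A t (phi t) j" unfolding D_def by (rule A_diff)
    then have eq: "A t (D t) j + r t j = A t (W t) j + r t j - A t (phi t) j" by simp
    show ?thesis
      unfolding eq using has_vector_derivative_diff[OF W_deriv[OF t j] phi[OF t j]] by (simp only: D_def)
  qed
  have W1: "vnorm N (W t) = 1" if t: "t \<in> {0..T}" for t
  proof -
    have "vnorm N (W t) = vnorm N (\<lambda>j. of_real (1 / n t) * U t j)"
      by (intro arg_cong[where f = "vnorm N"]) (simp add: W_def[abs_def] fun_eq_iff scaleR_conv_of_real divide_inverse)
    then show ?thesis using n0[OF t] unfolding vnorm_cmult by (simp add: norm_divide flip: n_def)
  qed
  have r: "vnorm N (r t) \<le> R" if t: "t \<in> {0..T}" for t
  proof -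
    have "\<bar>n' t\<bar> \<le> vnorm N (W t) * vnorm N (e t)" unfolding n'_def by (rule vnorm_inner_le)
    then have n': "\<bar>n' t\<bar> \<le> vnorm N (e t)" by (simp add: W1[OF t])
    have "r t = (\<lambda>j. of_real (1 / n t) * (e t j + of_real (- n' t) * W t j))"
      by (simp add: r_def[abs_def] fun_eq_iff scaleR_conv_of_real divide_inverse)
    then have "vnorm N (r t) = \<bar>1 / n t\<bar> * vnorm N (\<lambda>j. e t j + of_real (- n' t) * W t j)"
      by (simp only: vnorm_cmult norm_of_real)
    also have "\<dots> \<le> \<bar>1 / n t\<bar> * (vnorm N (e t) + vnorm N (\<lambda>j. of_real (- n' t) * W t j))"
      by (intro mult_left_mono vnorm_triangle) auto
    also have "\<dots> = (vnorm N (e t) + \<bar>n' t\<bar>) / n t"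
      unfolding vnorm_cmult W1[OF t] norm_of_real using n0[OF t] by simp
    also have "\<dots> \<le> (2 * vnorm N (e t)) / n t" using n' n0[OF t] by (intro divide_right_mono) auto
    also have "\<dots> \<le> R" using e[OF t] n0[OF t] by (simp add: divide_le_eq n_def)
    finally show ?thesis .
  qed
  have R: "R \<ge> 0" by (rule order_trans[OF vnorm_nonneg r[of 0]]) (use T in simp)
  have "sqrt (\<Sum>j\<in>grid_idx N. D T j \<bullet> D T j) \<le> sqrt (\<Sum>j\<in>grid_idx N. D 0 j \<bullet> D 0 j) + R * \<bar>T - 0\<bar>"
  proof (rule sqrt_growth[where S = "{0..T}" and h = "\<lambda>t. \<Sum>j\<in>grid_idx N. D t j \<bullet> D t j"])
    fix t assume t: "t \<in> {0..T}"
    show "((\<lambda>t. \<Sum>j\<in>grid_idx N. D t j \<bullet> D t j) has_real_derivative 2 * (\<Sum>j\<in>grid_idx N. D t j \<bullet> r t j)) (at t within {0..T})"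
      by (rule sq_deriv[OF D_deriv[OF t]])
    show "0 \<le> (\<Sum>j\<in>grid_idx N. D t j \<bullet> D t j)" by (intro sum_nonneg) auto
    have "\<bar>\<Sum>j\<in>grid_idx N. D t j \<bullet> r t j\<bar> \<le> vnorm N (D t) * vnorm N (r t)" by (rule vnorm_inner_le)
    also have "\<dots> \<le> vnorm N (D t) * R" by (intro mult_left_mono r[OF t]) auto
    finally show "\<bar>2 * (\<Sum>j\<in>grid_idx N. D t j \<bullet> r t j)\<bar> \<le> 2 * R * sqrt (\<Sum>j\<in>grid_idx N. D t j \<bullet> D t j)"
      unfolding sq[symmetric] by (simp add: abs_mult mult_ac)
  qed (use T R in auto)
  then show ?thesis
    unfolding sq[symmetric] using T by (simp add: D_def[abs_def] W_def n_def)
qed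

theorem theorem1:
  fixes L T :: real and N s :: nat
    and p V :: "real \<Rightarrow> real^'n \<Rightarrow> real"
    and psi phi :: "real \<Rightarrow> ('n \<Rightarrow> nat) \<Rightarrow> complex"
  assumes L_pos: "L > 0" and T_pos: "T > 0"
    and N_pow2: "\<exists>k. N = 2 ^ k" and N_ge2: "N \<ge> 2"
    and s_bound: "4 * real s \<ge> real CARD('n) + 7"
    and p_nonneg: "\<And>t x. t \<in> {0..T} \<Longrightarrow> p t x \<ge> 0"
    and p_per: "\<And>t. t \<in> {0..T} \<Longrightarrow> periodic_torus L (p t)"
    and p_int: "\<And>t. t \<in> {0..T} \<Longrightarrow> integral (torus_cube L) (p t) = 1"
    and V_per: "\<And>t. t \<in> {0..T} \<Longrightarrow> periodic_torus L (V t)"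
    and cont_eq: "\<And>t x. t \<in> {0..T} \<Longrightarrow>
        ((\<lambda>\<tau>. p \<tau> x) has_real_derivative
           - (\<Sum>i\<in>UNIV. partial_deriv i (\<lambda>y. p t y * partial_deriv i (V t) y) x)) (at t within {0..T})"
    and sqrtp_reg: "\<And>t. t \<in> {0..T} \<Longrightarrow> Ck (2 * (s + 1)) (\<lambda>y. sqrt (p t y))"
    and V_reg: "\<And>t. t \<in> {0..T} \<Longrightarrow> Ck (2 * (s + 1)) (V t)"
    and V_cont_t: "\<And>x. continuous_on {0..T} (\<lambda>t. V t x)"
    and lap_sqrtp_cont_t: "\<And>x. continuous_on {0..T} (\<lambda>t. laplacian (\<lambda>y. sqrt (p t y)) x)"
    and lap_Vsqrtp_cont_t: "\<And>x. continuous_on {0..T} (\<lambda>t. laplacian (\<lambda>y. V t y * sqrt (p t y)) x)"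
    and psi_def: "\<And>t. t \<in> {0..T} \<Longrightarrow> vnorm N (psi t) = 1 \<and>
        (\<exists>c>0. \<forall>j\<in>grid_idx N. psi t j = of_real (c * sqrt (p t (grid_pt L N j))))"
    and phi0_unit: "vnorm N (phi 0) = 1"
    and phi_ode: "\<And>t j. t \<in> {0..T} \<Longrightarrow> j \<in> grid_idx N \<Longrightarrow>
        ((\<lambda>\<tau>. phi \<tau> j) has_vector_derivative (- \<i> * Hc L N (V t) (phi t) j)) (at t within {0..T})"
    and cs_bdd: "bdd_above ((\<lambda>t. (Linf_norm_torus L (V t) + 1)
            * L2_norm_torus L ((laplacian ^^ (s + 1)) (\<lambda>y. sqrt (p t y)))
          + L2_norm_torus L ((laplacian ^^ (s + 1)) (\<lambda>y. V t y * sqrt (p t y)))) ` {0..T})"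
    and delta_le: "vnorm N (\<lambda>j. psi 0 j - phi 0 j)
        + T * (3 * (SUP t\<in>{0..T}. (Linf_norm_torus L (V t) + 1)
                 * L2_norm_torus L ((laplacian ^^ (s + 1)) (\<lambda>y. sqrt (p t y)))
               + L2_norm_torus L ((laplacian ^^ (s + 1)) (\<lambda>y. V t y * sqrt (p t y)))) + 1)
            * (L * real CARD('n) / real N) ^ (2 * s) \<le> T"
  shows "vnorm N (\<lambda>j. psi T j - phi T j) \<le>
        vnorm N (\<lambda>j. psi 0 j - phi 0 j)
        + T * (3 * (SUP t\<in>{0..T}. (Linf_norm_torus L (V t) + 1)
                 * L2_norm_torus L ((laplacian ^^ (s + 1)) (\<lambda>y. sqrt (p t y)))
               + L2_norm_torus L ((laplacian ^^ (s + 1)) (\<lambda>y. V t y * sqrt (p t y)))) + 1)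
            * (L * real CARD('n) / real N) ^ (2 * s)"
proof -
  define u where "u t y = sqrt (p t y)" for t y
  define g where "g t x = (V t x * laplacian (u t) x - laplacian (\<lambda>y. V t y * u t y) x) / 2" for t x
  define G where "G t = (Linf_norm_torus L (V t) + 1) * L2_norm_torus L ((laplacian ^^ (s + 1)) (u t))
      + L2_norm_torus L ((laplacian ^^ (s + 1)) (\<lambda>y. V t y * u t y))" for t
  define M where "M = (SUP t\<in>{0..T}. G t)"
  define d where "d = (L * real CARD('n) / real N) ^ (2 * s)"
  define K where "K = sqrt ((real N / L) ^ CARD('n))"
  define U where "U t j = complex_of_real (u t (grid_pt L N j))" for t j
  define A where "A t v j = Kop L N (DVop L N (V t) v) j - DVop L N (V t) (Kop L N v) j" for t v j
  define e where "e t j = of_real (g t (grid_pt L N j)) - A t (U t) j" for t j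
  obtain k where k: "N = 2 ^ k" using N_pow2 by blast
  then have N: "even N" "N > 0" using N_ge2 by (cases k; simp)+
  have s: "CARD('n) + 7 \<le> 4 * s" using s_bound by linarith
  have K: "K > 0" using L_pos N by (simp add: K_def)
  have d: "d > 0" using L_pos N by (simp add: d_def)
  have u0: "0 \<le> u t y" if "t \<in> {0..T}" for t y using p_nonneg[OF that] by (simp add: u_def)
  have pu: "p t = (\<lambda>y. (u t y)\<^sup>2)" if "t \<in> {0..T}" for t using p_nonneg[OF that] by (simp add: u_def fun_eq_iff)
  have u: "Ck (2 * (s + 1)) (u t)" "periodic_torus L (u t)" if "t \<in> {0..T}" for t
    using sqrtp_reg[OF that] p_per[OF that] by (simp_all only: u_def[abs_def]) (simp add: periodic_torus_def)
  have two: "Ck 2 f" "Ck (Suc 0) f" if "Ck (2 * (s + 1)) f" for f :: "real^'n \<Rightarrow> real"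
    by (rule Ck_mono[OF _ that]; simp)+
  have lap_cont: "continuous_on UNIV ((laplacian ^^ (s + 1)) f)" if "Ck (2 * (s + 1)) f" for f :: "real^'n \<Rightarrow> real"
    by (rule Ck_continuous[of 0], rule Ck_laplacian_funpow) (use that in \<open>simp only: add_0\<close>)
  have unit: "integral (torus_cube L) (\<lambda>x. (u t x)\<^sup>2) = 1" if "t \<in> {0..T}" for t
    using p_int[OF that] unfolding pu[OF that] .
  have A_nonneg: "0 \<le> L2_norm_torus L ((laplacian ^^ (s + 1)) (u t))" if "t \<in> {0..T}" for t
    by (intro L2_norm_torus_nonneg lap_cont u that)
  have Linf: "0 \<le> Linf_norm_torus L (V t)" if "t \<in> {0..T}" for t
  proof -
    have "0 \<in> torus_cube L" using L_pos by (simp add: torus_cube_def mem_box_cart)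
    then have "\<bar>V t 0\<bar> \<le> Linf_norm_torus L (V t)" by (rule Linf_norm_torus_ge[OF Ck_continuous[OF V_reg[OF that]]])
    then show ?thesis by linarith
  qed
  have AV_nonneg: "0 \<le> L2_norm_torus L ((laplacian ^^ (s + 1)) (\<lambda>y. V t y * u t y))" if "t \<in> {0..T}" for t
    by (intro L2_norm_torus_nonneg lap_cont Ck_mult V_reg u that)
  have GM: "G t \<le> M" if "t \<in> {0..T}" for t
    unfolding M_def by (rule cSUP_upper[OF that]) (use cs_bdd in \<open>simp only: G_def u_def[abs_def]\<close>)
  \<comment> \<open>The 1 added to the supremum norm of \<open>V\<close> lets \<open>G\<close>
    control the norm belonging to \<open>u\<close> alone; the other terms are nonnegative.\<close>
  have AG: "L2_norm_torus L ((laplacian ^^ (s + 1)) (u t)) \<le> M" if t: "t \<in> {0..T}" for t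
    using GM[OF t] AV_nonneg[OF t] mult_nonneg_nonneg[OF Linf[OF t] A_nonneg[OF t]]
    by (simp add: G_def distrib_right)
  have M0: "0 \<le> M" using AG[of 0] A_nonneg[of 0] T_pos by simp
  have delta: "vnorm N (\<lambda>j. psi 0 j - phi 0 j) + T * (3 * M + 1) * d \<le> T"
    using delta_le by (simp only: M_def G_def u_def[abs_def] d_def)
  \<comment> \<open>Dropping the nonnegative initial distance and dividing by \<open>T\<close> gives
    \<open>(3 * M + 1) * d \<le> 1\<close>, which bounds \<open>3 * M * d\<close> and
    \<open>d\<close> separately.\<close>
  have "T * ((3 * M + 1) * d) \<le> T * 1"
    using delta vnorm_nonneg[of N "\<lambda>j. psi 0 j - phi 0 j"] by (simp only: mult.assoc)
  then have small: "(3 * M + 1) * d \<le> 1" using T_pos by (simp only: mult_le_cancel_left_pos)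
  have Md: "3 * M * d \<le> 1" "d \<le> 1"
    using small mult_nonneg_nonneg[OF M0 less_imp_le[OF d]] d by (simp_all add: distrib_right)
  \<comment> \<open>A ratio above 1 would have its power \<open>d\<close> above 1, since the
    exponent \<open>2 * s\<close> is positive.\<close>
  have fine: "L * real CARD('n) / real N \<le> 1"
  proof (rule ccontr)
    assume "\<not> ?thesis"
    moreover have "0 < 2 * s" using s by simp
    ultimately have "1 < d" unfolding d_def by (intro one_less_power) auto
    then show False using Md by simp
  qed
  have Un: "K / 2 \<le> vnorm N (U t)" if t: "t \<in> {0..T}" for t
    unfolding K_def U_def[abs_def]
  proof (rule grid_norm_lower[OF N L_pos s u[OF t] unit[OF t] _ fine])
    have "3 * L2_norm_torus L ((laplacian ^^ (s + 1)) (u t)) * d \<le> 3 * M * d"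
      using AG[OF t] d by (intro mult_right_mono) auto
    then show "3 * L2_norm_torus L ((laplacian ^^ (s + 1)) (u t)) * (L * real CARD('n) / real N) ^ (2 * s) \<le> 1"
      using Md unfolding d_def by linarith
  qed
  have u_deriv: "((\<lambda>\<tau>. u \<tau> x) has_real_derivative g t x) (at t within {0..T})" if t: "t \<in> {0..T}" for t x
  proof (rule has_real_derivative_of_square[where f = "\<lambda>\<tau>. u \<tau> x" and g = "\<lambda>\<tau>. g \<tau> x", OF _ _ _ _ t])
    fix \<tau> assume \<tau>: "\<tau> \<in> {0..T}"
    have "((\<lambda>\<tau>. p \<tau> x) has_real_derivative 2 * u \<tau> x * g \<tau> x) (at \<tau> within {0..T})"
      using cont_eq[OF \<tau>, of x] unfolding pu[OF \<tau>] g_def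
        transport_eq_commutator[OF two(1)[OF u(1)[OF \<tau>]] two(1)[OF V_reg[OF \<tau>]]] .
    then show "((\<lambda>\<tau>. (u \<tau> x)\<^sup>2) has_real_derivative 2 * u \<tau> x * g \<tau> x) (at \<tau> within {0..T})"
      by (rule has_field_derivative_transform_within[where d = 1]) (use \<tau> pu in auto)
    \<comment> \<open>The point minimises the nonnegative function \<open>u \<tau>\<close>, so first
      derivatives vanish; once \<open>laplacian_mult\<close> is expanded, each surviving term of
      \<open>g\<close> has a factor \<open>u\<close> or a first derivative of
      \<open>u\<close>.\<close>
    show "g \<tau> x = 0" if z: "u \<tau> x = 0"
    proof -
      have "partial_deriv i (u \<tau>) x = 0" for i
        by (rule partial_deriv_at_zero[OF two(2)[OF u(1)[OF \<tau>]] u0[OF \<tau>] z])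
      then show ?thesis
        unfolding g_def laplacian_mult[OF two(1)[OF V_reg[OF \<tau>]] two(1)[OF u(1)[OF \<tau>]]] using z by simp
    qed
  next
    show "continuous_on {0..T} (\<lambda>\<tau>. g \<tau> x)"
      unfolding g_def u_def[abs_def]
      by (intro continuous_intros V_cont_t lap_sqrtp_cont_t lap_Vsqrtp_cont_t) simp
  qed (use u0 in auto)
  have R: "2 * vnorm N (e t) \<le> (3 * M + 1) * d * vnorm N (U t)" if t: "t \<in> {0..T}" for t
  proof -
    have "vnorm N (e t) \<le> K * (d * (Linf_norm_torus L (V t) * L2_norm_torus L ((laplacian ^^ (s + 1)) (u t))
            + L2_norm_torus L ((laplacian ^^ (s + 1)) (\<lambda>y. V t y * u t y))) / 4)"
      using grid_residual_bound[OF N L_pos s u[OF t] V_reg[OF t] V_per[OF t]]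
      by (simp only: e_def[abs_def] A_def U_def[abs_def] g_def K_def d_def)
    also have "\<dots> \<le> K * (d * M / 4)"
      using GM[OF t] A_nonneg[OF t] K d
      by (intro mult_left_mono divide_right_mono) (auto simp: G_def distrib_right)
    \<comment> \<open>\<open>K / 2\<close> is the lower bound \<open>Un\<close> for the norm of
      \<open>U t\<close>, so the residual is measured relative to the norm itself.\<close>
    finally have "2 * vnorm N (e t) \<le> (M * d) * (K / 2)" by (simp add: mult_ac)
    also have "\<dots> \<le> ((3 * M + 1) * d) * vnorm N (U t)"
      using Un[OF t] M0 d K by (intro mult_mono mult_right_mono) auto
    finally show ?thesis .
  qed
  \<comment> \<open>A positive multiple of \<open>U t\<close> with norm 1 has its factor fixed as
    the inverse of the norm; values off the grid do not enter \<open>vnorm\<close>.\<close>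
  have psi: "vnorm N (\<lambda>j. psi t j - phi t j) = vnorm N (\<lambda>j. U t j /\<^sub>R vnorm N (U t) - phi t j)" if t: "t \<in> {0..T}" for t
  proof -
    obtain c where c: "c > 0" "\<And>j. j \<in> grid_idx N \<Longrightarrow> psi t j = of_real c * U t j"
      using psi_def[OF t] by (auto simp: U_def u_def)
    have "vnorm N (psi t) = vnorm N (\<lambda>j. of_real c * U t j)"
      unfolding vnorm_def by (simp add: c(2))
    then have "c * vnorm N (U t) = 1" using psi_def[OF t] c(1) by (simp add: vnorm_cmult)
    then have "c = inverse (vnorm N (U t))"
      by (metis inverse_unique mult.commute)
    then have "psi t j = U t j /\<^sub>R vnorm N (U t)" if "j \<in> grid_idx N" for j
      using c(2)[OF that] by (simp add: scaleR_conv_of_real)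
    then show ?thesis unfolding vnorm_def by simp
  qed
  have "vnorm N (\<lambda>j. U T j /\<^sub>R vnorm N (U T) - phi T j)
     \<le> vnorm N (\<lambda>j. U 0 j /\<^sub>R vnorm N (U 0) - phi 0 j) + (3 * M + 1) * d * T"
  proof (rule normalized_flow_bound[OF T_pos A_def _ _ _ R])
    show "((\<lambda>\<tau>. U \<tau> j) has_vector_derivative A t (U t) j + e t j) (at t within {0..T})"
      if "t \<in> {0..T}" "j \<in> grid_idx N" for t j
      unfolding U_def[abs_def] e_def using has_vector_derivative_of_real[OF u_deriv[OF that(1)]] by simp
    show "((\<lambda>\<tau>. phi \<tau> j) has_vector_derivative A t (phi t) j) (at t within {0..T})"
      if "t \<in> {0..T}" "j \<in> grid_idx N" for t j
      using phi_ode[OF that] unfolding Hc_eq A_def .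
    show "0 < vnorm N (U t)" if "t \<in> {0..T}" for t using Un[OF that] K by linarith
  qed
  then have "vnorm N (\<lambda>j. psi T j - phi T j) \<le> vnorm N (\<lambda>j. psi 0 j - phi 0 j) + T * (3 * M + 1) * d"
    using psi[of T] psi[of 0] T_pos by (simp add: mult_ac)
  then show ?thesis by (simp only: M_def G_def u_def[abs_def] d_def)
qed

end
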